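(* Let $g:\mathbb{R}\to\mathbb{R}$ be continuous and increasing, and suppose that $G(x)=E_x\left[\int_0^\infty g(X_t)e^{-rt}\,dt\right]$ satisfies $|G(x)|<\infty$ for all $x\in\mathbb{R}$. Let $\kappa(x):=\frac1rE_0\left[g\left(x+\underline{X}'_{T'(r)}\right)\right]$ and consider, for $c\in\mathbb{R}$, the optimal stopping problem $$v(x,c)=\inf_{\tau\ge0}E_x\left[\int_0^\tau g(X_t)e^{-rt}\,dt+ce^{-r\tau}\right].$$ Then, for each given $c\in\mathbb{R}$, the stopping region $\mathcal{D}_c=\{x\in\mathbb{R}:v(x,c)=c\}$ and the continuation region $\mathcal{C}_c=\{x\in\mathbb{R}:v(x,c)<c\}$ are $$\mathcal{D}_c=\{x\in\mathbb{R}:\kappa(x)\ge c\},\qquad \mathcal{C}_c=\{x\in\mathbb{R}:\kappa(x)<c\},$$ and the stopping time $\tau^*(c)=\inf\{t\ge0:\kappa(X_t)\ge c\}$ is optimal for this problem.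
   Context: $X=(X_t)_{t\ge0}$ is a real-valued Lévy process with $X_0=x$ under $P_x$ ($x\in\mathbb{R}$), $E_x$ denotes expectation under $P_x$, and $r>0$ is a constant. The infimum defining $v$ is over stopping times $\tau$ of the natural filtration of $X$, which may take the value $+\infty$ (with $e^{-r\tau}=0$ there). $X'$ is an independent copy of $X$, $T'(r)$ is an exponentially distributed random variable with parameter $r$ independent of $X$ and $X'$, and $\underline{X}'_t=\inf_{0\le s\le t}X'_s$ (with $X'_0=0$ under $P_0$). *)

theory Defs
  imports "HOL-Probability.Probability"
begin

section \<open>Levy processes\<close>

text \<open>A process is a function \<open>X :: real \<Rightarrow> 'a \<Rightarrow> real\<close> of which only the times \<open>t \<ge> 0\<close> matter.\<close>

definition cadlag :: "(real \<Rightarrow> real) \<Rightarrow> bool" where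
  "cadlag f \<longleftrightarrow>
     (\<forall>t\<ge>0. (f \<longlongrightarrow> f t) (at_right t)) \<and> (\<forall>t>0. \<exists>l. (f \<longlongrightarrow> l) (at_left t))"

text \<open>The initial value is left free here. All paths, rather than almost all of them, are
  cadlag, so that path functionals such as running infima are random variables without completing
  the space.\<close>

definition levy_process :: "'a measure \<Rightarrow> (real \<Rightarrow> 'a \<Rightarrow> real) \<Rightarrow> bool" where
  "levy_process M X \<longleftrightarrow>
     prob_space M \<and>
     (\<forall>t\<ge>0. X t \<in> borel_measurable M) \<and>
     (\<forall>\<omega>\<in>space M. cadlag (\<lambda>t. X t \<omega>)) \<and>
     (\<forall>n (t :: nat \<Rightarrow> real). 0 \<le> t 0 \<and> (\<forall>i<n. t i \<le> t (Suc i)) \<longrightarrow>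
        prob_space.indep_vars M (\<lambda>_. borel) (\<lambda>i \<omega>. X (t (Suc i)) \<omega> - X (t i) \<omega>) {..<n}) \<and>
     (\<forall>s\<ge>0. \<forall>h\<ge>0.
        distr M borel (\<lambda>\<omega>. X (s + h) \<omega> - X s \<omega>) = distr M borel (\<lambda>\<omega>. X h \<omega> - X 0 \<omega>))"

definition path_space :: "(real \<Rightarrow> real) measure" where
  "path_space = (\<Pi>\<^sub>M t\<in>{0..}. borel)"

definition sample_path :: "(real \<Rightarrow> 'a \<Rightarrow> real) \<Rightarrow> 'a \<Rightarrow> real \<Rightarrow> real" where
  "sample_path X \<omega> = (\<lambda>t\<in>{0..}. X t \<omega>)"

text \<open>The measures \<open>P x\<close> live on one measurable space; under \<open>P x\<close> the process starts in \<open>x\<close>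
  and has the law of \<open>x + X\<close> under \<open>P 0\<close>.\<close>

definition levy_family :: "(real \<Rightarrow> 'a measure) \<Rightarrow> (real \<Rightarrow> 'a \<Rightarrow> real) \<Rightarrow> bool" where
  "levy_family P X \<longleftrightarrow>
     (\<forall>x. sets (P x) = sets (P 0)) \<and>
     (\<forall>x. levy_process (P x) X) \<and>
     (\<forall>x. AE \<omega> in P x. X 0 \<omega> = x) \<and>
     (\<forall>x. distr (P x) path_space (sample_path X) =
          distr (P 0) path_space (sample_path (\<lambda>t \<omega>. x + X t \<omega>)))"

text \<open>Independence of two random variables with values in different types; the library's
  \<open>indep_var\<close> needs equal types.\<close>

definition indep_rv ::
  "'a measure \<Rightarrow> 'b measure \<Rightarrow> ('a \<Rightarrow> 'b) \<Rightarrow> 'c measure \<Rightarrow> ('a \<Rightarrow> 'c) \<Rightarrow> bool" where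
  "indep_rv M N Y K Z \<longleftrightarrow>
     Y \<in> measurable M N \<and> Z \<in> measurable M K \<and>
     prob_space.indep_set M {Y -` A \<inter> space M | A. A \<in> sets N} {Z -` B \<inter> space M | B. B \<in> sets K}"

definition independent_copy ::
  "'a measure \<Rightarrow> (real \<Rightarrow> 'a \<Rightarrow> real) \<Rightarrow> (real \<Rightarrow> 'a \<Rightarrow> real) \<Rightarrow> bool" where
  "independent_copy M X X' \<longleftrightarrow>
     levy_process M X' \<and>
     distr M path_space (sample_path X') = distr M path_space (sample_path X) \<and>
     indep_rv M path_space (sample_path X) path_space (sample_path X')"

section \<open>The optimal stopping problem\<close>

text \<open>Natural filtration of \<open>X\<close>, augmented by the null sets of the completion of \<open>M\<close>. Without
  them the entrance time of \<open>X\<close> into a closed half-line need not be a stopping time. The time index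
  is \<open>ennreal\<close> in order that \<open>stopping_time (nat_filtration M X)\<close> covers times with value \<open>\<infinity>\<close>; the
  condition at index \<open>\<infinity>\<close> is void.\<close>

definition nat_filtration :: "'a measure \<Rightarrow> (real \<Rightarrow> 'a \<Rightarrow> real) \<Rightarrow> ennreal \<Rightarrow> 'a measure" where
  "nat_filtration M X t =
     sigma (space M)
       ({X s -` A \<inter> space M | s A. 0 \<le> s \<and> ennreal s \<le> t \<and> A \<in> sets borel} \<union>
        null_sets (completion M))"

definition discount :: "real \<Rightarrow> ennreal \<Rightarrow> real" where
  "discount r t = (if t = \<infinity> then 0 else exp (- r * enn2real t))"

text \<open>The expectation is taken in the completion of \<open>M\<close>, because stopping times of the augmented
  filtration are measurable only with respect to it.\<close>

definition cost ::
  "'a measure \<Rightarrow> (real \<Rightarrow> 'a \<Rightarrow> real) \<Rightarrow> real \<Rightarrow> (real \<Rightarrow> real) \<Rightarrow> real \<Rightarrow> ('a \<Rightarrow> ennreal) \<Rightarrow> real" where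
  "cost M X r g c \<tau> =
     (\<integral>\<omega>. (LBINT t:{t. 0 \<le> t \<and> ennreal t \<le> \<tau> \<omega>}. g (X t \<omega>) * exp (- r * t))
          + c * discount r (\<tau> \<omega>) \<partial>completion M)"

definition value_fun ::
  "(real \<Rightarrow> 'a measure) \<Rightarrow> (real \<Rightarrow> 'a \<Rightarrow> real) \<Rightarrow> real \<Rightarrow> (real \<Rightarrow> real) \<Rightarrow> real \<Rightarrow> real \<Rightarrow> real" where
  "value_fun P X r g x c =
     (INF \<tau>\<in>{\<tau>. stopping_time (nat_filtration (P x) X) \<tau>}. cost (P x) X r g c \<tau>)"

definition stopping_region ::
  "(real \<Rightarrow> 'a measure) \<Rightarrow> (real \<Rightarrow> 'a \<Rightarrow> real) \<Rightarrow> real \<Rightarrow> (real \<Rightarrow> real) \<Rightarrow> real \<Rightarrow> real set" where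
  "stopping_region P X r g c = {x. value_fun P X r g x c = c}"

definition continuation_region ::
  "(real \<Rightarrow> 'a measure) \<Rightarrow> (real \<Rightarrow> 'a \<Rightarrow> real) \<Rightarrow> real \<Rightarrow> (real \<Rightarrow> real) \<Rightarrow> real \<Rightarrow> real set" where
  "continuation_region P X r g c = {x. value_fun P X r g x c < c}"

definition optimal_stopping_time ::
  "(real \<Rightarrow> 'a measure) \<Rightarrow> (real \<Rightarrow> 'a \<Rightarrow> real) \<Rightarrow> real \<Rightarrow> (real \<Rightarrow> real) \<Rightarrow> real \<Rightarrow> ('a \<Rightarrow> ennreal) \<Rightarrow> bool"
where
  "optimal_stopping_time P X r g c \<tau> \<longleftrightarrow>
     (\<forall>x. stopping_time (nat_filtration (P x) X) \<tau> \<and>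
          cost (P x) X r g c \<tau> = value_fun P X r g x c)"

text \<open>The expectation under \<open>M\<close> of the integral of \<open>g (X t) * exp (- r * t)\<close> over \<open>t \<ge> 0\<close> exists and is
  finite, i.e. positive and negative part both have finite integral with respect to \<open>M \<Otimes> dt\<close>.\<close>

definition resolvent_finite ::
  "'a measure \<Rightarrow> (real \<Rightarrow> 'a \<Rightarrow> real) \<Rightarrow> real \<Rightarrow> (real \<Rightarrow> real) \<Rightarrow> bool" where
  "resolvent_finite M X r g \<longleftrightarrow>
     set_integrable (M \<Otimes>\<^sub>M lborel) (space M \<times> {0..}) (\<lambda>(\<omega>, t). g (X t \<omega>) * exp (- r * t))"

definition running_inf :: "(real \<Rightarrow> 'a \<Rightarrow> real) \<Rightarrow> real \<Rightarrow> 'a \<Rightarrow> real" where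
  "running_inf X t \<omega> = (INF s\<in>{0..t}. X s \<omega>)"

definition kappa ::
  "'a measure \<Rightarrow> (real \<Rightarrow> 'a \<Rightarrow> real) \<Rightarrow> ('a \<Rightarrow> real) \<Rightarrow> real \<Rightarrow> (real \<Rightarrow> real) \<Rightarrow> real \<Rightarrow> real" where
  "kappa M X' T' r g x = 1 / r * (\<integral>\<omega>. g (x + running_inf X' (T' \<omega>) \<omega>) \<partial>M)"

text \<open>The infimum is taken in \<open>ennreal\<close>, so it is \<open>\<infinity>\<close> for a path that never enters.\<close>

definition entrance_time ::
  "(real \<Rightarrow> 'a \<Rightarrow> real) \<Rightarrow> (real \<Rightarrow> real) \<Rightarrow> real \<Rightarrow> 'a \<Rightarrow> ennreal" where
  "entrance_time X k c \<omega> = Inf {ennreal t | t. 0 \<le> t \<and> k (X t \<omega>) \<ge> c}"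

end

theory Submission
  imports Defs
begin

text \<open>Let \<open>T\<close> be an exponential time with parameter \<open>r\<close>, independent of everything else, and let \<open>J\<close> be
  the infimum over \<open>[0, T]\<close> of an independent copy of the process started in \<open>0\<close>, so that
  \<open>r * \<kappa> y\<close> is the mean of \<open>g (y + J)\<close>. By the Wiener-Hopf factorization the increment of \<open>X\<close> over \<open>[0, T]\<close>
  has the law of the sum of the running supremum at \<open>T\<close> and an independent copy of \<open>J\<close>. Started afresh
  at a stopping time \<open>\<tau>\<close>, with the lack of memory of \<open>T\<close>, this says that \<open>g (X T)\<close> and
  \<open>r * \<kappa> (sup X over [\<tau>, T])\<close> have the same mean on the event \<open>\<tau> < T\<close> (\<open>wiener_hopf_stopped\<close>). Since \<open>\<tau> < T\<close>
  has conditional probability \<open>exp (- r * \<tau>)\<close> given \<open>X\<close>, the cost of \<open>\<tau>\<close> is the mean of \<open>g (X T) / r\<close>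
  minus the mean of \<open>\<kappa> (sup X over [\<tau>, T]) - c\<close> on \<open>\<tau> < T\<close> (\<open>cost_eq\<close>).

  Now \<open>\<kappa>\<close> is increasing and continuous, so the last integrand is at most the positive part of
  \<open>\<kappa> (sup X over [0, T]) - c\<close>, whatever \<open>\<tau>\<close> is. The first time \<open>\<tau>\<close> with \<open>\<kappa> (X \<tau>) \<ge> c\<close> attains this bound
  path by path: before it \<open>\<kappa> X\<close> stays below \<open>c\<close>, so if \<open>T\<close> comes earlier the positive part vanishes,
  and if \<open>T\<close> comes later the supremum over \<open>[\<tau>, T]\<close> decides (\<open>gain_entrance_time\<close>). Comparison with
  immediate stopping, which costs \<open>c\<close>, shows that \<open>c - v x c\<close> is the mean of the negative part of
  \<open>\<kappa> (sup X over [0, T]) - c\<close>. The supremum is at least \<open>x\<close>, and close to \<open>x\<close> when \<open>T\<close> is small; hence this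
  mean is zero exactly if \<open>\<kappa> x \<ge> c\<close> (\<open>optimal_value\<close>).

  The factorization comes from random walks. A walk killed at a geometric time is cut at its first
  maximum, the two pieces are independent, and reversing time turns the drop below the maximum into a
  minimum (\<open>wiener_hopf\<close>). Restricting \<open>X\<close> to dyadic grids, conditioning on the past of a grid time and
  refining the grid gives the statement for deterministic times (\<open>wiener_hopf_from\<close>); stopping times
  are approximated from the right by dyadic ones. All of this is done for nonnegative functions with
  values in \<open>ennreal\<close>, and \<open>g\<close> enters through its positive and negative parts. The factorization
  also gives the finiteness of \<open>\<kappa>\<close> at every point (\<open>low_mean_finite_above_start\<close>).

  That the entrance time is a stopping time is a separate matter, because a path may approach
  a closed half-line and jump away from it at the moment of arrival. For a Levy process
  this has probability zero: shortly before the arrival the path passes a slightly lower level, and a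
  jump of fixed size within a short time after that passage is unlikely (\<open>jump_off_null\<close>).\<close>

section \<open>Dyadic grids and cadlag paths\<close>

definition mesh :: "nat \<Rightarrow> real" where "mesh m = 1 / 2 ^ m"

text \<open>The grid points with this index decrease to \<open>t\<close> and lie strictly to the right of it, so that
  right-continuity alone gives convergence along them. Negative \<open>t\<close> are treated as \<open>0\<close>.\<close>

definition next_idx :: "nat \<Rightarrow> real \<Rightarrow> nat" where "next_idx m t = nat \<lfloor>t * 2 ^ m\<rfloor> + 1"

lemma mesh_pos [simp]: "0 < mesh m" "0 \<le> mesh m" "mesh m \<noteq> 0"
  by (simp_all add: mesh_def)

lemma mesh_tendsto: "mesh \<longlonglongrightarrow> 0"
  unfolding mesh_def by real_asymp

lemma next_idx_bounds:
  assumes "0 \<le> t"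
  shows "t < real (next_idx m t) * mesh m" "real (next_idx m t) * mesh m \<le> t + mesh m"
proof -
  have e: "real (next_idx m t) = of_int \<lfloor>t * 2 ^ m\<rfloor> + 1"
    using assms by (simp add: next_idx_def)
  have "t * 2 ^ m < real (next_idx m t)" "real (next_idx m t) \<le> t * 2 ^ m + 1"
    unfolding e by linarith+
  then show "t < real (next_idx m t) * mesh m" "real (next_idx m t) * mesh m \<le> t + mesh m"
    by (simp_all add: mesh_def field_simps)
qed

lemma next_idx_neg: "t \<le> 0 \<Longrightarrow> next_idx m t = 1"
  using mult_nonpos_nonneg[of t "2^m"] by (auto simp: next_idx_def floor_le_iff)

lemma next_idx_max: "next_idx m (max 0 t) = next_idx m t"
  by (simp add: max_def next_idx_neg)

lemma next_idx_mono: "s \<le> t \<Longrightarrow> next_idx m s \<le> next_idx m t"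
  unfolding next_idx_def by (intro add_right_mono nat_mono floor_mono mult_right_mono) auto

lemma next_idx_eq_iff:
  assumes "0 \<le> t"
  shows "next_idx m t = Suc k \<longleftrightarrow> real k * mesh m \<le> t \<and> t < real (Suc k) * mesh m"
proof -
  have "next_idx m t = Suc k \<longleftrightarrow> \<lfloor>t * 2 ^ m\<rfloor> = int k"
    using assms by (auto simp: next_idx_def nat_eq_iff)
  also have "\<dots> \<longleftrightarrow> real k \<le> t * 2 ^ m \<and> t * 2 ^ m < real k + 1"
    by (simp add: floor_eq_iff)
  finally show ?thesis by (simp add: mesh_def field_simps)
qed

lemma measurable_next_idx [measurable]: "next_idx m \<in> borel \<rightarrow>\<^sub>M count_space UNIV"
  unfolding next_idx_def by measurable

lemma next_time_at_right:
  assumes "0 \<le> t"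
  shows "filterlim (\<lambda>m. real (next_idx m t) * mesh m) (at_right t) sequentially"
  unfolding filterlim_at
proof
  have 1: "(\<lambda>m. t + mesh m) \<longlonglongrightarrow> t"
    using tendsto_add[OF tendsto_const[of t] mesh_tendsto] by simp
  show "(\<lambda>m. real (next_idx m t) * mesh m) \<longlonglongrightarrow> t"
    by (rule tendsto_sandwich[OF _ _ tendsto_const 1])
       (use next_idx_bounds[OF assms] in \<open>auto intro!: always_eventually less_imp_le\<close>)
  have "t < real (next_idx m t) * mesh m" for m by (rule next_idx_bounds(1)[OF assms])
  then show "\<forall>\<^sub>F m in sequentially. real (next_idx m t) * mesh m \<in> {t<..} \<and> real (next_idx m t) * mesh m \<noteq> t"
    by (simp add: less_imp_neq[symmetric])
qed

lemma cadlag_right: "cadlag f \<Longrightarrow> 0 \<le> t \<Longrightarrow> (f \<longlongrightarrow> f t) (at_right t)"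
  by (simp add: cadlag_def)

lemma cadlag_next_time:
  assumes "cadlag f" "0 \<le> t"
  shows "(\<lambda>m. f (real (next_idx m t) * mesh m)) \<longlonglongrightarrow> f t"
  by (rule filterlim_compose[OF cadlag_right next_time_at_right]) (use assms in auto)

lemma cadlag_shift:
  assumes "cadlag f" "0 \<le> u"
  shows "cadlag (\<lambda>t. f (u + t))"
  unfolding cadlag_def
proof (intro conjI allI impI)
  fix t :: real assume "0 \<le> t"
  then have "(f \<longlongrightarrow> f (u + t)) (at_right (u + t))"
    using assms by (simp add: cadlag_def)
  then show "((\<lambda>t. f (u + t)) \<longlongrightarrow> f (u + t)) (at_right t)"
    unfolding filterlim_at_right_to_0[of _ _ "u + t"] filterlim_at_right_to_0[of _ _ t]
    by (simp add: ac_simps)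
next
  fix t :: real assume "0 < t"
  then obtain l where "(f \<longlongrightarrow> l) (at_left (u + t))"
    using assms unfolding cadlag_def by (metis add_nonneg_pos)
  then have "((\<lambda>t. f (u + t)) \<longlongrightarrow> l) (at_left t)"
    unfolding filterlim_at_left_to_right[of _ _ "u + t"] filterlim_at_left_to_right[of _ _ t]
      filterlim_at_right_to_0[of _ _ "- (u + t)"] filterlim_at_right_to_0[of _ _ "- t"]
    by (simp add: algebra_simps)
  then show "\<exists>l. ((\<lambda>t. f (u + t)) \<longlongrightarrow> l) (at_left t)" by blast
qed

lemma cadlag_uminus: "cadlag f \<Longrightarrow> cadlag (\<lambda>t. - f t)"
  unfolding cadlag_def by (metis tendsto_minus)

text \<open>One-sided limits bound the path near every point, and finitely many such neighbourhoods cover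
  the interval.\<close>

lemma cadlag_bounded:
  assumes f: "cadlag f"
  shows "bounded (f ` {0..T})"
proof -
  have "\<exists>e>0. bounded (f ` (ball s e \<inter> {0..T}))" if s: "s \<in> {0..T}" for s
  proof -
    have "\<forall>\<^sub>F x in at_right s. dist (f x) (f s) < 1"
      using cadlag_right[OF f] s by (intro tendstoD) auto
    then obtain b where b: "s < b" "\<And>x. s < x \<Longrightarrow> x < b \<Longrightarrow> dist (f x) (f s) < 1"
      using eventually_at_right[of s "s+1"] by auto
    obtain a l where a: "a < s" "\<And>x. a < x \<Longrightarrow> x < s \<Longrightarrow> 0 \<le> x \<Longrightarrow> dist (f x) l < 1"
    proof (cases "s = 0")
      case True then show ?thesis using that[of "-1"] by auto
    next
      case False
      then obtain l where "(f \<longlongrightarrow> l) (at_left s)" using f s unfolding cadlag_def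
        by (metis atLeastAtMost_iff less_eq_real_def)
      then have "\<forall>\<^sub>F x in at_left s. dist (f x) l < 1" by (intro tendstoD) auto
      then obtain a where "a < s" "\<And>x. a < x \<Longrightarrow> x < s \<Longrightarrow> dist (f x) l < 1"
        using eventually_at_left[of "s-1" s] by auto
      then show ?thesis using that by blast
    qed
    have "f ` (ball s (min (b - s) (s - a)) \<inter> {0..T}) \<subseteq> ball (f s) 1 \<union> ball l 1"
    proof safe
      fix x assume x: "x \<in> ball s (min (b - s) (s - a))" "x \<in> {0..T}" "f x \<notin> ball l 1"
      consider "x < s" | "x = s" | "s < x" by linarith
      then show "f x \<in> ball (f s) 1"
      proof cases
        case 1 then show ?thesis using a(2)[of x] x by (auto simp: dist_real_def dist_commute)
      next
        case 3 then show ?thesis using b(2)[of x] x by (auto simp: dist_real_def dist_commute)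
      qed simp
    qed
    then have "bounded (f ` (ball s (min (b - s) (s - a)) \<inter> {0..T}))"
      by (rule bounded_subset[rotated]) simp
    then show ?thesis using a(1) b(1) by (intro exI[of _ "min (b - s) (s - a)"]) auto
  qed
  then obtain e where e: "\<And>s. s \<in> {0..T} \<Longrightarrow> 0 < e s \<and> bounded (f ` (ball s (e s) \<inter> {0..T}))"
    by metis
  have cover: "{0..T} \<subseteq> (\<Union>s\<in>{0..T}. ball s (e s))"
  proof
    fix s assume s: "s \<in> {0..T}"
    then have "s \<in> ball s (e s)" using e by simp
    then show "s \<in> (\<Union>s\<in>{0..T}. ball s (e s))" using s by blast
  qed
  obtain C where C: "C \<subseteq> {0..T}" "finite C" "{0..T} \<subseteq> (\<Union>s\<in>C. ball s (e s))"
    by (rule compactE_image[OF compact_Icc open_ball cover])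
  have "f ` {0..T} \<subseteq> (\<Union>s\<in>C. f ` (ball s (e s) \<inter> {0..T}))"
  proof
    fix y assume "y \<in> f ` {0..T}"
    then obtain x where x: "x \<in> {0..T}" "y = f x" by blast
    then obtain s where "s \<in> C" "x \<in> ball s (e s)" using C(3) by blast
    then show "y \<in> (\<Union>s\<in>C. f ` (ball s (e s) \<inter> {0..T}))" using x by blast
  qed
  moreover have "bounded (\<Union>s\<in>C. f ` (ball s (e s) \<inter> {0..T}))"
  proof (rule bounded_UN[OF C(2)])
    show "\<forall>s\<in>C. bounded (f ` (ball s (e s) \<inter> {0..T}))" using C(1) e by blast
  qed
  ultimately show ?thesis by (rule bounded_subset[rotated])
qed

lemma cadlag_bdd:
  assumes "cadlag f" "0 \<le> a"
  shows "bdd_above (f ` {a..b})" "bdd_below (f ` {a..b})"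
proof -
  have "f ` {a..b} \<subseteq> f ` {0..b}" using assms by auto
  then have "bounded (f ` {a..b})" using cadlag_bounded[OF assms(1)] bounded_subset by blast
  then show "bdd_above (f ` {a..b})" "bdd_below (f ` {a..b})"
    by (auto simp: bounded_imp_bdd_above bounded_imp_bdd_below)
qed

text \<open>The grid extends to one point beyond \<open>t\<close>. The value at that point tends to \<open>f t\<close>, so a jump at
  \<open>t\<close> itself is not lost in the limit.\<close>

lemma grid_Max_tendsto_SUP:
  assumes f: "cadlag f" and t: "0 \<le> t"
  shows "(\<lambda>m. Max ((\<lambda>i. f (real i * mesh m)) ` {..next_idx m t})) \<longlonglongrightarrow> (SUP s\<in>{0..t}. f s)"
proof (rule order_tendstoI)
  fix a assume "a < (SUP s\<in>{0..t}. f s)"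
  then obtain s where s: "s \<in> {0..t}" "a < f s"
    using less_cSUP_iff[of "{0..t}" f a] t cadlag_bdd[OF f] by auto
  then have "\<forall>\<^sub>F m in sequentially. a < f (real (next_idx m s) * mesh m)"
    using cadlag_next_time[OF f, of s] by (auto intro: order_tendstoD)
  then show "\<forall>\<^sub>F m in sequentially. a < Max ((\<lambda>i. f (real i * mesh m)) ` {..next_idx m t})"
  proof eventually_elim
    case (elim m)
    then show ?case using next_idx_mono[of s t m] s by (subst Max_gr_iff) auto
  qed
next
  fix a assume a: "(SUP s\<in>{0..t}. f s) < a"
  have le: "f s < a" if "0 \<le> s" "s \<le> t" for s
    using cSUP_upper[of s "{0..t}" f] cadlag_bdd[OF f] that a by fastforce
  then have "\<forall>\<^sub>F m in sequentially. f (real (next_idx m t) * mesh m) < a"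
    using cadlag_next_time[OF f t] t by (auto intro: order_tendstoD)
  then show "\<forall>\<^sub>F m in sequentially. Max ((\<lambda>i. f (real i * mesh m)) ` {..next_idx m t}) < a"
  proof eventually_elim
    case (elim m)
    have "f (real i * mesh m) < a" if "i \<le> next_idx m t" for i
    proof (cases "i = next_idx m t")
      case False
      then have "real i + 1 \<le> real (next_idx m t)" using that by linarith
      then have "(real i + 1) * mesh m \<le> real (next_idx m t) * mesh m"
        by (intro mult_right_mono) auto
      then show ?thesis using next_idx_bounds[OF t, of m] by (intro le) (auto simp: algebra_simps)
    qed (use elim in simp)
    then show ?case by (subst Max_less_iff) auto
  qed
qed

lemma Min_image_conv_Max:
  fixes f :: "'b \<Rightarrow> real"
  assumes "finite A" "A \<noteq> {}"
  shows "Min (f ` A) = - Max ((\<lambda>i. - f i) ` A)"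
  using minus_Max_eq_Min[of "(\<lambda>i. - f i) ` A"] assms by (simp add: image_image)

lemma grid_Min_tendsto_INF:
  assumes f: "cadlag f" and t: "0 \<le> t"
  shows "(\<lambda>m. Min ((\<lambda>i. f (real i * mesh m)) ` {..next_idx m t})) \<longlonglongrightarrow> (INF s\<in>{0..t}. f s)"
proof -
  have "(INF s\<in>{0..t}. f s) = - (SUP s\<in>{0..t}. - f s)"
    unfolding Inf_real_def by (simp add: image_image)
  moreover have "Min ((\<lambda>i. f (real i * mesh m)) ` {..next_idx m t}) =
      - Max ((\<lambda>i. - f (real i * mesh m)) ` {..next_idx m t})" for m
    by (rule Min_image_conv_Max) auto
  ultimately show ?thesis
    using tendsto_minus[OF grid_Max_tendsto_SUP[OF cadlag_uminus[OF f] t]] by (simp only:)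
qed

section \<open>Wiener-Hopf factorization of a random walk\<close>

definition wsum :: "(nat \<Rightarrow> real) \<Rightarrow> nat \<Rightarrow> real" where "wsum d n = (\<Sum>i<n. d i)"
definition wmax :: "(nat \<Rightarrow> real) \<Rightarrow> nat \<Rightarrow> real" where "wmax d n = Max (wsum d ` {..n})"
definition wmin :: "(nat \<Rightarrow> real) \<Rightarrow> nat \<Rightarrow> real" where "wmin d n = Min (wsum d ` {..n})"

definition record_at :: "(nat \<Rightarrow> real) \<Rightarrow> nat \<Rightarrow> bool" where
  "record_at d k \<longleftrightarrow> (\<forall>i<k. wsum d i < wsum d k)"
definition stays_nonpos :: "(nat \<Rightarrow> real) \<Rightarrow> nat \<Rightarrow> bool" where
  "stays_nonpos d j \<longleftrightarrow> (\<forall>i\<le>j. wsum d i \<le> 0)"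

text \<open>Every path has one first maximum. Cutting there leaves two pieces whose constraints do not
  refer to each other: the first ends in a strict record, the second never rises above its start.\<close>

lemma first_argmax_unique:
  "\<exists>!k. k \<le> n \<and> record_at d k \<and> (\<forall>i\<in>{k..n}. wsum d i \<le> wsum d k)"
proof -
  have "Max (wsum d ` {..n}) \<in> wsum d ` {..n}" by (intro Max_in) auto
  then have "\<exists>k. k \<le> n \<and> wsum d k = Max (wsum d ` {..n})"
    by (metis (no_types, lifting) atMost_iff imageE)
  then obtain k where k: "k \<le> n" "wsum d k = Max (wsum d ` {..n})"
    and least: "\<And>i. i < k \<Longrightarrow> \<not> (i \<le> n \<and> wsum d i = Max (wsum d ` {..n}))"
    using exists_least_iff[of "\<lambda>k. k \<le> n \<and> wsum d k = Max (wsum d ` {..n})"] by blast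
  have le: "wsum d i \<le> wsum d k" if "i \<le> n" for i
    unfolding k by (intro Max_ge) (use that in auto)
  show ?thesis
  proof (rule ex1I[of _ k])
    have "wsum d i < wsum d k" if "i < k" for i
    proof -
      have "i \<le> n" using that k by simp
      then show ?thesis using le[of i] least[OF that] k(2) by (simp add: less_le)
    qed
    then show "k \<le> n \<and> record_at d k \<and> (\<forall>i\<in>{k..n}. wsum d i \<le> wsum d k)"
      using k le by (auto simp: record_at_def)
    fix j assume j: "j \<le> n \<and> record_at d j \<and> (\<forall>i\<in>{j..n}. wsum d i \<le> wsum d j)"
    show "j = k"
    proof (rule linorder_cases[of j k])
      assume "j < k" with j k \<open>\<And>i. i < k \<Longrightarrow> wsum d i < wsum d k\<close>[of j] show ?thesis
        by (auto dest!: bspec[of _ _ k])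
    next
      assume "k < j" with j le[of j] show ?thesis by (auto simp: record_at_def not_le[symmetric])
    qed
  qed
qed

lemma wmax_eqI:
  assumes "k \<le> n" "record_at d k" "\<forall>i\<in>{k..n}. wsum d i \<le> wsum d k"
  shows "wmax d n = wsum d k"
  unfolding wmax_def
proof (rule Max_eqI)
  fix y assume "y \<in> wsum d ` {..n}"
  then obtain i where i: "i \<le> n" "y = wsum d i" by auto
  show "y \<le> wsum d k"
    using assms i by (cases "i < k") (auto simp: record_at_def)
qed (use assms in auto)

lemma measurable_wsum [measurable]: "(\<lambda>d. wsum d n) \<in> borel_measurable (PiM UNIV (\<lambda>_. borel))"
  unfolding wsum_def by measurable

lemma measurable_wmax [measurable]: "(\<lambda>d. wmax d n) \<in> borel_measurable (PiM UNIV (\<lambda>_. borel))"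
  unfolding wmax_def by measurable

lemma measurable_wmin [measurable]: "(\<lambda>d. wmin d n) \<in> borel_measurable (PiM UNIV (\<lambda>_. borel))"
  unfolding wmin_def by measurable

lemma measurable_record_at [measurable]:
  "Measurable.pred (PiM UNIV (\<lambda>_. borel)) (\<lambda>d. record_at d n)"
  unfolding record_at_def by measurable

lemma measurable_stays_nonpos [measurable]:
  "Measurable.pred (PiM UNIV (\<lambda>_. borel)) (\<lambda>d. stays_nonpos d n)"
  unfolding stays_nonpos_def by measurable

lemma wsum_comb_seq_le: "i \<le> k \<Longrightarrow> wsum (comb_seq k d e) i = wsum d i"
  unfolding wsum_def comb_seq_def by (intro sum.cong) auto

lemma wsum_comb_seq_add: "wsum (comb_seq k d e) (k + j) = wsum d k + wsum e j"
  by (induction j) (auto simp: wsum_def comb_seq_def)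

lemma suminf_Cauchy_ennreal:
  fixes b :: "nat \<Rightarrow> nat \<Rightarrow> ennreal"
  shows "(\<Sum>n. \<Sum>k\<le>n. b k (n - k)) = (\<Sum>k. \<Sum>j. b k j)"
proof -
  have "(\<Sum>n. \<Sum>k\<le>n. b k (n - k)) = (\<Sum>n. \<Sum>k. if k \<le> n then b k (n - k) else 0)"
    by (intro suminf_cong) (subst suminf_finite[of "{..n}" for n], auto)
  also have "\<dots> = (\<Sum>k. \<Sum>n. if k \<le> n then b k (n - k) else 0)"
    by (subst nn_integral_count_space_nat[symmetric], subst nn_integral_suminf)
       (simp_all add: nn_integral_count_space_nat)
  also have "\<dots> = (\<Sum>k. \<Sum>j. b k j)"
  proof (rule suminf_cong)
    fix k
    show "(\<Sum>n. if k \<le> n then b k (n - k) else 0) = (\<Sum>j. b k j)"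
      by (subst suminf_offset[where i = k]) (auto simp: suminf_finite intro!: summableI)
  qed
  finally show ?thesis .
qed

locale random_walk =
  fixes \<nu> :: "real measure"
  assumes prob_step: "prob_space \<nu>" and sets_step [measurable_cong, simp]: "sets \<nu> = sets borel"
begin

lemma space_step [simp]: "space \<nu> = UNIV"
  using sets_eq_imp_space_eq[OF sets_step] by simp

sublocale sequence_space \<nu>
  unfolding sequence_space_def by (intro product_prob_spaceI prob_step)

lemma sets_S [measurable_cong]: "sets S = sets (PiM UNIV (\<lambda>_. borel))"
  by (intro sets_PiM_cong) auto

lemma sigma_finite_S: "sigma_finite_measure S"
  by unfold_locales

lemma integral_split:
  assumes [measurable]: "h \<in> borel_measurable (PiM UNIV (\<lambda>_. borel))"
  shows "(\<integral>\<^sup>+d. h d \<partial>S) = (\<integral>\<^sup>+d. \<integral>\<^sup>+e. h (comb_seq k d e) \<partial>S \<partial>S)"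
proof -
  have [measurable]: "h \<in> borel_measurable S"
    using assms by (simp cong: measurable_cong_sets[OF sets_S refl])
  have "(\<integral>\<^sup>+d. h d \<partial>S) = (\<integral>\<^sup>+d. h d \<partial>distr (S \<Otimes>\<^sub>M S) S (\<lambda>(d, e). comb_seq k d e))"
    unfolding PiM_comb_seq ..
  also have "\<dots> = (\<integral>\<^sup>+x. h (comb_seq k (fst x) (snd x)) \<partial>(S \<Otimes>\<^sub>M S))"
    by (subst nn_integral_distr) (auto simp: case_prod_beta' intro!: measurable_comb_seq')
  also have "\<dots> = (\<integral>\<^sup>+d. \<integral>\<^sup>+e. h (comb_seq k d e) \<partial>S \<partial>S)"
    by (subst sigma_finite_measure.nn_integral_fst[OF sigma_finite_S, symmetric])
       (auto simp: case_prod_beta' intro!: measurable_compose[OF _ \<open>h \<in> borel_measurable S\<close>])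
  finally show ?thesis .
qed

text \<open>The two pieces of a path cut at its first maximum are independent, and the second is again
  a walk from zero.\<close>

lemma integral_at_max:
  assumes F [measurable]: "case_prod F \<in> borel_measurable (borel \<Otimes>\<^sub>M borel)"
  shows "(\<integral>\<^sup>+d. F (wmax d n) (wsum d n - wmax d n) \<partial>S) =
    (\<Sum>k\<le>n. \<integral>\<^sup>+d. \<integral>\<^sup>+e. (if record_at d k \<and> stays_nonpos e (n - k)
        then F (wsum d k) (wsum e (n - k)) else 0) \<partial>S \<partial>S)"
proof -
  define A where "A k d \<longleftrightarrow> record_at d k \<and> (\<forall>i\<in>{k..n}. wsum d i \<le> wsum d k)" for k d
  have [measurable]: "Measurable.pred (PiM UNIV (\<lambda>_. borel)) (A k)" for k
    unfolding A_def not_less[symmetric] by measurable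
  have pt: "F (wmax d n) (wsum d n - wmax d n) =
    (\<Sum>k\<le>n. if A k d then F (wsum d k) (wsum d n - wsum d k) else 0)" for d
  proof -
    obtain k where k: "k \<le> n" "A k d" and uniq: "\<And>j. j \<le> n \<Longrightarrow> A j d \<Longrightarrow> j = k"
      using first_argmax_unique[of n d] unfolding Ex1_def A_def by blast
    have "(\<Sum>j\<le>n. if A j d then F (wsum d j) (wsum d n - wsum d j) else 0)
      = (\<Sum>j\<in>{k}. if A j d then F (wsum d j) (wsum d n - wsum d j) else 0)"
    proof (rule sum.mono_neutral_right)
      show "\<forall>j\<in>{..n} - {k}. (if A j d then F (wsum d j) (wsum d n - wsum d j) else 0) = 0"
        using uniq by (metis Diff_iff atMost_iff insertI1)
    qed (use k in auto)
    also have "\<dots> = F (wmax d n) (wsum d n - wmax d n)"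
      using k wmax_eqI[of k n d] by (simp add: A_def)
    finally show ?thesis by simp
  qed
  have "(\<integral>\<^sup>+d. F (wmax d n) (wsum d n - wmax d n) \<partial>S) =
    (\<Sum>k\<le>n. \<integral>\<^sup>+d. (if A k d then F (wsum d k) (wsum d n - wsum d k) else 0) \<partial>S)"
    unfolding pt by (intro nn_integral_sum) measurable
  also have "\<dots> = (\<Sum>k\<le>n. \<integral>\<^sup>+d. \<integral>\<^sup>+e. (if record_at d k \<and> stays_nonpos e (n - k)
        then F (wsum d k) (wsum e (n - k)) else 0) \<partial>S \<partial>S)"
  proof (rule sum.cong[OF refl])
    fix k assume "k \<in> {..n}"
    then have k: "n = k + (n - k)" by auto
    have "A k (comb_seq k d e) \<longleftrightarrow> record_at d k \<and> stays_nonpos e (n - k)" for d e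
    proof -
      have "(\<forall>i\<in>{k..n}. wsum (comb_seq k d e) i \<le> wsum (comb_seq k d e) k) \<longleftrightarrow>
        (\<forall>j\<le>n - k. wsum (comb_seq k d e) (k + j) \<le> wsum (comb_seq k d e) k)"
        using k by (auto simp: Ball_def) (metis le_add_diff_inverse diff_le_mono)
      then show ?thesis
        by (auto simp: A_def record_at_def stays_nonpos_def wsum_comb_seq_add wsum_comb_seq_le)
    qed
    moreover have "wsum (comb_seq k d e) n = wsum d k + wsum e (n - k)" for d e
      by (subst k) (rule wsum_comb_seq_add)
    ultimately show "(\<integral>\<^sup>+d. (if A k d then F (wsum d k) (wsum d n - wsum d k) else 0) \<partial>S) =
      (\<integral>\<^sup>+d. \<integral>\<^sup>+e. (if record_at d k \<and> stays_nonpos e (n - k)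
        then F (wsum d k) (wsum e (n - k)) else 0) \<partial>S \<partial>S)"
      by (subst integral_split[of _ k]) (auto simp: wsum_comb_seq_le cong: if_cong)
  qed
  finally show ?thesis .
qed

text \<open>Discounted occupation of the strict ascending ladder points, as a functional of the test
  function. Up to normalization it is the law of the maximum at an independent geometric time.\<close>

definition ladder :: "ennreal \<Rightarrow> (real \<Rightarrow> ennreal) \<Rightarrow> ennreal" where
  "ladder q \<phi> = (\<Sum>k. q ^ k * (\<integral>\<^sup>+d. (if record_at d k then \<phi> (wsum d k) else 0) \<partial>S))"

text \<open>The same for the paths that never rise above zero; up to normalization it is the law of the
  final value minus the maximum at an independent geometric time.\<close>

definition descent :: "ennreal \<Rightarrow> (real \<Rightarrow> ennreal) \<Rightarrow> ennreal" where
  "descent q \<phi> = (\<Sum>j. q ^ j * (\<integral>\<^sup>+e. (if stays_nonpos e j then \<phi> (wsum e j) else 0) \<partial>S))"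

lemma measurable_descent [measurable (raw)]:
  assumes [measurable]: "case_prod F \<in> borel_measurable (N \<Otimes>\<^sub>M borel)"
  shows "(\<lambda>y. descent q (F y)) \<in> borel_measurable N"
proof -
  interpret sigma_finite_measure S by (rule sigma_finite_S)
  show ?thesis unfolding descent_def by measurable
qed

lemma weighted_cmult:
  assumes [measurable]: "\<phi> \<in> borel_measurable borel" "\<And>k. Measurable.pred (PiM UNIV (\<lambda>_. borel)) (\<lambda>d. Q d k)"
  shows "(\<Sum>k. q ^ k * (\<integral>\<^sup>+d. (if Q d k then c * \<phi> (wsum d k) else 0) \<partial>S)) =
    c * (\<Sum>k. q ^ k * (\<integral>\<^sup>+d. (if Q d k then \<phi> (wsum d k) else 0) \<partial>S))"
  unfolding ennreal_suminf_cmult[symmetric]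
proof (rule suminf_cong)
  fix k
  have "(\<integral>\<^sup>+d. (if Q d k then c * \<phi> (wsum d k) else 0) \<partial>S) =
      (\<integral>\<^sup>+d. c * (if Q d k then \<phi> (wsum d k) else 0) \<partial>S)"
    by (intro nn_integral_cong) auto
  also have "\<dots> = c * (\<integral>\<^sup>+d. (if Q d k then \<phi> (wsum d k) else 0) \<partial>S)"
    by (rule nn_integral_cmult) measurable
  finally show "q ^ k * (\<integral>\<^sup>+d. (if Q d k then c * \<phi> (wsum d k) else 0) \<partial>S) =
      c * (q ^ k * (\<integral>\<^sup>+d. (if Q d k then \<phi> (wsum d k) else 0) \<partial>S))"
    by (simp add: mult.left_commute)
qed

lemma ladder_cmult:
  "\<phi> \<in> borel_measurable borel \<Longrightarrow> ladder q (\<lambda>y. c * \<phi> y) = c * ladder q \<phi>"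
  unfolding ladder_def by (rule weighted_cmult[OF _ measurable_record_at])

lemma descent_cmult:
  "\<phi> \<in> borel_measurable borel \<Longrightarrow> descent q (\<lambda>y. c * \<phi> y) = c * descent q \<phi>"
  unfolding descent_def by (rule weighted_cmult[OF _ measurable_stays_nonpos])

text \<open>The decomposition at the first maximum turns the geometric sum into a Cauchy product: the maximum
  and the final distance below it are independent at a geometric time.\<close>

lemma geometric_factorization:
  assumes F [measurable]: "case_prod F \<in> borel_measurable (borel \<Otimes>\<^sub>M borel)"
  shows "(\<Sum>n. q ^ n * (\<integral>\<^sup>+d. F (wmax d n) (wsum d n - wmax d n) \<partial>S)) = ladder q (\<lambda>y. descent q (F y))"
proof -
  interpret S: sigma_finite_measure S by (rule sigma_finite_S)
  define b where "b k j = q ^ k * q ^ j * (\<integral>\<^sup>+d. \<integral>\<^sup>+e. (if record_at d k \<and> stays_nonpos e j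
        then F (wsum d k) (wsum e j) else 0) \<partial>S \<partial>S)" for k j
  have "(\<Sum>n. q ^ n * (\<integral>\<^sup>+d. F (wmax d n) (wsum d n - wmax d n) \<partial>S)) = (\<Sum>n. \<Sum>k\<le>n. b k (n - k))"
    unfolding integral_at_max[OF F] b_def sum_distrib_left
    by (intro suminf_cong sum.cong refl) (simp add: power_add[symmetric])
  also have "\<dots> = (\<Sum>k. \<Sum>j. b k j)"
    by (rule suminf_Cauchy_ennreal)
  also have "\<dots> = ladder q (\<lambda>y. descent q (F y))"
    unfolding ladder_def
  proof (rule suminf_cong)
    fix k
    have "q ^ k * (\<integral>\<^sup>+d. (if record_at d k then descent q (F (wsum d k)) else 0) \<partial>S)
      = q ^ k * (\<integral>\<^sup>+d. (\<Sum>j. q ^ j * (\<integral>\<^sup>+e. (if record_at d k \<and> stays_nonpos e j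
          then F (wsum d k) (wsum e j) else 0) \<partial>S)) \<partial>S)"
      by (intro arg_cong2[of _ _ _ _ "(*)"] refl nn_integral_cong) (simp add: descent_def)
    also have "\<dots> = q ^ k * (\<Sum>j. \<integral>\<^sup>+d. q ^ j * (\<integral>\<^sup>+e. (if record_at d k \<and> stays_nonpos e j
          then F (wsum d k) (wsum e j) else 0) \<partial>S) \<partial>S)"
      by (subst nn_integral_suminf) measurable
    also have "\<dots> = (\<Sum>j. b k j)"
      unfolding b_def ennreal_suminf_cmult[symmetric]
      by (intro suminf_cong) (subst nn_integral_cmult, measurable, simp add: mult.assoc)
    finally show "(\<Sum>j. b k j) = q ^ k * (\<integral>\<^sup>+d. (if record_at d k then descent q (F (wsum d k)) else 0) \<partial>S)"
      by simp
  qed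
  finally show ?thesis .
qed

text \<open>Reading the increments backwards preserves their law and turns the final distance below the
  maximum into the minimum.\<close>

lemma reversal:
  assumes h [measurable]: "h \<in> borel_measurable borel"
  shows "(\<integral>\<^sup>+d. h (wsum d n - wmax d n) \<partial>S) = (\<integral>\<^sup>+d. h (wmin d n) \<partial>S)"
proof -
  (* Reverses the first n increments and keeps the others. *)
  define p where "p i = (if i < n then n - 1 - i else i)" for i :: nat
  have "inj p" by (rule injI) (auto simp: p_def split: if_splits)
  then have D: "distr S S (\<lambda>d i. d (p i)) = S"
    using distr_PiM_reindex[of UNIV "\<lambda>_. \<nu>" p UNIV] prob_step by (simp add: restrict_def)
  have ws: "wsum (\<lambda>i. d (p i)) j = wsum d n - wsum d (n - j)" if "j \<le> n" for d j
  proof -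
    have "wsum (\<lambda>i. d (p i)) j = (\<Sum>i<j. d (n - 1 - i))"
      unfolding wsum_def by (intro sum.cong) (use that in \<open>auto simp: p_def\<close>)
    also have "\<dots> = (\<Sum>i\<in>{n-j..<n}. d i)"
      by (rule sum.reindex_bij_witness[of _ "\<lambda>i. n - 1 - i" "\<lambda>i. n - 1 - i"]) (use that in auto)
    also have "\<dots> = wsum d n - wsum d (n - j)"
    proof -
      have "{..<n} = {..<n - j} \<union> {n-j..<n}" by auto
      then have "wsum d n = wsum d (n - j) + (\<Sum>i\<in>{n-j..<n}. d i)"
        unfolding wsum_def by (simp add: sum.union_disjoint ivl_disj_int)
      then show ?thesis by simp
    qed
    finally show ?thesis .
  qed
  have min: "wmin (\<lambda>i. d (p i)) n = wsum d n - wmax d n" for d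
    unfolding wmin_def
  proof (rule Min_eqI)
    fix y assume "y \<in> wsum (\<lambda>i. d (p i)) ` {..n}"
    then show "wsum d n - wmax d n \<le> y"
      by (auto simp: ws wmax_def intro!: Max_ge)
  next
    have "Max (wsum d ` {..n}) \<in> wsum d ` {..n}" by (intro Max_in) auto
    then obtain k where k: "k \<le> n" "wmax d n = wsum d k"
      unfolding wmax_def by (metis (no_types, lifting) atMost_iff imageE)
    then show "wsum d n - wmax d n \<in> wsum (\<lambda>i. d (p i)) ` {..n}"
      using ws[of "n - k" d] by (intro image_eqI[of _ _ "n - k"]) auto
  qed simp
  have "(\<integral>\<^sup>+d. h (wmin d n) \<partial>S) = (\<integral>\<^sup>+d. h (wmin d n) \<partial>distr S S (\<lambda>d i. d (p i)))"
    by (simp only: D)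
  also have "\<dots> = (\<integral>\<^sup>+d. h (wmin (\<lambda>i. d (p i)) n) \<partial>S)"
    by (rule nn_integral_distr) (auto simp: space_PiM intro!: measurable_PiM_single')
  finally show ?thesis by (simp add: min)
qed

text \<open>The maximum and an independent minimum at geometric times add up, in law, to the walk at a
  geometric time. The masses of the two factors satisfy
  \<open>ladder q (\<lambda>_. 1) * descent q (\<lambda>_. 1) = 1 / (1 - q)\<close>, which accounts for the constant.\<close>

theorem wiener_hopf:
  assumes f [measurable]: "f \<in> borel_measurable borel" and q: "0 \<le> q" "q < 1"
  shows "(\<Sum>n. ennreal (q ^ n) * (\<integral>\<^sup>+d. f (wsum d n) \<partial>S)) =
    ennreal (1 - q) * (\<Sum>n. ennreal (q ^ n) * (\<integral>\<^sup>+d. (\<Sum>j. ennreal (q ^ j) * (\<integral>\<^sup>+e. f (wmax d n + wmin e j) \<partial>S)) \<partial>S))"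
proof -
  interpret S: prob_space S by (intro prob_space_PiM prob_step)
  let ?q = "ennreal q" and ?f = "\<lambda>y z. f (y + z)"
  have pw: "ennreal (q ^ n) = ?q ^ n" for n by (simp add: ennreal_power q)
  have [measurable]: "(\<lambda>(y, z). ?f y z) \<in> borel_measurable (borel \<Otimes>\<^sub>M borel)" by measurable
  (* G y sums, with geometric weights, the means of f at y plus an independent minimum. *)
  define G where "G y = (\<Sum>j. ?q ^ j * (\<integral>\<^sup>+e. ?f y (wmin e j) \<partial>S))" for y
  have [measurable]: "G \<in> borel_measurable borel"
    unfolding G_def by measurable
  have G: "G y = ladder ?q (\<lambda>_. 1) * descent ?q (?f y)" for y
  proof -
    have "G y = (\<Sum>j. ?q ^ j * (\<integral>\<^sup>+e. ?f y (wsum e j - wmax e j) \<partial>S))"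
      unfolding G_def by (subst reversal) auto
    also have "\<dots> = ladder ?q (\<lambda>_. descent ?q (?f y))"
      by (rule geometric_factorization) simp
    also have "\<dots> = descent ?q (?f y) * ladder ?q (\<lambda>_. 1)"
      using ladder_cmult[of "\<lambda>_. 1" ?q "descent ?q (?f y)"] by simp
    finally show ?thesis by (simp add: mult.commute)
  qed
  have one: "ladder ?q (\<lambda>_. 1) * descent ?q (\<lambda>_. 1) = inverse (ennreal (1 - q))"
  proof -
    have "ladder ?q (\<lambda>_. 1) * descent ?q (\<lambda>_. 1) = ladder ?q (\<lambda>_. descent ?q (\<lambda>_. 1))"
      using ladder_cmult[of "\<lambda>_. 1" ?q "descent ?q (\<lambda>_. 1)"] by (simp add: mult.commute)
    also have "\<dots> = (\<Sum>n. ?q ^ n * (\<integral>\<^sup>+d. 1 \<partial>S))"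
      by (rule geometric_factorization[symmetric]) simp
    also have "\<dots> = (\<Sum>n. ennreal (q ^ n))" by (simp add: pw P.emeasure_space_1)
    also have "\<dots> = ennreal (1 / (1 - q))"
      using q by (subst suminf_ennreal2) (auto simp: suminf_geometric intro!: summable_geometric)
    also have "\<dots> = inverse (ennreal (1 - q))"
      using q by (subst inverse_ennreal) (auto simp: inverse_eq_divide)
    finally show ?thesis .
  qed
  have "(\<Sum>n. ?q ^ n * (\<integral>\<^sup>+d. G (wmax d n) \<partial>S)) = ladder ?q (\<lambda>y. descent ?q (\<lambda>_. G y))"
    by (rule geometric_factorization[of "\<lambda>y _. G y"]) measurable
  also have "\<dots> = ladder ?q (\<lambda>y. (ladder ?q (\<lambda>_. 1) * descent ?q (\<lambda>_. 1)) * descent ?q (?f y))"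
  proof -
    have "descent ?q (\<lambda>_. G y) = descent ?q (\<lambda>_. 1) * G y" for y
      using descent_cmult[of "\<lambda>_. 1" ?q "G y"] by (simp add: mult.commute)
    then show ?thesis by (simp add: G ac_simps)
  qed
  also have "\<dots> = (ladder ?q (\<lambda>_. 1) * descent ?q (\<lambda>_. 1)) * ladder ?q (\<lambda>y. descent ?q (?f y))"
    by (rule ladder_cmult) measurable
  also have "ladder ?q (\<lambda>y. descent ?q (?f y)) = (\<Sum>n. ?q ^ n * (\<integral>\<^sup>+d. f (wsum d n) \<partial>S))"
    by (subst geometric_factorization[symmetric]) auto
  finally have "ennreal (1 - q) * (\<Sum>n. ?q ^ n * (\<integral>\<^sup>+d. G (wmax d n) \<partial>S)) =
     (ennreal (1 - q) * inverse (ennreal (1 - q))) * (\<Sum>n. ?q ^ n * (\<integral>\<^sup>+d. f (wsum d n) \<partial>S))"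
    unfolding one by (simp add: mult.assoc)
  also have "ennreal (1 - q) * inverse (ennreal (1 - q)) = 1"
    using q by (simp add: inverse_ennreal flip: ennreal_mult)
  finally show ?thesis by (simp add: pw G_def)
qed

end

section \<open>The exponential clock\<close>

abbreviation exp_law :: "real \<Rightarrow> real measure" where
  "exp_law r \<equiv> density lborel (exponential_density r)"

locale exp_clock =
  fixes r :: real
  assumes r_pos: "0 < r"
begin

sublocale clock: prob_space "exp_law r"
  by (rule prob_space_exponential_density[OF r_pos])

lemma distributed_clock: "distributed (exp_law r) lborel (\<lambda>t. t) (exponential_density r)"
  unfolding distributed_def
proof (intro conjI)
  have "distr (exp_law r) lborel (\<lambda>t. t) = exp_law r"
    by (rule distr_id2) simp
  then show "distr (exp_law r) lborel (\<lambda>t. t) = exp_law r" .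
qed auto

lemma AE_clock_pos: "AE t in exp_law r. 0 < t"
proof -
  have "AE t in lborel. t \<noteq> (0::real)" by (rule AE_lborel_singleton)
  then show ?thesis
    by (subst AE_density) (auto simp: exponential_density_def elim!: eventually_mono)
qed

lemma clock_exceeds: "0 \<le> a \<Longrightarrow> clock.prob {t. a < t} = exp (- r * a)"
  using clock.exponential_distributedD_gt[OF distributed_clock _ r_pos, of a] by (simp add: mult.commute)

text \<open>The number of grid points up to an exponential time is geometric.\<close>

lemma clock_next_idx:
  "emeasure (exp_law r) {t. next_idx m t = Suc n} =
    ennreal ((1 - exp (- r * mesh m)) * exp (- r * mesh m) ^ n)"
proof -
  let ?a = "real n * mesh m" and ?b = "real (Suc n) * mesh m"
  have ab: "0 \<le> ?a" "0 \<le> ?b" "?a \<le> ?b" by (auto intro: mult_right_mono)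
  have "AE t in lborel. t \<noteq> ?a" "AE t in lborel. t \<noteq> ?b" by (rule AE_lborel_singleton)+
  then have ae: "AE t in exp_law r. t \<noteq> ?a \<and> t \<noteq> ?b"
    by (subst AE_density) (auto elim: eventually_elim2)
  have "AE t in exp_law r. t \<in> {t. next_idx m t = Suc n} \<longleftrightarrow> t \<in> {t. ?a < t} - {t. ?b < t}"
    using ae AE_clock_pos
  proof eventually_elim
    case (elim t)
    then show ?case using next_idx_eq_iff[of t m n] by auto
  qed
  then have "emeasure (exp_law r) {t. next_idx m t = Suc n} = emeasure (exp_law r) ({t. ?a < t} - {t. ?b < t})"
    by (rule emeasure_eq_AE) auto
  also have "\<dots> = ennreal (exp (- r * ?a) - exp (- r * ?b))"
  proof -
    have "clock.prob ({t. ?a < t} - {t. ?b < t}) = clock.prob {t. ?a < t} - clock.prob {t. ?b < t}"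
    proof (rule clock.finite_measure_Diff)
      show "{t. ?b < t} \<subseteq> {t. ?a < t}" using le_less_trans[OF ab(3)] by blast
    qed auto
    then show ?thesis using ab by (simp only: clock.emeasure_eq_measure clock_exceeds)
  qed
  also have "exp (- r * ?a) = exp (- r * mesh m) ^ n"
    by (simp add: exp_of_nat_mult[symmetric] ac_simps)
  also have "exp (- r * ?b) = exp (- r * mesh m) * exp (- r * mesh m) ^ n"
    by (simp add: exp_of_nat_mult[symmetric] exp_add[symmetric] algebra_simps)
  finally show ?thesis by (simp add: algebra_simps)
qed

text \<open>Written with the next grid point after \<open>t\<close> instead of the last one before it, the geometric sum
  is an exponential integral, up to one additional term and a factor that tend to \<open>0\<close> and \<open>1\<close> as the
  mesh refines. The next grid point is preferable because paths are right-continuous.\<close>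

lemma geometric_to_clock:
  fixes F :: "nat \<Rightarrow> ennreal"
  defines "q m \<equiv> exp (- r * mesh m)"
  shows "ennreal (1 - q m) * (\<Sum>n. ennreal (q m ^ n) * F n) =
    ennreal (1 - q m) * F 0 + ennreal (q m) * (\<integral>\<^sup>+t. F (next_idx m t) \<partial>exp_law r)"
proof -
  have q: "0 \<le> q m" "q m \<le> 1" using r_pos by (auto simp: q_def)
  have "(\<integral>\<^sup>+t. F (next_idx m t) \<partial>exp_law r) =
    (\<integral>\<^sup>+t. (\<Sum>n. F (Suc n) * indicator {t. next_idx m t = Suc n} t) \<partial>exp_law r)"
  proof (rule nn_integral_cong)
    fix t :: real
    obtain k where k: "next_idx m t = Suc k" by (auto simp: next_idx_def)
    have "(\<Sum>n. F (Suc n) * indicator {t. next_idx m t = Suc n} t) =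
        (\<Sum>n\<in>{k}. F (Suc n) * indicator {t. next_idx m t = Suc n} t)"
      by (rule suminf_finite) (auto simp: k)
    then show "F (next_idx m t) = (\<Sum>n. F (Suc n) * indicator {t. next_idx m t = Suc n} t)"
      by (simp add: k)
  qed
  also have "\<dots> = (\<Sum>n. F (Suc n) * emeasure (exp_law r) {t. next_idx m t = Suc n})"
    by (subst nn_integral_suminf) (auto simp: nn_integral_cmult)
  also have "\<dots> = (\<Sum>n. ennreal (1 - q m) * (ennreal (q m ^ n) * F (Suc n)))"
    unfolding clock_next_idx q_def[symmetric] using q
    by (intro suminf_cong) (simp add: ennreal_mult ac_simps)
  finally have I: "(\<integral>\<^sup>+t. F (next_idx m t) \<partial>exp_law r) =
    ennreal (1 - q m) * (\<Sum>n. ennreal (q m ^ n) * F (Suc n))"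
    by (simp add: ennreal_suminf_cmult)
  have "(\<Sum>n. ennreal (q m ^ n) * F n) =
      (\<Sum>n. ennreal (q m ^ Suc n) * F (Suc n)) + ennreal (q m ^ 0) * F 0"
    using suminf_offset[of "\<lambda>n. ennreal (q m ^ n) * F n" 1] by (simp add: summableI)
  also have "(\<Sum>n. ennreal (q m ^ Suc n) * F (Suc n)) = ennreal (q m) * (\<Sum>n. ennreal (q m ^ n) * F (Suc n))"
    unfolding ennreal_suminf_cmult[symmetric] using q
    by (intro suminf_cong) (simp add: ennreal_mult ac_simps)
  finally show ?thesis unfolding I by (simp add: algebra_simps)
qed

lemma memoryless:
  assumes [measurable]: "h \<in> borel_measurable borel" and u: "0 \<le> u"
  shows "(\<integral>\<^sup>+t. (if u < t then h t else 0) \<partial>exp_law r) =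
    ennreal (exp (- r * u)) * (\<integral>\<^sup>+t. h (u + t) \<partial>exp_law r)"
proof -
  have "(\<integral>\<^sup>+t. (if u < t then h t else 0) \<partial>exp_law r) =
      (\<integral>\<^sup>+t. ennreal (exponential_density r t) * (if u < t then h t else 0) \<partial>lborel)"
    by (rule nn_integral_density) auto
  also have "\<dots> = (\<integral>\<^sup>+t. ennreal (exponential_density r (u + t)) * (if u < u + t then h (u + t) else 0) \<partial>lborel)"
    by (subst nn_integral_real_affine[where c = 1 and t = u]) (auto cong: if_cong)
  also have "\<dots> = (\<integral>\<^sup>+t. ennreal (exp (- r * u)) * (ennreal (exponential_density r t) * h (u + t)) \<partial>lborel)"
  proof (rule nn_integral_cong_AE)
    have "AE t in lborel. t \<noteq> (0::real)" by (rule AE_lborel_singleton)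
    then show "AE t in lborel. ennreal (exponential_density r (u + t)) * (if u < u + t then h (u + t) else 0) =
      ennreal (exp (- r * u)) * (ennreal (exponential_density r t) * h (u + t))"
    proof eventually_elim
      case (elim t)
      have e: "r * exp (- (u + t) * r) = exp (- r * u) * (r * exp (- t * r))"
        by (simp add: exp_add[symmetric] algebra_simps)
      show ?case
      proof (cases "0 < t")
        case True
        then have "exponential_density r (u + t) = exp (- r * u) * exponential_density r t"
          using u e by (simp add: exponential_density_def)
        then show ?thesis using True r_pos by (simp add: ennreal_mult exponential_density_nonneg mult.assoc)
      qed (use elim in \<open>simp add: exponential_density_def\<close>)
    qed
  qed
  also have "\<dots> = ennreal (exp (- r * u)) * (\<integral>\<^sup>+t. ennreal (exponential_density r t) * h (u + t) \<partial>lborel)"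
    by (rule nn_integral_cmult) measurable
  also have "(\<integral>\<^sup>+t. ennreal (exponential_density r t) * h (u + t) \<partial>lborel) = (\<integral>\<^sup>+t. h (u + t) \<partial>exp_law r)"
    by (rule nn_integral_density[symmetric]) auto
  finally show ?thesis .
qed

end

section \<open>Increments of a Levy process on a grid\<close>

definition step_law :: "'a measure \<Rightarrow> (real \<Rightarrow> 'a \<Rightarrow> real) \<Rightarrow> nat \<Rightarrow> real measure" where
  "step_law M X m = distr M borel (\<lambda>\<omega>. X (mesh m) \<omega> - X 0 \<omega>)"

definition grid_incr :: "(real \<Rightarrow> 'a \<Rightarrow> real) \<Rightarrow> real \<Rightarrow> nat \<Rightarrow> 'a \<Rightarrow> nat \<Rightarrow> real" where
  "grid_incr X u m \<omega> i = X (u + real (Suc i) * mesh m) \<omega> - X (u + real i * mesh m) \<omega>"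

text \<open>The natural filtration without null sets. Independence of the past and the later increments is
  proved here; augmentation changes each event by a null set only.\<close>

definition raw_filtration :: "'a measure \<Rightarrow> (real \<Rightarrow> 'a \<Rightarrow> real) \<Rightarrow> real \<Rightarrow> 'a measure" where
  "raw_filtration M X u = sigma (space M) {X s -` A \<inter> space M | s A. 0 \<le> s \<and> s \<le> u \<and> A \<in> sets borel}"

lemma wsum_grid_incr: "wsum (grid_incr X u m \<omega>) n = X (u + real n * mesh m) \<omega> - X u \<omega>"
  unfolding wsum_def grid_incr_def
  using sum_lessThan_telescope[of "\<lambda>i. X (u + real i * mesh m) \<omega>" n] by simp

lemma wmax_grid_incr:
  "X u \<omega> + wmax (grid_incr X u m \<omega>) n = Max ((\<lambda>i. X (u + real i * mesh m) \<omega>) ` {..n})"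
  unfolding wmax_def
  using Max_add_commute[of "{..n}" "wsum (grid_incr X u m \<omega>)" "X u \<omega>"] by (simp add: add.commute wsum_grid_incr)

lemma wmin_grid_incr:
  "X u \<omega> + wmin (grid_incr X u m \<omega>) n = Min ((\<lambda>i. X (u + real i * mesh m) \<omega>) ` {..n})"
  unfolding wmin_def
  using Min_add_commute[of "{..n}" "wsum (grid_incr X u m \<omega>)" "X u \<omega>"] by (simp add: add.commute wsum_grid_incr)

locale levy_from = prob_space M for M :: "'a measure" +
  fixes X :: "real \<Rightarrow> 'a \<Rightarrow> real" and x :: real
  assumes levy: "levy_process M X" and start: "AE \<omega> in M. X 0 \<omega> = x"
begin

lemma measurable_X: "0 \<le> t \<Longrightarrow> X t \<in> borel_measurable M"
  using levy by (simp add: levy_process_def)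

lemma measurable_X' [measurable (raw)]: "0 \<le> t \<Longrightarrow> (\<lambda>\<omega>. X t \<omega>) \<in> borel_measurable M"
  using measurable_X by simp

lemma measurable_X_grid [measurable]:
  "X (real i * mesh m) \<in> borel_measurable M" "X (mesh m) \<in> borel_measurable M" "X 0 \<in> borel_measurable M"
  by (intro measurable_X; simp)+

lemma cadlag_path: "\<omega> \<in> space M \<Longrightarrow> cadlag (\<lambda>t. X t \<omega>)"
  using levy by (simp add: levy_process_def)

lemma indep_increments:
  "0 \<le> t 0 \<Longrightarrow> (\<And>i. i < n \<Longrightarrow> t i \<le> t (Suc i)) \<Longrightarrow>
    indep_vars (\<lambda>_. borel) (\<lambda>i \<omega>. X (t (Suc i)) \<omega> - X (t i) \<omega>) {..<n}"
  using levy by (simp add: levy_process_def)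

lemma stationary:
  "0 \<le> s \<Longrightarrow> 0 \<le> h \<Longrightarrow> distr M borel (\<lambda>\<omega>. X (s + h) \<omega> - X s \<omega>) = distr M borel (\<lambda>\<omega>. X h \<omega> - X 0 \<omega>)"
  using levy by (simp add: levy_process_def)

lemma prob_step_law: "prob_space (step_law M X m)"
  unfolding step_law_def by (rule prob_space_distr) measurable

lemma random_walk_step_law: "random_walk (step_law M X m)"
  by (rule random_walk.intro[OF prob_step_law]) (simp add: step_law_def)

sublocale walk: random_walk "step_law M X m" for m
  by (rule random_walk_step_law)

lemma measurable_grid_incr [measurable]:
  assumes "0 \<le> u"
  shows "(\<lambda>\<omega>. grid_incr X u m \<omega> i) \<in> borel_measurable M"
  unfolding grid_incr_def using assms by (intro borel_measurable_diff measurable_X) auto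

lemma measurable_grid_incr_PiM [measurable]:
  assumes "0 \<le> u"
  shows "grid_incr X u m \<in> M \<rightarrow>\<^sub>M PiM UNIV (\<lambda>_. borel)"
  using measurable_grid_incr[OF assms] by (intro measurable_PiM_single') auto

lemma indep_grid_incr:
  assumes "0 \<le> u"
  shows "indep_vars (\<lambda>_. borel) (\<lambda>i \<omega>. grid_incr X u m \<omega> i) UNIV"
proof -
  have fin: "indep_vars (\<lambda>_. borel) (\<lambda>i \<omega>. grid_incr X u m \<omega> i) {..<n}" for n
    unfolding grid_incr_def
    using assms by (intro indep_increments[of "\<lambda>i. u + real i * mesh m"]) (auto intro!: mult_right_mono)
  show ?thesis
    unfolding indep_vars_def
  proof (intro conjI ballI)
    show "(\<lambda>\<omega>. grid_incr X u m \<omega> i) \<in> M \<rightarrow>\<^sub>M borel" for i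
      by (rule measurable_grid_incr[OF assms])
    show "indep_sets (\<lambda>i. sigma_sets (space M) {(\<lambda>\<omega>. grid_incr X u m \<omega> i) -` A \<inter> space M |A. A \<in> sets borel}) UNIV"
    proof (subst indep_sets_finite_index_sets, intro allI impI)
      fix J :: "nat set" assume "finite J"
      then obtain n where "J \<subseteq> {..<n}" using finite_nat_iff_bounded by blast
      with fin[of n] show "indep_sets (\<lambda>i. sigma_sets (space M) {(\<lambda>\<omega>. grid_incr X u m \<omega> i) -` A \<inter> space M |A. A \<in> sets borel}) J"
        unfolding indep_vars_def by (blast intro: indep_sets_mono_index)
    qed
  qed
qed

lemma distr_grid_incr_single:
  assumes "0 \<le> u"
  shows "distr M borel (\<lambda>\<omega>. grid_incr X u m \<omega> i) = step_law M X m"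
proof -
  have "u + real (Suc i) * mesh m = (u + real i * mesh m) + mesh m" by (simp add: algebra_simps)
  then show ?thesis
    unfolding grid_incr_def step_law_def using stationary[of "u + real i * mesh m" "mesh m"] assms by (simp add: add.assoc)
qed

lemma distr_grid_incr:
  assumes "0 \<le> u"
  shows "distr M (PiM UNIV (\<lambda>_. borel)) (grid_incr X u m) = PiM UNIV (\<lambda>_. step_law M X m)"
proof -
  have "distr M (PiM UNIV (\<lambda>_. borel)) (\<lambda>\<omega>. \<lambda>i\<in>UNIV. grid_incr X u m \<omega> i) =
      PiM UNIV (\<lambda>i. distr M borel (\<lambda>\<omega>. grid_incr X u m \<omega> i))"
    by (rule indep_vars_iff_distr_eq_PiM[THEN iffD1, OF _ _ indep_grid_incr[OF assms]])
       (auto intro: measurable_grid_incr[OF assms])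
  then show ?thesis by (simp add: restrict_UNIV distr_grid_incr_single[OF assms])
qed

text \<open>The times in \<open>J\<close> and the grid after \<open>u\<close> are merged into one increasing sequence, to which the
  independence of increments applies. Because \<open>X 0\<close> is almost surely constant, the values \<open>X s\<close> are
  functions of the increments before \<open>u\<close>.\<close>

lemma past_indep_future_generators:
  assumes u: "0 \<le> u" and J: "finite J" "J \<subseteq> {0..u}" and E: "\<And>s. s \<in> J \<Longrightarrow> E s \<in> sets borel"
    and B: "\<And>i. B i \<in> sets borel"
  shows "prob ({\<omega>\<in>space M. \<forall>s\<in>J. X s \<omega> \<in> E s} \<inter> {\<omega>\<in>space M. \<forall>i<N. grid_incr X u m \<omega> i \<in> B i}) =
    prob {\<omega>\<in>space M. \<forall>s\<in>J. X s \<omega> \<in> E s} * prob {\<omega>\<in>space M. \<forall>i<N. grid_incr X u m \<omega> i \<in> B i}"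
proof -
  define K where "K = J \<union> {0, u}"
  have K: "finite K" "0 \<in> K" "u \<in> K" "K \<subseteq> {0..u}" using J u by (auto simp: K_def)
  (* t runs through the observation times up to index p, where it reaches u, and then along the grid. *)
  define L where "L = sorted_list_of_set K"
  have L: "sorted L" "set L = K" "distinct L" using K by (auto simp: L_def)
  define p where "p = length L - 1"
  have len: "length L = Suc p" using K L by (cases L) (auto simp: p_def)
  have L_le: "L ! i \<le> L ! j" if "i \<le> j" "j \<le> p" for i j
    using sorted_nth_mono[OF L(1), of i j] that len by auto
  have L0: "L ! 0 = 0"
  proof -
    obtain i where "i \<le> p" "L ! i = 0" using K(2) L(2) len by (metis in_set_conv_nth less_Suc_eq_le)
    moreover have "0 \<le> L ! 0" using K(4) L(2) len nth_mem[of 0 L] by auto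
    ultimately show ?thesis using L_le[of 0 i] by auto
  qed
  have Lp: "L ! p = u"
  proof -
    obtain i where "i \<le> p" "L ! i = u" using K(3) L(2) len by (metis in_set_conv_nth less_Suc_eq_le)
    moreover have "L ! p \<le> u" using K(4) L(2) len nth_mem[of p L] by auto
    ultimately show ?thesis using L_le[of i p] by auto
  qed
  define t where "t i = (if i < p then L ! i else u + real (i - p) * mesh m)" for i
  have t_L: "t i = L ! i" if "i \<le> p" for i
    using that Lp by (auto simp: t_def)
  have t_grid: "t (p + i) = u + real i * mesh m" for i
    by (simp add: t_def)
  have t_mono: "t i \<le> t (Suc i)" for i
  proof (cases "Suc i \<le> p")
    case True then show ?thesis using t_L[of i] t_L[of "Suc i"] L_le[of i "Suc i"] by simp
  next
    case False
    then obtain j where "i = p + j" by (metis le_Suc_ex not_less_eq_eq)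
    then show ?thesis using t_grid[of j] t_grid[of "Suc j"] by (simp add: mult_right_mono)
  qed
  define Y where "Y i \<omega> = X (t (Suc i)) \<omega> - X (t i) \<omega>" for i \<omega>
  have indep: "indep_vars (\<lambda>_. borel) Y {..<p + N}"
    unfolding Y_def using t_mono t_L[of 0] L0 by (intro indep_increments) auto
  have t_nonneg: "0 \<le> t i" for i
  proof -
    have "t 0 \<le> t i" by (rule lift_Suc_mono_le[of t, OF t_mono]) simp
    then show ?thesis using t_L[of 0] L0 by simp
  qed
  have Y_grid: "Y (p + i) \<omega> = grid_incr X u m \<omega> i" for i \<omega>
    using t_grid[of i] t_grid[of "Suc i"] by (simp add: Y_def grid_incr_def)
  obtain k where k: "\<And>s. s \<in> J \<Longrightarrow> k s \<le> p \<and> L ! k s = s"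
  proof -
    have "\<forall>s\<in>J. \<exists>i. i \<le> p \<and> L ! i = s"
      using L(2) len by (metis K_def UnCI in_set_conv_nth less_Suc_eq_le)
    then show ?thesis using that by metis
  qed
  have X_sum: "X s \<omega> = X 0 \<omega> + (\<Sum>i<k s. Y i \<omega>)" if "s \<in> J" for s \<omega>
    using sum_lessThan_telescope[of "\<lambda>i. X (t i) \<omega>" "k s"] k[OF that] t_L[of "k s"] t_L[of 0] L0
    by (simp add: Y_def)
  let ?P = "PiM {..<p} (\<lambda>_. borel :: real measure)" and ?Q = "PiM {p..<p + N} (\<lambda>_. borel :: real measure)"
  define past where "past = {y \<in> space ?P. \<forall>s\<in>J. x + (\<Sum>i<k s. y i) \<in> E s}"
  define future where "future = {y \<in> space ?Q. \<forall>i\<in>{..<N}. y (p + i) \<in> B i}"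
  have "past \<in> sets ?P"
    unfolding past_def
  proof (intro sets.sets_Collect_finite_All J(1))
    fix s assume s: "s \<in> J"
    have "(\<lambda>y. x + (\<Sum>i<k s. y i)) \<in> borel_measurable ?P"
      using k[OF s] by (intro borel_measurable_add borel_measurable_const borel_measurable_sum measurable_component_singleton) auto
    from measurable_sets[OF this E[OF s]]
    show "{y \<in> space ?P. x + (\<Sum>i<k s. y i) \<in> E s} \<in> sets ?P"
      by (simp add: vimage_def Int_def conj_commute)
  qed
  moreover have "future \<in> sets ?Q"
    unfolding future_def
  proof (intro sets.sets_Collect_finite_All finite_lessThan)
    fix i assume i: "i \<in> {..<N}"
    have "(\<lambda>y. y (p + i)) \<in> borel_measurable ?Q"
      using i by (intro measurable_component_singleton) auto
    from measurable_sets[OF this B]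
    show "{y \<in> space ?Q. y (p + i) \<in> B i} \<in> sets ?Q"
      by (simp add: vimage_def Int_def conj_commute)
  qed
  moreover have "indep_var ?P (\<lambda>\<omega>. restrict (\<lambda>i. Y i \<omega>) {..<p}) ?Q (\<lambda>\<omega>. restrict (\<lambda>i. Y i \<omega>) {p..<p+N})"
    by (rule indep_var_restrict[OF indep]) auto
  ultimately have eq: "prob ((\<lambda>\<omega>. (restrict (\<lambda>i. Y i \<omega>) {..<p}, restrict (\<lambda>i. Y i \<omega>) {p..<p+N})) -` (past \<times> future) \<inter> space M) =
    prob ((\<lambda>\<omega>. restrict (\<lambda>i. Y i \<omega>) {..<p}) -` past \<inter> space M) *
    prob ((\<lambda>\<omega>. restrict (\<lambda>i. Y i \<omega>) {p..<p+N}) -` future \<inter> space M)"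
    by (intro indep_varD)
  have fut: "restrict (\<lambda>i. Y i \<omega>) {p..<p+N} \<in> future \<longleftrightarrow> (\<forall>i<N. grid_incr X u m \<omega> i \<in> B i)" for \<omega>
    by (auto simp: future_def space_PiM Y_grid)
  have past: "restrict (\<lambda>i. Y i \<omega>) {..<p} \<in> past \<longleftrightarrow> (\<forall>s\<in>J. x + (\<Sum>i<k s. Y i \<omega>) \<in> E s)" for \<omega>
  proof -
    have "(\<Sum>i<k s. restrict (\<lambda>i. Y i \<omega>) {..<p} i) = (\<Sum>i<k s. Y i \<omega>)" if "s \<in> J" for s
      using k[OF that] by (intro sum.cong) auto
    then show ?thesis by (auto simp: past_def space_PiM)
  qed
  have mX [measurable]: "\<And>s. s \<in> J \<Longrightarrow> (\<lambda>\<omega>. X s \<omega>) \<in> borel_measurable M" using J by (intro measurable_X') auto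
  have mY [measurable]: "\<And>i. Y i \<in> borel_measurable M"
    unfolding Y_def using t_nonneg by (intro borel_measurable_diff measurable_X') auto
  define A where "A = {\<omega>\<in>space M. \<forall>s\<in>J. X s \<omega> \<in> E s}"
  define A' where "A' = {\<omega>\<in>space M. \<forall>s\<in>J. x + (\<Sum>i<k s. Y i \<omega>) \<in> E s}"
  define C where "C = {\<omega>\<in>space M. \<forall>i<N. grid_incr X u m \<omega> i \<in> B i}"
  have mA [measurable]: "A \<in> sets M"
    unfolding A_def using J(1) E by (intro sets.sets_Collect_finite_All) auto
  have mA' [measurable]: "A' \<in> sets M"
    unfolding A'_def using J(1) E by (intro sets.sets_Collect_finite_All) auto
  have mC [measurable]: "C \<in> sets M"
    unfolding C_def using B measurable_grid_incr[OF u] by measurable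
  have ae: "AE \<omega> in M. \<omega> \<in> A \<longleftrightarrow> \<omega> \<in> A'"
    using start by eventually_elim (auto simp: X_sum A_def A'_def)
  have "prob A = prob A'"
    by (rule measure_eq_AE[OF ae mA mA'])
  moreover have "prob (A \<inter> C) = prob (A' \<inter> C)"
    by (rule measure_eq_AE) (use ae in \<open>auto elim: eventually_mono\<close>)
  moreover have "(\<lambda>\<omega>. restrict (\<lambda>i. Y i \<omega>) {..<p}) -` past \<inter> space M = A'"
    by (auto simp: past A'_def)
  moreover have "(\<lambda>\<omega>. restrict (\<lambda>i. Y i \<omega>) {p..<p+N}) -` future \<inter> space M = C"
    by (auto simp: fut C_def)
  moreover have "(\<lambda>\<omega>. (restrict (\<lambda>i. Y i \<omega>) {..<p}, restrict (\<lambda>i. Y i \<omega>) {p..<p+N})) -` (past \<times> future) \<inter> space M = A' \<inter> C"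
    by (auto simp: fut past A'_def C_def)
  ultimately show ?thesis
    using eq unfolding A_def[symmetric] C_def[symmetric] by simp
qed

end

definition cylinders :: "'a set \<Rightarrow> ('i \<Rightarrow> 'a \<Rightarrow> real) \<Rightarrow> 'i set \<Rightarrow> 'a set set" where
  "cylinders \<Omega> Y I = {{\<omega>\<in>\<Omega>. \<forall>i\<in>J. Y i \<omega> \<in> E i} | J E. finite J \<and> J \<subseteq> I \<and> (\<forall>i. E i \<in> sets borel)}"

lemma Int_stable_cylinders: "Int_stable (cylinders \<Omega> Y I)"
proof (rule Int_stableI)
  fix a b assume "a \<in> cylinders \<Omega> Y I" "b \<in> cylinders \<Omega> Y I"
  then obtain J E J' E' where
    a: "a = {\<omega>\<in>\<Omega>. \<forall>s\<in>J. Y s \<omega> \<in> E s}" "finite J" "J \<subseteq> I" "\<forall>s. E s \<in> sets borel" and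
    b: "b = {\<omega>\<in>\<Omega>. \<forall>s\<in>J'. Y s \<omega> \<in> E' s}" "finite J'" "J' \<subseteq> I" "\<forall>s. E' s \<in> sets borel"
    unfolding cylinders_def by blast
  define E'' where "E'' s = (if s \<in> J then E s else UNIV) \<inter> (if s \<in> J' then E' s else UNIV)" for s
  have eq: "a \<inter> b = {\<omega>\<in>\<Omega>. \<forall>s\<in>J \<union> J'. Y s \<omega> \<in> E'' s}"
    unfolding a b E''_def by auto
  have m: "\<forall>s. E'' s \<in> sets borel" using a b by (auto simp: E''_def)
  show "a \<inter> b \<in> cylinders \<Omega> Y I"
    unfolding cylinders_def mem_Collect_eq
    by (rule exI[of _ "J \<union> J'"], rule exI[of _ E'']) (use eq m a b in auto)
qed

lemma cylinder_single: "i \<in> I \<Longrightarrow> C \<in> sets borel \<Longrightarrow> Y i -` C \<inter> \<Omega> \<in> cylinders \<Omega> Y I"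
  unfolding cylinders_def mem_Collect_eq
  by (rule exI[of _ "{i}"], rule exI[of _ "\<lambda>_. C"]) auto

lemma cylinders_sets:
  assumes "\<And>i. i \<in> I \<Longrightarrow> Y i \<in> borel_measurable M"
  shows "cylinders (space M) Y I \<subseteq> sets M"
proof
  fix a assume "a \<in> cylinders (space M) Y I"
  then obtain J E where a: "a = {\<omega>\<in>space M. \<forall>s\<in>J. Y s \<omega> \<in> E s}" "finite J" "J \<subseteq> I" "\<forall>s. E s \<in> sets borel"
    unfolding cylinders_def by blast
  show "a \<in> sets M" unfolding a(1)
  proof (intro sets.sets_Collect_finite_All a(2))
    fix s assume "s \<in> J"
    then have "Y s \<in> borel_measurable M" using a(3) by (intro assms) auto
    from measurable_sets[OF this] a(4) show "{\<omega>\<in>space M. Y s \<omega> \<in> E s} \<in> sets M"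
      by (simp add: vimage_def Int_def conj_commute)
  qed
qed

context levy_from begin

abbreviation past_cylinders :: "real \<Rightarrow> 'a set set" where
  "past_cylinders u \<equiv> cylinders (space M) X {0..u}"

abbreviation future_cylinders :: "real \<Rightarrow> nat \<Rightarrow> 'a set set" where
  "future_cylinders u m \<equiv> cylinders (space M) (\<lambda>i \<omega>. grid_incr X u m \<omega> i) UNIV"

lemma space_raw_filtration [simp]: "space (raw_filtration M X u) = space M"
  unfolding raw_filtration_def by (rule space_measure_of) auto

lemma sets_raw_filtration:
  "sets (raw_filtration M X u) = sigma_sets (space M) {X s -` A \<inter> space M | s A. 0 \<le> s \<and> s \<le> u \<and> A \<in> sets borel}"
  unfolding raw_filtration_def by (rule sets_measure_of) auto

lemma sets_raw_filtration_subset: "sets (raw_filtration M X u) \<subseteq> sets M"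
  unfolding sets_raw_filtration
  by (rule sets.sigma_sets_subset) (auto intro!: measurable_sets[OF measurable_X])

lemma raw_filtration_past_cylinders:
  "sets (raw_filtration M X u) \<subseteq> sigma_sets (space M) (past_cylinders u)"
  unfolding sets_raw_filtration
  by (rule sigma_sets_mono) (auto intro!: sigma_sets.Basic cylinder_single)

lemma measurable_X_raw: "0 \<le> s \<Longrightarrow> s \<le> u \<Longrightarrow> X s \<in> borel_measurable (raw_filtration M X u)"
  by (rule measurableI) (auto simp: sets_raw_filtration intro!: sigma_sets.Basic)

lemma past_indep_future:
  assumes u: "0 \<le> u" and A: "A \<in> sets (raw_filtration M X u)" and B: "B \<in> sets (PiM UNIV (\<lambda>_. borel))"
  shows "prob (A \<inter> (grid_incr X u m -` B \<inter> space M)) = prob A * prob (grid_incr X u m -` B \<inter> space M)"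
proof -
  have past_sets: "past_cylinders u \<subseteq> events" by (intro cylinders_sets measurable_X) simp
  have future_sets: "future_cylinders u m \<subseteq> events" by (intro cylinders_sets measurable_grid_incr u)
  have "indep_set (past_cylinders u) (future_cylinders u m)"
  proof (rule indep_setI[OF past_sets future_sets])
    fix a b assume "a \<in> past_cylinders u" "b \<in> future_cylinders u m"
    then obtain J E J' B where ab:
      "a = {\<omega>\<in>space M. \<forall>s\<in>J. X s \<omega> \<in> E s}" "finite J" "J \<subseteq> {0..u}" "\<forall>s. E s \<in> sets borel"
      "b = {\<omega>\<in>space M. \<forall>i\<in>J'. grid_incr X u m \<omega> i \<in> B i}" "finite J'" "\<forall>i. B i \<in> sets borel"
      unfolding cylinders_def by blast
    obtain N where N: "J' \<subseteq> {..<N}" using ab(6) finite_nat_iff_bounded by blast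
    define B' where "B' i = (if i \<in> J' then B i else UNIV)" for i
    have b: "b = {\<omega>\<in>space M. \<forall>i<N. grid_incr X u m \<omega> i \<in> B' i}"
      unfolding ab(5) B'_def using N by auto
    show "prob (a \<inter> b) = prob a * prob b"
      unfolding ab(1) b by (rule past_indep_future_generators[OF u ab(2,3)]) (use ab in \<open>auto simp: B'_def\<close>)
  qed
  from indep_set_sigma_sets[OF this Int_stable_cylinders Int_stable_cylinders]
  have indep: "indep_set (sigma_sets (space M) (past_cylinders u)) (sigma_sets (space M) (future_cylinders u m))" .
  define H where "H = sigma (space M) (future_cylinders u m)"
  have sub: "future_cylinders u m \<subseteq> Pow (space M)"
    using future_sets sets.space_closed by blast
  have H: "space H = space M" "sets H = sigma_sets (space M) (future_cylinders u m)"
    unfolding H_def using sub by auto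
  have "grid_incr X u m \<in> H \<rightarrow>\<^sub>M PiM UNIV (\<lambda>_. borel)"
  proof (rule measurable_PiM_single')
    fix i :: nat
    show "(\<lambda>\<omega>. grid_incr X u m \<omega> i) \<in> borel_measurable H"
    proof (rule measurableI)
      fix C :: "real set" assume C: "C \<in> sets borel"
      have "(\<lambda>\<omega>. grid_incr X u m \<omega> i) -` C \<inter> space M \<in> future_cylinders u m"
        using cylinder_single[where Y = "\<lambda>i \<omega>. grid_incr X u m \<omega> i" and i = i, OF UNIV_I C] .
      then show "(\<lambda>\<omega>. grid_incr X u m \<omega> i) -` C \<inter> space H \<in> sets H"
        unfolding H by auto
    qed auto
  qed auto
  from measurable_sets[OF this B] have "grid_incr X u m -` B \<inter> space M \<in> sigma_sets (space M) (future_cylinders u m)"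
    unfolding H .
  with A raw_filtration_past_cylinders show ?thesis
    by (intro indep_setD[OF indep]) auto
qed

text \<open>A functional of the past and of the later increments may be integrated over the increments
  first, with the past held fixed.\<close>

lemma freeze_past:
  assumes u: "0 \<le> u" and Phi [measurable]: "\<Phi> \<in> borel_measurable (raw_filtration M X u \<Otimes>\<^sub>M PiM UNIV (\<lambda>_. borel))"
  shows "(\<integral>\<^sup>+\<omega>. \<Phi> (\<omega>, grid_incr X u m \<omega>) \<partial>M) = (\<integral>\<^sup>+\<omega>. \<integral>\<^sup>+d. \<Phi> (\<omega>, d) \<partial>walk.S m \<partial>M)"
proof -
  let ?F = "raw_filtration M X u" and ?P = "PiM UNIV (\<lambda>_::nat. borel :: real measure)"
  let ?S = "walk.S m"
  have id: "(\<lambda>\<omega>. \<omega>) \<in> M \<rightarrow>\<^sub>M ?F"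
    using sets_raw_filtration_subset by (intro measurableI) auto
  note D = measurable_grid_incr_PiM[OF u, of m]
  have pair: "(\<lambda>\<omega>. (\<omega>, grid_incr X u m \<omega>)) \<in> M \<rightarrow>\<^sub>M ?F \<Otimes>\<^sub>M ?P"
    by (rule measurable_Pair[OF id D])
  interpret F: prob_space "distr M ?F (\<lambda>\<omega>. \<omega>)" by (rule prob_space_distr[OF id])
  have sS: "sigma_finite_measure ?S" by (rule walk.sigma_finite_S)
  have eq: "distr M ?F (\<lambda>\<omega>. \<omega>) \<Otimes>\<^sub>M ?S = distr M (?F \<Otimes>\<^sub>M ?P) (\<lambda>\<omega>. (\<omega>, grid_incr X u m \<omega>))"
  proof (rule pair_measure_eqI[OF F.sigma_finite_measure_axioms sS])
    show "sets (distr M ?F (\<lambda>\<omega>. \<omega>) \<Otimes>\<^sub>M ?S) = sets (distr M (?F \<Otimes>\<^sub>M ?P) (\<lambda>\<omega>. (\<omega>, grid_incr X u m \<omega>)))"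
      by (simp cong: sets_pair_measure_cong add: walk.sets_S)
    fix A B assume "A \<in> sets (distr M ?F (\<lambda>\<omega>. \<omega>))" "B \<in> sets ?S"
    then have A: "A \<in> sets ?F" and B: "B \<in> sets ?P" by (auto simp: walk.sets_S)
    have A': "A \<subseteq> space M" using sets.sets_into_space[OF A] by simp
    have "emeasure (distr M ?F (\<lambda>\<omega>. \<omega>)) A = emeasure M A"
      using emeasure_distr[OF id A] A' by (simp add: Int_absorb2 vimage_def)
    moreover have "emeasure ?S B = emeasure M (grid_incr X u m -` B \<inter> space M)"
      using emeasure_distr[OF D B] distr_grid_incr[OF u, of m] by simp
    moreover have "emeasure (distr M (?F \<Otimes>\<^sub>M ?P) (\<lambda>\<omega>. (\<omega>, grid_incr X u m \<omega>))) (A \<times> B) =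
      emeasure M (A \<inter> (grid_incr X u m -` B \<inter> space M))"
      by (subst emeasure_distr[OF pair pair_measureI[OF A B]]) (auto intro!: arg_cong[of _ _ "emeasure M"])
    ultimately show "emeasure (distr M ?F (\<lambda>\<omega>. \<omega>)) A * emeasure ?S B =
      emeasure (distr M (?F \<Otimes>\<^sub>M ?P) (\<lambda>\<omega>. (\<omega>, grid_incr X u m \<omega>))) (A \<times> B)"
      using past_indep_future[OF u A B, of m] by (simp add: emeasure_eq_measure ennreal_mult)
  qed
  have Phi': "\<Phi> \<in> borel_measurable (distr M ?F (\<lambda>\<omega>. \<omega>) \<Otimes>\<^sub>M ?S)"
    using Phi by (simp cong: measurable_cong_sets sets_pair_measure_cong add: walk.sets_S)
  have "(\<integral>\<^sup>+\<omega>. \<Phi> (\<omega>, grid_incr X u m \<omega>) \<partial>M) =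
      (\<integral>\<^sup>+z. \<Phi> z \<partial>distr M (?F \<Otimes>\<^sub>M ?P) (\<lambda>\<omega>. (\<omega>, grid_incr X u m \<omega>)))"
    by (subst nn_integral_distr[OF pair]) (simp_all add: Phi)
  also have "\<dots> = (\<integral>\<^sup>+\<omega>. \<integral>\<^sup>+d. \<Phi> (\<omega>, d) \<partial>?S \<partial>distr M ?F (\<lambda>\<omega>. \<omega>))"
    unfolding eq[symmetric]
    by (rule sigma_finite_measure.nn_integral_fst[OF sS Phi', symmetric])
  also have "\<dots> = (\<integral>\<^sup>+\<omega>. \<integral>\<^sup>+d. \<Phi> (\<omega>, d) \<partial>?S \<partial>M)"
  proof (rule nn_integral_distr[OF id])
    show "(\<lambda>\<omega>. \<integral>\<^sup>+d. \<Phi> (\<omega>, d) \<partial>?S) \<in> borel_measurable (distr M ?F (\<lambda>\<omega>. \<omega>))"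
      using sigma_finite_measure.borel_measurable_nn_integral_fst[OF sS Phi'] by simp
  qed
  finally show ?thesis .
qed

text \<open>The discrete factorization restarted at time \<open>u\<close> from the random position \<open>X u\<close>, on an event of
  the past.\<close>

lemma stopped_wiener_hopf:
  assumes u: "0 \<le> u" and A [measurable]: "A \<in> sets (raw_filtration M X u)"
    and f [measurable]: "f \<in> borel_measurable borel" and q: "0 \<le> q" "q < 1"
  shows "(\<Sum>n. ennreal (q ^ n) * (\<integral>\<^sup>+\<omega>. indicator A \<omega> * f (X (u + real n * mesh m) \<omega>) \<partial>M)) =
    (\<Sum>n. ennreal (q ^ n) * (\<integral>\<^sup>+\<omega>. indicator A \<omega> *
       (ennreal (1 - q) * (\<Sum>j. ennreal (q ^ j) * (\<integral>\<^sup>+e. f (Max ((\<lambda>i. X (u + real i * mesh m) \<omega>) ` {..n}) + wmin e j) \<partial>walk.S m))) \<partial>M))"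
proof -
  let ?F = "raw_filtration M X u"
  have [measurable]: "X u \<in> borel_measurable ?F" by (rule measurable_X_raw) (use u in auto)
  have id: "(\<lambda>\<omega>. \<omega>) \<in> M \<rightarrow>\<^sub>M ?F"
    using sets_raw_filtration_subset by (intro measurableI) auto
  have [measurable]: "X u \<in> borel_measurable M" by (rule measurable_X[OF u])
  have [measurable]: "A \<in> sets M" by (rule subsetD[OF sets_raw_filtration_subset A])
  interpret S: sigma_finite_measure "walk.S m" by (rule walk.sigma_finite_S)
  define g where "g y = ennreal (1 - q) * (\<Sum>j. ennreal (q ^ j) * (\<integral>\<^sup>+e. f (y + wmin e j) \<partial>walk.S m))" for y
  have [measurable]: "g \<in> borel_measurable borel" unfolding g_def by measurable
  have wh: "(\<Sum>n. ennreal (q ^ n) * (\<integral>\<^sup>+d. f (a + wsum d n) \<partial>walk.S m)) =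
      (\<Sum>n. ennreal (q ^ n) * (\<integral>\<^sup>+d. g (a + wmax d n) \<partial>walk.S m))" for a
  proof -
    have "(\<Sum>n. ennreal (q ^ n) * (\<integral>\<^sup>+d. f (a + wsum d n) \<partial>walk.S m)) =
      ennreal (1 - q) * (\<Sum>n. ennreal (q ^ n) * (\<integral>\<^sup>+d. (\<Sum>j. ennreal (q ^ j) * (\<integral>\<^sup>+e. f (a + (wmax d n + wmin e j)) \<partial>walk.S m)) \<partial>walk.S m))"
      by (rule walk.wiener_hopf) (use q in auto)
    also have "\<dots> = (\<Sum>n. ennreal (q ^ n) * (\<integral>\<^sup>+d. g (a + wmax d n) \<partial>walk.S m))"
    proof -
      have g_int: "(\<integral>\<^sup>+d. g (a + wmax d n) \<partial>walk.S m) =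
        ennreal (1 - q) * (\<integral>\<^sup>+d. (\<Sum>j. ennreal (q ^ j) * (\<integral>\<^sup>+e. f (a + (wmax d n + wmin e j)) \<partial>walk.S m)) \<partial>walk.S m)" for n
        unfolding g_def add.assoc by (rule nn_integral_cmult) measurable
      then show ?thesis
        unfolding g_int ennreal_suminf_cmult[symmetric] by (intro suminf_cong mult.left_commute)
    qed
    finally show ?thesis .
  qed
  have fr: "(\<integral>\<^sup>+\<omega>. indicator A \<omega> * h (X u \<omega> + w (grid_incr X u m \<omega>)) \<partial>M) =
      (\<integral>\<^sup>+\<omega>. indicator A \<omega> * (\<integral>\<^sup>+d. h (X u \<omega> + w d) \<partial>walk.S m) \<partial>M)"
    if [measurable]: "h \<in> borel_measurable borel" "w \<in> borel_measurable (PiM UNIV (\<lambda>_. borel))" for h w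
  proof -
    have "(\<integral>\<^sup>+\<omega>. indicator A \<omega> * h (X u \<omega> + w (grid_incr X u m \<omega>)) \<partial>M) =
      (\<integral>\<^sup>+\<omega>. \<integral>\<^sup>+d. indicator A \<omega> * h (X u \<omega> + w d) \<partial>walk.S m \<partial>M)"
      using freeze_past[OF u, of "\<lambda>z. indicator A (fst z) * h (X u (fst z) + w (snd z))" m] by simp
    also have "\<dots> = (\<integral>\<^sup>+\<omega>. indicator A \<omega> * (\<integral>\<^sup>+d. h (X u \<omega> + w d) \<partial>walk.S m) \<partial>M)"
      by (intro nn_integral_cong nn_integral_cmult) measurable
    finally show ?thesis .
  qed
  have sum_in: "(\<Sum>n. ennreal (q ^ n) * (\<integral>\<^sup>+\<omega>. indicator A \<omega> * (\<integral>\<^sup>+d. h (X u \<omega> + w d n) \<partial>walk.S m) \<partial>M)) =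
      (\<integral>\<^sup>+\<omega>. indicator A \<omega> * (\<Sum>n. ennreal (q ^ n) * (\<integral>\<^sup>+d. h (X u \<omega> + w d n) \<partial>walk.S m)) \<partial>M)"
    if [measurable]: "h \<in> borel_measurable borel" "\<And>n. (\<lambda>d. w d n) \<in> borel_measurable (PiM UNIV (\<lambda>_. borel))"
    for h and w :: "(nat \<Rightarrow> real) \<Rightarrow> nat \<Rightarrow> real"
  proof -
    have "(\<integral>\<^sup>+\<omega>. indicator A \<omega> * (\<Sum>n. ennreal (q ^ n) * (\<integral>\<^sup>+d. h (X u \<omega> + w d n) \<partial>walk.S m)) \<partial>M) =
      (\<integral>\<^sup>+\<omega>. (\<Sum>n. ennreal (q ^ n) * (indicator A \<omega> * (\<integral>\<^sup>+d. h (X u \<omega> + w d n) \<partial>walk.S m))) \<partial>M)"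
      unfolding ennreal_suminf_cmult[symmetric] by (simp add: mult.left_commute)
    also have "\<dots> = (\<Sum>n. ennreal (q ^ n) * (\<integral>\<^sup>+\<omega>. indicator A \<omega> * (\<integral>\<^sup>+d. h (X u \<omega> + w d n) \<partial>walk.S m) \<partial>M))"
      by (subst nn_integral_suminf, measurable, intro suminf_cong nn_integral_cmult) measurable
    finally show ?thesis ..
  qed
  have "(\<Sum>n. ennreal (q ^ n) * (\<integral>\<^sup>+\<omega>. indicator A \<omega> * f (X (u + real n * mesh m) \<omega>) \<partial>M)) =
    (\<Sum>n. ennreal (q ^ n) * (\<integral>\<^sup>+\<omega>. indicator A \<omega> * (\<integral>\<^sup>+d. f (X u \<omega> + wsum d n) \<partial>walk.S m) \<partial>M))"
    using fr[OF f measurable_wsum] by (simp add: wsum_grid_incr)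
  also have "\<dots> = (\<Sum>n. ennreal (q ^ n) * (\<integral>\<^sup>+\<omega>. indicator A \<omega> * (\<integral>\<^sup>+d. g (X u \<omega> + wmax d n) \<partial>walk.S m) \<partial>M))"
    by (subst (1 2) sum_in) (simp_all add: wh)
  also have "\<dots> = (\<Sum>n. ennreal (q ^ n) * (\<integral>\<^sup>+\<omega>. indicator A \<omega> * g (Max ((\<lambda>i. X (u + real i * mesh m) \<omega>) ` {..n})) \<partial>M))"
    by (subst fr[symmetric]) (simp_all add: wmax_grid_incr)
  finally show ?thesis unfolding g_def .
qed

end

section \<open>Wiener-Hopf factorization of a Levy process\<close>

definition low :: "(real \<Rightarrow> 'a \<Rightarrow> real) \<Rightarrow> real \<Rightarrow> 'a \<Rightarrow> real" where
  "low X t \<omega> = (INF s\<in>{0..max 0 t}. X s \<omega>)"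

text \<open>The upper end is at least \<open>u\<close>, which makes the supremum a measurable function of all real \<open>t\<close>;
  likewise the \<open>max\<close> in \<open>low\<close>.\<close>

definition peak :: "(real \<Rightarrow> 'a \<Rightarrow> real) \<Rightarrow> real \<Rightarrow> real \<Rightarrow> 'a \<Rightarrow> real" where
  "peak X u t \<omega> = (SUP s\<in>{u..max u t}. X s \<omega>)"

lemma grid_low:
  assumes "cadlag (\<lambda>t. X t \<omega>)"
  shows "(\<lambda>m. Min ((\<lambda>i. X (real i * mesh m) \<omega>) ` {..next_idx m t})) \<longlonglongrightarrow> low X t \<omega>"
  using grid_Min_tendsto_INF[OF assms, of "max 0 t"] by (simp add: low_def next_idx_max)

lemma grid_peak:
  assumes "cadlag (\<lambda>t. X t \<omega>)" "0 \<le> u"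
  shows "(\<lambda>m. Max ((\<lambda>i. X (u + real i * mesh m) \<omega>) ` {..next_idx m (t - u)})) \<longlonglongrightarrow> peak X u t \<omega>"
proof -
  have "(+) u ` {0..max 0 (t - u)} = {u..max u t}"
    using image_add_atLeastAtMost[of u 0 "max 0 (t - u)"] by (simp add: max_def split: if_splits)
  then have "(\<lambda>s. X (u + s) \<omega>) ` {0..max 0 (t - u)} = (\<lambda>s. X s \<omega>) ` {u..max u t}"
    using image_image[of "\<lambda>s. X s \<omega>" "(+) u" "{0..max 0 (t - u)}"] by simp
  then show ?thesis
    using grid_Max_tendsto_SUP[OF cadlag_shift[OF assms], of "max 0 (t - u)"]
    by (simp add: peak_def next_idx_max)
qed

lemma grid_path:
  assumes "cadlag (\<lambda>t. X t \<omega>)" "0 \<le> u"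
  shows "(\<lambda>m. X (u + real (next_idx m t) * mesh m) \<omega>) \<longlonglongrightarrow> X (u + max 0 t) \<omega>"
  using cadlag_next_time[OF cadlag_shift[OF assms], of "max 0 t"] by (simp add: next_idx_max)

lemma continuous_ennreal_compose:
  fixes f :: "real \<Rightarrow> ennreal"
  assumes "continuous_on UNIV f" "(y \<longlongrightarrow> l) F"
  shows "((\<lambda>i. f (y i)) \<longlongrightarrow> f l) F"
  using continuous_on_tendsto_compose[OF assms] by simp

context levy_from begin

lemma measurable_grid_functional:
  assumes V [measurable]: "\<And>n. V n \<in> borel_measurable M" and b [measurable]: "b \<in> borel_measurable N"
    and a [measurable]: "a \<in> N \<rightarrow>\<^sub>M M"
  shows "(\<lambda>z. V (next_idx m (b z)) (a z) :: real) \<in> borel_measurable N"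
  by (rule measurable_compose_countable[where f = "\<lambda>n z. V n (a z)" and g = "\<lambda>z. next_idx m (b z)"]) measurable

lemma measurable_path_pair [measurable (raw)]:
  assumes b [measurable]: "b \<in> borel_measurable N" and a [measurable]: "a \<in> N \<rightarrow>\<^sub>M M"
  shows "(\<lambda>z. X (max 0 (b z)) (a z)) \<in> borel_measurable N"
proof (rule borel_measurable_LIMSEQ_metric)
  show "(\<lambda>z. X (real (next_idx m (b z)) * mesh m) (a z)) \<in> borel_measurable N" for m
    by (rule measurable_grid_functional[OF _ b a, of "\<lambda>n. X (real n * mesh m)"]) measurable
  fix z assume "z \<in> space N"
  then have "a z \<in> space M" using measurable_space[OF a] by simp
  then show "(\<lambda>m. X (real (next_idx m (b z)) * mesh m) (a z)) \<longlonglongrightarrow> X (max 0 (b z)) (a z)"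
    using grid_path[where X = X and u = 0, OF cadlag_path] by simp
qed

lemma measurable_low [measurable (raw)]:
  assumes b [measurable]: "b \<in> borel_measurable N" and a [measurable]: "a \<in> N \<rightarrow>\<^sub>M M"
  shows "(\<lambda>z. low X (b z) (a z)) \<in> borel_measurable N"
proof (rule borel_measurable_LIMSEQ_metric)
  show "(\<lambda>z. Min ((\<lambda>i. X (real i * mesh m) (a z)) ` {..next_idx m (b z)})) \<in> borel_measurable N" for m
    by (rule measurable_grid_functional[OF _ b a, of "\<lambda>n \<omega>. Min ((\<lambda>i. X (real i * mesh m) \<omega>) ` {..n})"]) measurable
  fix z assume "z \<in> space N"
  then have "a z \<in> space M" using measurable_space[OF a] by simp
  then show "(\<lambda>m. Min ((\<lambda>i. X (real i * mesh m) (a z)) ` {..next_idx m (b z)})) \<longlonglongrightarrow> low X (b z) (a z)"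
    by (intro grid_low cadlag_path)
qed

lemma measurable_peak [measurable (raw)]:
  assumes u: "0 \<le> u" and b [measurable]: "b \<in> borel_measurable N" and a [measurable]: "a \<in> N \<rightarrow>\<^sub>M M"
  shows "(\<lambda>z. peak X u (b z) (a z)) \<in> borel_measurable N"
proof (rule borel_measurable_LIMSEQ_metric)
  have [measurable]: "X (u + real i * mesh m) \<in> borel_measurable M" for i m
    using u by (intro measurable_X) simp
  show "(\<lambda>z. Max ((\<lambda>i. X (u + real i * mesh m) (a z)) ` {..next_idx m (b z - u)})) \<in> borel_measurable N" for m
    by (rule measurable_grid_functional[OF _ _ a, of "\<lambda>n \<omega>. Max ((\<lambda>i. X (u + real i * mesh m) \<omega>) ` {..n})"]) measurable
  fix z assume "z \<in> space N"
  then have "a z \<in> space M" using measurable_space[OF a] by simp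
  then show "(\<lambda>m. Max ((\<lambda>i. X (u + real i * mesh m) (a z)) ` {..next_idx m (b z - u)})) \<longlonglongrightarrow> peak X u (b z) (a z)"
    by (intro grid_peak cadlag_path u)
qed

end

context exp_clock begin

text \<open>The probability that the exponential clock survives one step of the grid.\<close>

definition survival :: "nat \<Rightarrow> real" where "survival m = exp (- r * mesh m)"

lemma survival_bounds: "0 \<le> survival m" "survival m < 1" "survival m \<le> 1"
  using r_pos by (auto simp: survival_def less_imp_le)

lemma survival_tendsto: "survival \<longlonglongrightarrow> 1"
proof -
  have "(\<lambda>m. exp (- r * mesh m)) \<longlonglongrightarrow> exp (- r * 0)"
    by (intro tendsto_intros mesh_tendsto)
  then show ?thesis by (simp add: survival_def[abs_def])
qed

lemma geometric_mass:
  assumes "\<And>n. F n \<le> B"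
  shows "ennreal (1 - survival m) * (\<Sum>n. ennreal (survival m ^ n) * F n) \<le> B"
proof -
  have "ennreal (1 - survival m) * (\<Sum>n. ennreal (survival m ^ n) * F n)
      \<le> ennreal (1 - survival m) * B + ennreal (survival m) * (\<integral>\<^sup>+t. B \<partial>exp_law r)"
    unfolding survival_def geometric_to_clock
    by (intro add_mono mult_left_mono nn_integral_mono assms) auto
  also have "\<dots> = (ennreal (1 - survival m) + ennreal (survival m)) * B"
    by (simp add: clock.emeasure_space_1[simplified] distrib_right)
  also have "\<dots> = B" using survival_bounds[of m] by (simp add: ennreal_plus[symmetric] del: ennreal_plus)
  finally show ?thesis .
qed

text \<open>Sums over a grid with geometric weights converge to integrals over the exponential clock, by
  dominated convergence in both variables.\<close>

lemma geometric_limit: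
  fixes G :: "nat \<Rightarrow> nat \<Rightarrow> 'b \<Rightarrow> ennreal"
  assumes N: "prob_space N" and G [measurable]: "\<And>m n. G m n \<in> borel_measurable N"
    and bound: "\<And>m n \<omega>. \<omega> \<in> space N \<Longrightarrow> G m n \<omega> \<le> B" and B: "B < \<infinity>"
    and lim: "\<And>t \<omega>. \<omega> \<in> space N \<Longrightarrow> (\<lambda>m. G m (next_idx m t) \<omega>) \<longlonglongrightarrow> H t \<omega>"
  shows "(\<lambda>m. ennreal (1 - survival m) * (\<Sum>n. ennreal (survival m ^ n) * (\<integral>\<^sup>+\<omega>. G m n \<omega> \<partial>N)))
    \<longlonglongrightarrow> (\<integral>\<^sup>+t. \<integral>\<^sup>+\<omega>. H t \<omega> \<partial>N \<partial>exp_law r)"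
proof -
  interpret N: prob_space N by (rule N)
  define F where "F m n = (\<integral>\<^sup>+\<omega>. G m n \<omega> \<partial>N)" for m n
  have FB: "F m n \<le> B" for m n
  proof -
    have "F m n \<le> (\<integral>\<^sup>+\<omega>. B \<partial>N)" unfolding F_def by (intro nn_integral_mono bound)
    then show ?thesis by (simp add: N.emeasure_space_1)
  qed
  have F_lim: "(\<lambda>m. F m (next_idx m t)) \<longlonglongrightarrow> (\<integral>\<^sup>+\<omega>. H t \<omega> \<partial>N)" for t
    unfolding F_def
  proof (rule nn_integral_dominated_convergence[where w = "\<lambda>_. B"])
    show "H t \<in> borel_measurable N"
      by (rule borel_measurable_LIMSEQ_order[OF lim]) auto
    show "(\<integral>\<^sup>+\<omega>. B \<partial>N) < \<infinity>" using B by (simp add: N.emeasure_space_1)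
  qed (use bound lim in auto)
  have F_meas: "(\<lambda>t. F m (next_idx m t)) \<in> borel_measurable (exp_law r)" for m
    by (rule measurable_compose[of "next_idx m" _ "count_space UNIV"]) auto
  have I: "(\<lambda>m. \<integral>\<^sup>+t. F m (next_idx m t) \<partial>exp_law r) \<longlonglongrightarrow> (\<integral>\<^sup>+t. \<integral>\<^sup>+\<omega>. H t \<omega> \<partial>N \<partial>exp_law r)"
  proof (rule nn_integral_dominated_convergence[where w = "\<lambda>_. B"])
    show "(\<lambda>t. \<integral>\<^sup>+\<omega>. H t \<omega> \<partial>N) \<in> borel_measurable (exp_law r)"
      by (rule borel_measurable_LIMSEQ_order[OF F_lim F_meas])
    show "(\<integral>\<^sup>+t. B \<partial>exp_law r) < \<infinity>" using B by (simp add: clock.emeasure_space_1[simplified])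
  qed (use FB F_lim F_meas in auto)
  have d0: "(\<lambda>m. ennreal (1 - survival m)) \<longlonglongrightarrow> ennreal (1 - 1)"
    by (intro tendsto_ennrealI tendsto_intros survival_tendsto)
  have "(\<lambda>m. ennreal (1 - survival m) * B) \<longlonglongrightarrow> ennreal (1 - 1) * B"
    using B by (intro tendsto_mult_ennreal d0 tendsto_const) auto
  then have upper: "(\<lambda>m. ennreal (1 - survival m) * B) \<longlonglongrightarrow> 0" by simp
  have first: "(\<lambda>m. ennreal (1 - survival m) * F m 0) \<longlonglongrightarrow> 0"
    by (rule tendsto_sandwich[OF _ _ tendsto_const upper])
       (auto intro!: always_eventually mult_left_mono FB)
  have "(\<integral>\<^sup>+t. \<integral>\<^sup>+\<omega>. H t \<omega> \<partial>N \<partial>exp_law r) \<le> (\<integral>\<^sup>+t. B \<partial>exp_law r)"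
    by (intro nn_integral_mono LIMSEQ_le_const2[OF F_lim]) (use FB in auto)
  then have fin: "(\<integral>\<^sup>+t. \<integral>\<^sup>+\<omega>. H t \<omega> \<partial>N \<partial>exp_law r) < \<infinity>"
    using B by (simp add: clock.emeasure_space_1[simplified] le_less_trans)
  have "(\<lambda>m. ennreal (survival m) * (\<integral>\<^sup>+t. F m (next_idx m t) \<partial>exp_law r))
      \<longlonglongrightarrow> ennreal 1 * (\<integral>\<^sup>+t. \<integral>\<^sup>+\<omega>. H t \<omega> \<partial>N \<partial>exp_law r)"
    using fin by (intro tendsto_mult_ennreal I tendsto_ennrealI survival_tendsto) auto
  from tendsto_add[OF first this] show ?thesis
    unfolding F_def[symmetric] geometric_to_clock[folded survival_def] by simp
qed

end

text \<open>The process to be stopped and the process whose running infimum enters \<open>\<kappa>\<close> may live on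
  different spaces; they only have to share the laws of their increments over grid steps.\<close>

locale levy_pair = X: levy_from M X x + X': levy_from M' X' 0 + exp_clock r
  for M :: "'a measure" and X x and M' :: "'b measure" and X' r +
  assumes same_law: "step_law M X m = step_law M' X' m"
begin

text \<open>The mean of \<open>f (y + J)\<close>, where \<open>J\<close> is the running infimum at the exponential time. With \<open>g\<close> in
  the place of \<open>f\<close> this would be \<open>r * \<kappa> y\<close>.\<close>

definition low_mean :: "(real \<Rightarrow> ennreal) \<Rightarrow> real \<Rightarrow> ennreal" where
  "low_mean f y = (\<integral>\<^sup>+t. \<integral>\<^sup>+\<omega>. f (y + low X' t \<omega>) \<partial>M' \<partial>exp_law r)"

text \<open>The grid version of \<open>low_mean\<close>, in the form in which it appears in \<open>wiener_hopf\<close>.\<close>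

definition grid_low_mean :: "nat \<Rightarrow> (real \<Rightarrow> ennreal) \<Rightarrow> real \<Rightarrow> ennreal" where
  "grid_low_mean m f y = ennreal (1 - survival m) *
    (\<Sum>j. ennreal (survival m ^ j) * (\<integral>\<^sup>+e. f (y + wmin e j) \<partial>X.walk.S m))"

lemma measurable_grid_low_mean [measurable]:
  assumes [measurable]: "f \<in> borel_measurable borel"
  shows "grid_low_mean m f \<in> borel_measurable borel"
proof -
  interpret S: sigma_finite_measure "X.walk.S m" by (rule X.walk.sigma_finite_S)
  show ?thesis unfolding grid_low_mean_def by measurable
qed

lemma grid_low_mean_le:
  assumes "\<And>y. f y \<le> B"
  shows "grid_low_mean m f y \<le> B"
  unfolding grid_low_mean_def
proof (rule geometric_mass)
  have S1: "emeasure (X.walk.S m) (space (X.walk.S m)) = 1"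
    by (intro prob_space.emeasure_space_1 prob_space_PiM X.prob_step_law)
  fix j
  have "(\<integral>\<^sup>+e. f (y + wmin e j) \<partial>X.walk.S m) \<le> (\<integral>\<^sup>+e. B \<partial>X.walk.S m)"
    by (intro nn_integral_mono assms)
  then show "(\<integral>\<^sup>+e. f (y + wmin e j) \<partial>X.walk.S m) \<le> B" by (simp only: nn_integral_const S1 mult_1_right)
qed

lemma grid_low_mean_path:
  assumes [measurable]: "f \<in> borel_measurable borel"
  shows "(\<integral>\<^sup>+e. f (y + wmin e j) \<partial>X.walk.S m) =
    (\<integral>\<^sup>+\<omega>. f (y + Min ((\<lambda>i. X' (real i * mesh m) \<omega>) ` {..j})) \<partial>M')"
proof -
  have "(\<integral>\<^sup>+e. f (y + wmin e j) \<partial>X.walk.S m) =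
      (\<integral>\<^sup>+e. f (y + wmin e j) \<partial>distr M' (PiM UNIV (\<lambda>_. borel)) (grid_incr X' 0 m))"
    unfolding X'.distr_grid_incr[OF order_refl] same_law ..
  also have "\<dots> = (\<integral>\<^sup>+\<omega>. f (y + wmin (grid_incr X' 0 m \<omega>) j) \<partial>M')"
    by (rule nn_integral_distr[OF X'.measurable_grid_incr_PiM]) auto
  also have "\<dots> = (\<integral>\<^sup>+\<omega>. f (y + Min ((\<lambda>i. X' (real i * mesh m) \<omega>) ` {..j})) \<partial>M')"
  proof (rule nn_integral_cong_AE)
    show "AE \<omega> in M'. f (y + wmin (grid_incr X' 0 m \<omega>) j) = f (y + Min ((\<lambda>i. X' (real i * mesh m) \<omega>) ` {..j}))"
      using X'.start
    proof eventually_elim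
      case (elim \<omega>)
      then show ?case using wmin_grid_incr[of X' 0 \<omega> m j] by simp
    qed
  qed
  finally show ?thesis .
qed

text \<open>The argument moves with the mesh because in the application it is a grid maximum, which itself
  converges only in the limit.\<close>

lemma grid_low_mean_tendsto:
  assumes f: "continuous_on UNIV f" and B: "\<And>y. f y \<le> B" "B < \<infinity>" and y: "y \<longlonglongrightarrow> l"
  shows "(\<lambda>m. grid_low_mean m f (y m)) \<longlonglongrightarrow> low_mean f l"
proof -
  have [measurable]: "f \<in> borel_measurable borel" using f by (rule borel_measurable_continuous_onI)
  show ?thesis
    unfolding grid_low_mean_def grid_low_mean_path[OF \<open>f \<in> borel_measurable borel\<close>] low_mean_def
  proof (rule geometric_limit[OF X'.prob_space_axioms _ _ B(2)])
    show "(\<lambda>\<omega>. f (y m + Min ((\<lambda>i. X' (real i * mesh m) \<omega>) ` {..n}))) \<in> borel_measurable M'" for m n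
      by measurable
    fix t \<omega> assume "\<omega> \<in> space M'"
    then show "(\<lambda>m. f (y m + Min ((\<lambda>i. X' (real i * mesh m) \<omega>) ` {..next_idx m t}))) \<longlonglongrightarrow> f (l + low X' t \<omega>)"
      by (intro continuous_ennreal_compose[OF f] tendsto_add y grid_low X'.cadlag_path)
  qed (use B in auto)
qed

lemma measurable_low_mean_bounded:
  assumes f: "continuous_on UNIV f" and B: "\<And>y. f y \<le> B" "B < \<infinity>"
  shows "low_mean f \<in> borel_measurable borel"
proof -
  have [measurable]: "f \<in> borel_measurable borel" using f by (rule borel_measurable_continuous_onI)
  show ?thesis
    by (rule borel_measurable_LIMSEQ_order[OF grid_low_mean_tendsto[OF f B tendsto_const]]) measurable
qed

lemma low_mean_le:
  assumes B: "\<And>y. f y \<le> B"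
  shows "low_mean f y \<le> B"
proof -
  have "low_mean f y \<le> (\<integral>\<^sup>+t. \<integral>\<^sup>+\<omega>. B \<partial>M' \<partial>exp_law r)"
    unfolding low_mean_def by (intro nn_integral_mono B)
  then show ?thesis by (simp add: X'.emeasure_space_1 clock.emeasure_space_1[simplified])
qed

lemma low_mean_isCont_bounded:
  assumes f: "continuous_on UNIV f" and B: "\<And>y. f y \<le> B" "B < \<infinity>" and y: "y \<longlonglongrightarrow> l"
  shows "(\<lambda>n. low_mean f (y n)) \<longlonglongrightarrow> low_mean f l"
  unfolding low_mean_def
proof (rule nn_integral_dominated_convergence[where w = "\<lambda>_. B"])
  have [measurable]: "f \<in> borel_measurable borel" using f by (rule borel_measurable_continuous_onI)
  show "(\<lambda>t. \<integral>\<^sup>+\<omega>. f (y n + low X' t \<omega>) \<partial>M') \<in> borel_measurable (exp_law r)" for n by measurable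
  show "(\<lambda>t. \<integral>\<^sup>+\<omega>. f (l + low X' t \<omega>) \<partial>M') \<in> borel_measurable (exp_law r)" by measurable
  have "(\<integral>\<^sup>+\<omega>. f (y n + low X' t \<omega>) \<partial>M') \<le> (\<integral>\<^sup>+\<omega>. B \<partial>M')" for n t
    by (intro nn_integral_mono B)
  then show "AE t in exp_law r. (\<integral>\<^sup>+\<omega>. f (y n + low X' t \<omega>) \<partial>M') \<le> B" for n
    by (simp add: X'.emeasure_space_1)
  show "(\<integral>\<^sup>+t. B \<partial>exp_law r) < \<infinity>" using B by (simp add: clock.emeasure_space_1[simplified])
  have "(\<lambda>n. \<integral>\<^sup>+\<omega>. f (y n + low X' t \<omega>) \<partial>M') \<longlonglongrightarrow> (\<integral>\<^sup>+\<omega>. f (l + low X' t \<omega>) \<partial>M')" for t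
  proof (rule nn_integral_dominated_convergence[where w = "\<lambda>_. B"])
    show "(\<integral>\<^sup>+\<omega>. B \<partial>M') < \<infinity>" using B by (simp add: X'.emeasure_space_1)
    show "AE \<omega> in M'. (\<lambda>n. f (y n + low X' t \<omega>)) \<longlonglongrightarrow> f (l + low X' t \<omega>)"
      by (intro AE_I2 continuous_ennreal_compose[OF f] tendsto_intros y)
  qed (use B in \<open>auto\<close>)
  then show "AE t in exp_law r. (\<lambda>n. \<integral>\<^sup>+\<omega>. f (y n + low X' t \<omega>) \<partial>M') \<longlonglongrightarrow> (\<integral>\<^sup>+\<omega>. f (l + low X' t \<omega>) \<partial>M')"
    by simp
qed auto

text \<open>Both sides of \<open>stopped_wiener_hopf\<close> converge as the grid is refined.\<close>

theorem wiener_hopf_from: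
  assumes u: "0 \<le> u" and A: "A \<in> sets (raw_filtration M X u)"
    and f: "continuous_on UNIV f" and B: "\<And>y. f y \<le> B" "B < \<infinity>"
  shows "(\<integral>\<^sup>+t. \<integral>\<^sup>+\<omega>. indicator A \<omega> * f (X (u + max 0 t) \<omega>) \<partial>M \<partial>exp_law r) =
    (\<integral>\<^sup>+t. \<integral>\<^sup>+\<omega>. indicator A \<omega> * low_mean f (peak X u (u + t) \<omega>) \<partial>M \<partial>exp_law r)"
proof -
  have fm [measurable]: "f \<in> borel_measurable borel" using f by (rule borel_measurable_continuous_onI)
  have [measurable]: "A \<in> sets M" by (rule subsetD[OF X.sets_raw_filtration_subset A])
  have Xm [measurable]: "X (u + real n * mesh m) \<in> borel_measurable M" for n m
    using u by (intro X.measurable_X) simp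
  have ind: "indicator A \<omega> * b \<le> B" if "b \<le> B" for \<omega> and b :: ennreal
    using that by (auto simp: indicator_def)
  have indlim: "(\<lambda>m. indicator A \<omega> * b m) \<longlonglongrightarrow> (indicator A \<omega> * c :: ennreal)" if "b \<longlonglongrightarrow> c" for \<omega> b c
    using that by (auto simp: indicator_def)
  have left: "(\<lambda>m. ennreal (1 - survival m) * (\<Sum>n. ennreal (survival m ^ n) *
      (\<integral>\<^sup>+\<omega>. indicator A \<omega> * f (X (u + real n * mesh m) \<omega>) \<partial>M)))
    \<longlonglongrightarrow> (\<integral>\<^sup>+t. \<integral>\<^sup>+\<omega>. indicator A \<omega> * f (X (u + max 0 t) \<omega>) \<partial>M \<partial>exp_law r)"
    by (rule geometric_limit[OF X.prob_space_axioms _ _ B(2)])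
       (auto intro!: ind B indlim continuous_ennreal_compose[OF f] grid_path X.cadlag_path u)
  have right: "(\<lambda>m. ennreal (1 - survival m) * (\<Sum>n. ennreal (survival m ^ n) *
      (\<integral>\<^sup>+\<omega>. indicator A \<omega> * grid_low_mean m f (Max ((\<lambda>i. X (u + real i * mesh m) \<omega>) ` {..n})) \<partial>M)))
    \<longlonglongrightarrow> (\<integral>\<^sup>+t. \<integral>\<^sup>+\<omega>. indicator A \<omega> * low_mean f (peak X u (u + t) \<omega>) \<partial>M \<partial>exp_law r)"
  proof (rule geometric_limit[OF X.prob_space_axioms _ _ B(2)])
    fix t \<omega> assume "\<omega> \<in> space M"
    from grid_peak[where X = X and \<omega> = \<omega>, OF X.cadlag_path[OF this] u, of "u + t"]
    show "(\<lambda>m. indicator A \<omega> * grid_low_mean m f (Max ((\<lambda>i. X (u + real i * mesh m) \<omega>) ` {..next_idx m t})))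
      \<longlonglongrightarrow> indicator A \<omega> * low_mean f (peak X u (u + t) \<omega>)"
      by (intro indlim grid_low_mean_tendsto[OF f B]) simp
  qed (use B in \<open>auto intro!: ind grid_low_mean_le\<close>)
  have "(\<Sum>n. ennreal (survival m ^ n) * (\<integral>\<^sup>+\<omega>. indicator A \<omega> * f (X (u + real n * mesh m) \<omega>) \<partial>M)) =
      (\<Sum>n. ennreal (survival m ^ n) * (\<integral>\<^sup>+\<omega>. indicator A \<omega> * grid_low_mean m f (Max ((\<lambda>i. X (u + real i * mesh m) \<omega>) ` {..n})) \<partial>M))" for m
    unfolding grid_low_mean_def by (rule X.stopped_wiener_hopf[OF u A fm survival_bounds(1,2)])
  with left right show ?thesis by (simp add: LIMSEQ_unique)
qed

end

section \<open>Factorization after a stopping time\<close>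

lemma peak_tendsto_right:
  assumes f: "cadlag (\<lambda>t. X t \<omega>)" and a: "0 \<le> a" "a < t"
    and c: "c \<longlonglongrightarrow> a" "\<And>n. a < c n" "(\<lambda>n. X (c n) \<omega>) \<longlonglongrightarrow> X a \<omega>"
  shows "(\<lambda>n. peak X (c n) t \<omega>) \<longlonglongrightarrow> peak X a t \<omega>"
proof (rule order_tendstoI)
  have ct: "\<forall>\<^sub>F n in sequentially. c n < t" using order_tendstoD(2)[OF c(1) a(2)] .
  have bdd: "bdd_above ((\<lambda>s. X s \<omega>) ` {b..t})" if "0 \<le> b" for b
    by (rule cadlag_bdd(1)[OF f that])
  fix y
  { assume "y < peak X a t \<omega>"
    then obtain s where s: "s \<in> {a..t}" "y < X s \<omega>"
      using less_cSUP_iff[OF _ bdd[OF a(1)], of y] a by (auto simp: peak_def max_def)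
    have "\<forall>\<^sub>F n in sequentially. \<exists>s'\<in>{c n..t}. y < X s' \<omega>"
    proof (cases "s = a")
      case True
      with c(3) s have "\<forall>\<^sub>F n in sequentially. y < X (c n) \<omega>" by (auto intro: order_tendstoD)
      with ct show ?thesis by eventually_elim (auto intro!: bexI)
    next
      case False
      then have "\<forall>\<^sub>F n in sequentially. c n < s" using s by (intro order_tendstoD(2)[OF c(1)]) auto
      then show ?thesis by eventually_elim (use s in \<open>auto intro!: bexI[of _ s]\<close>)
    qed
    with ct show "\<forall>\<^sub>F n in sequentially. y < peak X (c n) t \<omega>"
    proof eventually_elim
      case (elim n)
      then show ?case
        using less_cSUP_iff[OF _ bdd[of "c n"], of y] c(2)[of n] a by (auto simp: peak_def max_def)
    qed }
  { assume y: "peak X a t \<omega> < y"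
    show "\<forall>\<^sub>F n in sequentially. peak X (c n) t \<omega> < y"
      using ct
    proof eventually_elim
      case (elim n)
      have "peak X (c n) t \<omega> \<le> peak X a t \<omega>"
        unfolding peak_def using elim c(2)[of n] a by (intro cSUP_subset_mono) (auto simp: max_def bdd)
      then show ?case using y by simp
    qed }
qed

context levy_from begin

lemma null_set_completion_subset: "A \<in> null_sets (completion M) \<Longrightarrow> A \<subseteq> space M"
  by (metis null_setsD2 sets.sets_into_space space_completion)

lemma sets_nat_filtration:
  "sets (nat_filtration M X t) = sigma_sets (space M)
     ({X s -` A \<inter> space M | s A. 0 \<le> s \<and> ennreal s \<le> t \<and> A \<in> sets borel} \<union> null_sets (completion M))"
  unfolding nat_filtration_def
  by (rule sets_measure_of) (auto dest: null_set_completion_subset)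

lemma space_nat_filtration [simp]: "space (nat_filtration M X t) = space M"
  unfolding nat_filtration_def
  by (rule space_measure_of) (auto dest: null_set_completion_subset)

lemma filtration_nat: "filtration (space M) (nat_filtration M X)"
proof
  fix s t :: ennreal assume "s \<le> t"
  then show "sets (nat_filtration M X s) \<subseteq> sets (nat_filtration M X t)"
    unfolding sets_nat_filtration by (intro sigma_sets_mono') (auto intro: order_trans)
qed simp

lemma nat_filtration_raw:
  assumes u: "0 \<le> u" and A: "A \<in> sets (nat_filtration M X (ennreal u))"
  shows "A \<in> sets (completion M) \<and>
    (\<exists>A0\<in>sets (raw_filtration M X u). AE \<omega> in completion M. \<omega> \<in> A \<longleftrightarrow> \<omega> \<in> A0)"
  using A unfolding sets_nat_filtration
proof (induction rule: sigma_sets.induct)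
  case (Basic a)
  then show ?case
  proof
    assume "a \<in> {X s -` A \<inter> space M | s A. 0 \<le> s \<and> ennreal s \<le> ennreal u \<and> A \<in> sets borel}"
    then obtain s A where s: "a = X s -` A \<inter> space M" "0 \<le> s" "s \<le> u" "A \<in> sets borel"
      using u by auto
    then have "a \<in> sets (raw_filtration M X u)"
      using measurable_sets[OF measurable_X_raw[of s u], of A] by simp
    moreover from this have "a \<in> sets M" using sets_raw_filtration_subset by blast
    ultimately show ?thesis by (auto intro!: bexI[of _ a])
  next
    assume a: "a \<in> null_sets (completion M)"
    then have "AE \<omega> in completion M. \<omega> \<in> a \<longleftrightarrow> \<omega> \<in> {}"
      using AE_not_in[OF a] by simp
    then show ?thesis using a by (auto intro!: bexI[of _ "{}"])
  qed
next
  case Empty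
  then show ?case by (auto intro!: bexI[of _ "{}"])
next
  case (Compl a)
  then obtain A0 where A0: "A0 \<in> sets (raw_filtration M X u)" "AE \<omega> in completion M. \<omega> \<in> a \<longleftrightarrow> \<omega> \<in> A0"
    by auto
  have "space M - A0 \<in> sets (raw_filtration M X u)"
    using sets.compl_sets[OF A0(1)] by simp
  moreover have "AE \<omega> in completion M. \<omega> \<in> space M - a \<longleftrightarrow> \<omega> \<in> space M - A0"
    using A0(2) by eventually_elim auto
  moreover have "space M - a \<in> sets (completion M)"
    using sets.compl_sets[of a "completion M"] Compl by simp
  ultimately show ?case by blast
next
  case (Union a)
  then obtain A0 where A0: "\<And>i :: nat. A0 i \<in> sets (raw_filtration M X u)"
    "\<And>i. AE \<omega> in completion M. \<omega> \<in> a i \<longleftrightarrow> \<omega> \<in> A0 i"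
    by metis
  have "AE \<omega> in completion M. \<forall>i. \<omega> \<in> a i \<longleftrightarrow> \<omega> \<in> A0 i"
    using A0(2) by (simp add: AE_all_countable)
  then have "AE \<omega> in completion M. \<omega> \<in> (\<Union>i. a i) \<longleftrightarrow> \<omega> \<in> (\<Union>i. A0 i)"
    by eventually_elim auto
  moreover have "(\<Union>i. A0 i) \<in> sets (raw_filtration M X u)" using A0(1) by auto
  moreover have "(\<Union>i. a i) \<in> sets (completion M)" using Union by auto
  ultimately show ?case by blast
qed

lemma ident_completion [measurable]: "(\<lambda>\<omega>. \<omega>) \<in> completion M \<rightarrow>\<^sub>M M"
  by (rule measurable_completion) simp

lemma fst_completion [measurable]: "fst \<in> completion M \<Otimes>\<^sub>M N \<rightarrow>\<^sub>M M"
  by (rule measurable_compose[OF measurable_fst ident_completion])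

text \<open>On this event the approximation of \<open>\<tau>\<close> from the right by the grid is \<open>Suc k * mesh n\<close>, a
  time at which the event is already observable.\<close>

definition cell :: "('a \<Rightarrow> ennreal) \<Rightarrow> nat \<Rightarrow> nat \<Rightarrow> 'a set" where
  "cell \<tau> n k = {\<omega>\<in>space M. ennreal (real k * mesh n) \<le> \<tau> \<omega> \<and> \<tau> \<omega> < ennreal (real (Suc k) * mesh n)}"

lemma cell_sets:
  assumes "stopping_time (nat_filtration M X) \<tau>"
  shows "cell \<tau> n k \<in> sets (nat_filtration M X (ennreal (real (Suc k) * mesh n)))"
proof -
  let ?F = "nat_filtration M X (ennreal (real (Suc k) * mesh n))"
  interpret F: filtration "space M" "nat_filtration M X" by (rule filtration_nat)
  have a: "Measurable.pred ?F (\<lambda>\<omega>. \<tau> \<omega> < ennreal (real (Suc k) * mesh n))"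
    by (rule F.stopping_time_less_const[OF assms])
  have "Measurable.pred (nat_filtration M X (ennreal (real k * mesh n))) (\<lambda>\<omega>. \<tau> \<omega> < ennreal (real k * mesh n))"
    by (rule F.stopping_time_less_const[OF assms])
  moreover have "sets (nat_filtration M X (ennreal (real k * mesh n))) \<subseteq> sets ?F"
    by (intro F.sets_F_mono ennreal_leI mult_right_mono) auto
  ultimately have b: "Measurable.pred ?F (\<lambda>\<omega>. \<tau> \<omega> < ennreal (real k * mesh n))"
    by (auto simp: pred_def)
  have "Measurable.pred ?F (\<lambda>\<omega>. \<not> \<tau> \<omega> < ennreal (real k * mesh n) \<and> \<tau> \<omega> < ennreal (real (Suc k) * mesh n))"
    using a b by (intro pred_intros_logic)
  then show ?thesis by (simp add: cell_def pred_def not_less del: of_nat_Suc)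
qed

lemma stopping_time_measurable:
  assumes "stopping_time (nat_filtration M X) \<tau>"
  shows "\<tau> \<in> borel_measurable (completion M)"
proof (rule measurable_stopping_time[OF assms])
  fix t :: ennreal
  show "sets (nat_filtration M X t) \<subseteq> sets (completion M)"
    unfolding sets_nat_filtration
  proof (rule sets.sigma_sets_subset[of _ "completion M", simplified space_completion], safe)
    fix s :: real and A :: "real set" assume "0 \<le> s" "A \<in> sets borel"
    then show "X s -` A \<inter> space M \<in> sets (completion M)"
      by (intro sets_completionI_sets measurable_sets[OF measurable_X])
  next
    fix A assume "A \<in> null_sets (completion M)"
    then show "A \<in> sets (completion M)" by (rule null_setsD2)
  qed
qed simp

lemma cell_iff:
  assumes "\<omega> \<in> space M" "\<tau> \<omega> < \<infinity>"
  shows "\<omega> \<in> cell \<tau> n k \<longleftrightarrow> next_idx n (enn2real (\<tau> \<omega>)) = Suc k"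
proof -
  obtain a where a: "\<tau> \<omega> = ennreal a" "0 \<le> a" using assms(2) by (cases "\<tau> \<omega>") auto
  show ?thesis
    using assms(1) a by (auto simp: cell_def next_idx_eq_iff ennreal_less_iff simp del: of_nat_Suc)
qed

lemma cell_sum:
  fixes w :: "nat \<Rightarrow> ennreal"
  assumes "\<omega> \<in> space M"
  shows "(\<Sum>k. indicator (cell \<tau> n k) \<omega> * w (Suc k)) =
    (if \<tau> \<omega> < \<infinity> then w (next_idx n (enn2real (\<tau> \<omega>))) else 0)"
proof (cases "\<tau> \<omega> < \<infinity>")
  case True
  obtain k where k: "next_idx n (enn2real (\<tau> \<omega>)) = Suc k" by (auto simp: next_idx_def)
  have "(\<Sum>j. indicator (cell \<tau> n j) \<omega> * w (Suc j)) = (\<Sum>j\<in>{k}. indicator (cell \<tau> n j) \<omega> * w (Suc j))"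
    by (rule suminf_finite) (auto simp: cell_iff[where \<tau> = \<tau>, OF assms True] k indicator_def)
  then show ?thesis using True k by (simp add: cell_iff[where \<tau> = \<tau>, OF assms True] indicator_def)
next
  case False
  then have "\<omega> \<notin> cell \<tau> n k" for k by (auto simp: cell_def less_top[symmetric] dest: order.strict_trans1)
  then show ?thesis using False by simp
qed

end

context levy_pair begin

abbreviation "Mc \<equiv> completion M"
abbreviation "MT \<equiv> completion M \<Otimes>\<^sub>M exp_law r"

sublocale Mc: prob_space Mc
  by (rule prob_spaceI) (use X.emeasure_space_1 in simp)

sublocale MT: pair_prob_space Mc "exp_law r" ..

text \<open>On \<open>u < t\<close> the exponential clock restarts at \<open>u\<close>; the factor \<open>exp (- r * u)\<close> will be common to
  both sides of the factorization.\<close>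

lemma after_time:
  assumes u: "0 \<le> u" and A: "A \<in> sets Mc" "A0 \<in> sets M" "AE \<omega> in Mc. \<omega> \<in> A \<longleftrightarrow> \<omega> \<in> A0"
    and W: "(\<lambda>z. W (snd z) (fst z)) \<in> borel_measurable (M \<Otimes>\<^sub>M borel)"
  shows "(\<integral>\<^sup>+z. indicator A (fst z) * (if u < snd z then W (snd z) (fst z) else 0) \<partial>MT) =
    ennreal (exp (- r * u)) * (\<integral>\<^sup>+t. \<integral>\<^sup>+\<omega>. indicator A0 \<omega> * W (u + t) \<omega> \<partial>M \<partial>exp_law r)"
proof -
  note [measurable] = A(1,2)
  have "(\<lambda>z. (fst z, snd z)) \<in> MT \<rightarrow>\<^sub>M M \<Otimes>\<^sub>M borel" by measurable
  from measurable_compose[OF this W]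
  have [measurable]: "(\<lambda>z. W (snd z) (fst z)) \<in> borel_measurable MT" by simp
  have "(\<lambda>z. (snd z, fst z)) \<in> borel \<Otimes>\<^sub>M M \<rightarrow>\<^sub>M M \<Otimes>\<^sub>M borel" by measurable
  from measurable_compose[OF this W]
  have [measurable]: "(\<lambda>(t, \<omega>). W t \<omega>) \<in> borel_measurable (borel \<Otimes>\<^sub>M M)"
    by (simp add: case_prod_beta')
  have "(\<integral>\<^sup>+z. indicator A (fst z) * (if u < snd z then W (snd z) (fst z) else 0) \<partial>MT) =
      (\<integral>\<^sup>+t. \<integral>\<^sup>+\<omega>. indicator A \<omega> * (if u < t then W t \<omega> else 0) \<partial>Mc \<partial>exp_law r)"
    by (subst MT.nn_integral_snd[symmetric]) (auto simp: case_prod_beta' cong: if_cong)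
  also have "\<dots> = (\<integral>\<^sup>+t. (if u < t then \<integral>\<^sup>+\<omega>. indicator A0 \<omega> * W t \<omega> \<partial>M else 0) \<partial>exp_law r)"
  proof (rule nn_integral_cong)
    fix t
    have "(\<integral>\<^sup>+\<omega>. indicator A \<omega> * W t \<omega> \<partial>Mc) = (\<integral>\<^sup>+\<omega>. indicator A0 \<omega> * W t \<omega> \<partial>Mc)"
      using A(3) by (intro nn_integral_cong_AE) (auto elim!: eventually_mono simp: indicator_def)
    then show "(\<integral>\<^sup>+\<omega>. indicator A \<omega> * (if u < t then W t \<omega> else 0) \<partial>Mc) =
        (if u < t then \<integral>\<^sup>+\<omega>. indicator A0 \<omega> * W t \<omega> \<partial>M else 0)"
      by (simp add: nn_integral_completion)
  qed
  also have "\<dots> = ennreal (exp (- r * u)) * (\<integral>\<^sup>+t. \<integral>\<^sup>+\<omega>. indicator A0 \<omega> * W (u + t) \<omega> \<partial>M \<partial>exp_law r)"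
    by (rule memoryless[OF _ u]) measurable
  finally show ?thesis .
qed

lemma wiener_hopf_after:
  assumes u: "0 \<le> u" and A: "A \<in> sets (nat_filtration M X (ennreal u))"
    and f: "continuous_on UNIV f" and B: "\<And>y. f y \<le> B" "B < \<infinity>"
  shows "(\<integral>\<^sup>+z. indicator A (fst z) * (if u < snd z then f (X (max 0 (snd z)) (fst z)) else 0) \<partial>MT) =
    (\<integral>\<^sup>+z. indicator A (fst z) * (if u < snd z then low_mean f (peak X u (snd z) (fst z)) else 0) \<partial>MT)"
proof -
  have [measurable]: "f \<in> borel_measurable borel" using f by (rule borel_measurable_continuous_onI)
  note [measurable] = measurable_low_mean_bounded[OF f B]
  obtain A0 where A0: "A0 \<in> sets (raw_filtration M X u)" "AE \<omega> in Mc. \<omega> \<in> A \<longleftrightarrow> \<omega> \<in> A0" and Ac: "A \<in> sets Mc"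
    using X.nat_filtration_raw[OF u A] by blast
  have A0M: "A0 \<in> sets M" by (rule subsetD[OF X.sets_raw_filtration_subset A0(1)])
  have "(\<integral>\<^sup>+t. \<integral>\<^sup>+\<omega>. indicator A0 \<omega> * f (X (max 0 (u + t)) \<omega>) \<partial>M \<partial>exp_law r) =
      (\<integral>\<^sup>+t. \<integral>\<^sup>+\<omega>. indicator A0 \<omega> * f (X (u + max 0 t) \<omega>) \<partial>M \<partial>exp_law r)"
    using AE_clock_pos by (intro nn_integral_cong_AE) (auto elim!: eventually_mono simp: u max_def)
  also have "\<dots> = (\<integral>\<^sup>+t. \<integral>\<^sup>+\<omega>. indicator A0 \<omega> * low_mean f (peak X u (u + t) \<omega>) \<partial>M \<partial>exp_law r)"
    by (rule wiener_hopf_from[OF u A0(1) f B])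
  finally have "(\<integral>\<^sup>+t. \<integral>\<^sup>+\<omega>. indicator A0 \<omega> * f (X (max 0 (u + t)) \<omega>) \<partial>M \<partial>exp_law r) =
      (\<integral>\<^sup>+t. \<integral>\<^sup>+\<omega>. indicator A0 \<omega> * low_mean f (peak X u (u + t) \<omega>) \<partial>M \<partial>exp_law r)" .
  moreover have "(\<lambda>z. f (X (max 0 (snd z)) (fst z))) \<in> borel_measurable (M \<Otimes>\<^sub>M borel)"
    by measurable
  moreover have "(\<lambda>z. low_mean f (peak X u (snd z) (fst z))) \<in> borel_measurable (M \<Otimes>\<^sub>M borel)"
    using u by measurable
  ultimately show ?thesis
    using after_time[OF u Ac A0M A0(2), of "\<lambda>t \<omega>. f (X (max 0 t) \<omega>)"]
      after_time[OF u Ac A0M A0(2), of "\<lambda>t \<omega>. low_mean f (peak X u t \<omega>)"] by simp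
qed

definition stopped_low_mean :: "('a \<Rightarrow> ennreal) \<Rightarrow> (real \<Rightarrow> ennreal) \<Rightarrow> 'a \<times> real \<Rightarrow> ennreal" where
  "stopped_low_mean \<tau> f z = (if \<tau> (fst z) < ennreal (snd z)
     then low_mean f (peak X (enn2real (\<tau> (fst z))) (snd z) (fst z)) else 0)"

text \<open>For a stopping time with values in a grid the identity is the sum of \<open>wiener_hopf_after\<close> over
  its values. Grid approximations decrease strictly to \<open>\<tau>\<close>, and the strict inequalities \<open>u < t\<close> then
  make both integrands converge at every point, including \<open>t = \<tau>\<close>.\<close>

lemma wiener_hopf_stopped_bounded:
  assumes \<tau>: "stopping_time (nat_filtration M X) \<tau>"
    and f: "continuous_on UNIV f" and B: "\<And>y. f y \<le> B" "B < \<infinity>"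
  shows "stopped_low_mean \<tau> f \<in> borel_measurable MT"
    and "(\<integral>\<^sup>+z. (if \<tau> (fst z) < ennreal (snd z) then f (X (max 0 (snd z)) (fst z)) else 0) \<partial>MT) =
      (\<integral>\<^sup>+z. stopped_low_mean \<tau> f z \<partial>MT)"
proof -
  have [measurable]: "f \<in> borel_measurable borel" using f by (rule borel_measurable_continuous_onI)
  note [measurable] = measurable_low_mean_bounded[OF f B] X.stopping_time_measurable[OF \<tau>]
  define u where "u n k = real k * mesh n" for n k
  have u [simp]: "0 \<le> u n k" for n k by (simp add: u_def)
  (* The integrands for the approximation of tau from the right by the grid of mesh n. *)
  define L where "L n z = (\<Sum>k. indicator (X.cell \<tau> n k) (fst z) *
     (if u n (Suc k) < snd z then f (X (max 0 (snd z)) (fst z)) else 0))" for n and z :: "'a \<times> real"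
  define R where "R n z = (\<Sum>k. indicator (X.cell \<tau> n k) (fst z) *
     (if u n (Suc k) < snd z then low_mean f (peak X (u n (Suc k)) (snd z) (fst z)) else 0))" for n and z :: "'a \<times> real"
  have cell [measurable]: "X.cell \<tau> n k \<in> sets Mc" for n k
    using X.nat_filtration_raw[OF _ X.cell_sets[OF \<tau>]] by simp
  have pk [measurable]: "(\<lambda>z. peak X (u n k) (snd z) (fst z)) \<in> borel_measurable MT" for n k
    by (rule X.measurable_peak[OF u]) measurable
  have pt [measurable]: "(\<lambda>z. X (max 0 (snd z)) (fst z)) \<in> borel_measurable MT"
    by (rule X.measurable_path_pair) measurable
  have summands [measurable]:
    "(\<lambda>z. indicator (X.cell \<tau> n k) (fst z) * (if u n (Suc k) < snd z then f (X (max 0 (snd z)) (fst z)) else 0)) \<in> borel_measurable MT"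
    "(\<lambda>z. indicator (X.cell \<tau> n k) (fst z) * (if u n (Suc k) < snd z then low_mean f (peak X (u n (Suc k)) (snd z) (fst z)) else 0)) \<in> borel_measurable MT" for n k
    by measurable
  have [measurable]: "L n \<in> borel_measurable MT" "R n \<in> borel_measurable MT" for n
    unfolding L_def[abs_def] R_def[abs_def] by (intro borel_measurable_suminf_order summands)+
  have eq: "(\<integral>\<^sup>+z. L n z \<partial>MT) = (\<integral>\<^sup>+z. R n z \<partial>MT)" for n
  proof -
    have "(\<integral>\<^sup>+z. L n z \<partial>MT) = (\<Sum>k. \<integral>\<^sup>+z. indicator (X.cell \<tau> n k) (fst z) *
       (if u n (Suc k) < snd z then f (X (max 0 (snd z)) (fst z)) else 0) \<partial>MT)"
      unfolding L_def by (intro nn_integral_suminf summands)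
    also have "\<dots> = (\<Sum>k. \<integral>\<^sup>+z. indicator (X.cell \<tau> n k) (fst z) *
       (if u n (Suc k) < snd z then low_mean f (peak X (u n (Suc k)) (snd z) (fst z)) else 0) \<partial>MT)"
      by (intro suminf_cong wiener_hopf_after[OF u _ f B]) (simp add: u_def X.cell_sets[OF \<tau>] del: of_nat_Suc)
    also have "\<dots> = (\<integral>\<^sup>+z. R n z \<partial>MT)"
      unfolding R_def by (intro nn_integral_suminf[symmetric] summands)
    finally show ?thesis .
  qed
  have L: "L n z = (if \<tau> (fst z) < \<infinity> \<and> u n (next_idx n (enn2real (\<tau> (fst z)))) < snd z
      then f (X (max 0 (snd z)) (fst z)) else 0)" if "z \<in> space MT" for n z
    unfolding L_def using X.cell_sum[where \<omega> = "fst z" and \<tau> = \<tau> and n = n and w = "\<lambda>k. if u n k < snd z then f (X (max 0 (snd z)) (fst z)) else 0"] that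
    by (auto simp: space_pair_measure)
  have R: "R n z = (if \<tau> (fst z) < \<infinity> \<and> u n (next_idx n (enn2real (\<tau> (fst z)))) < snd z
      then low_mean f (peak X (u n (next_idx n (enn2real (\<tau> (fst z))))) (snd z) (fst z)) else 0)" if "z \<in> space MT" for n z
    unfolding R_def using X.cell_sum[where \<omega> = "fst z" and \<tau> = \<tau> and n = n and w = "\<lambda>k. if u n k < snd z then low_mean f (peak X (u n k) (snd z) (fst z)) else 0"] that
    by (auto simp: space_pair_measure)
  define Lim where "Lim z = (if \<tau> (fst z) < ennreal (snd z) then f (X (max 0 (snd z)) (fst z)) else 0)" for z :: "'a \<times> real"
  have lims: "(\<lambda>n. L n z) \<longlonglongrightarrow> Lim z \<and> (\<lambda>n. R n z) \<longlonglongrightarrow> stopped_low_mean \<tau> f z" if z: "z \<in> space MT" for z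
  proof -
    obtain \<omega> t where zz: "z = (\<omega>, t)" "\<omega> \<in> space M" using z by (auto simp: space_pair_measure)
    show ?thesis
    proof (cases "\<tau> \<omega> < ennreal t")
      case False
      have no: "\<not> (\<tau> \<omega> < \<infinity> \<and> u n (next_idx n (enn2real (\<tau> \<omega>))) < t)" for n
      proof
        assume a: "\<tau> \<omega> < \<infinity> \<and> u n (next_idx n (enn2real (\<tau> \<omega>))) < t"
        then have "enn2real (\<tau> \<omega>) < t"
          using less_trans[OF next_idx_bounds(1)[of "enn2real (\<tau> \<omega>)" n], of t] by (simp add: u_def enn2real_nonneg)
        then have "ennreal (enn2real (\<tau> \<omega>)) < ennreal t" by (subst ennreal_less_iff) auto
        with a False show False by simp
      qed
      have "L n z = 0" "R n z = 0" for n
        using L[OF z, of n] R[OF z, of n] no[of n] unfolding zz fst_conv snd_conv by (simp_all only: if_False)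
      then show ?thesis using False by (simp add: zz Lim_def stopped_low_mean_def)
    next
      case True
      then have fin: "\<tau> \<omega> < \<infinity>" by (metis ennreal_less_top order.strict_trans infinity_ennreal_def)
      define a where "a = enn2real (\<tau> \<omega>)"
      have "ennreal a = \<tau> \<omega>" using fin by (simp add: a_def)
      then have a: "0 \<le> a" "a < t" using True by (auto simp: a_def ennreal_less_iff[symmetric])
      let ?c = "\<lambda>n. u n (next_idx n a)"
      have c: "?c \<longlonglongrightarrow> a" "\<And>n. a < ?c n"
        using next_time_at_right[OF a(1)] next_idx_bounds(1)[OF a(1)] unfolding u_def by (auto simp: filterlim_at)
      have Xc: "(\<lambda>n. X (?c n) \<omega>) \<longlonglongrightarrow> X a \<omega>"
        unfolding u_def by (rule cadlag_next_time[OF X.cadlag_path[OF zz(2)] a(1)])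
      have "(\<lambda>n. low_mean f (peak X (?c n) t \<omega>)) \<longlonglongrightarrow> low_mean f (peak X a t \<omega>)"
        by (intro low_mean_isCont_bounded[OF f B] peak_tendsto_right X.cadlag_path zz(2) a c Xc)
      moreover have ev: "\<forall>\<^sub>F n in sequentially. ?c n < t" by (rule order_tendstoD(2)[OF c(1) a(2)])
      have evR: "\<forall>\<^sub>F n in sequentially. R n z = low_mean f (peak X (?c n) t \<omega>)"
        using ev
      proof eventually_elim
        case (elim n)
        then show ?case using R[OF z, of n] fin unfolding zz fst_conv snd_conv a_def[symmetric] by simp
      qed
      have evL: "\<forall>\<^sub>F n in sequentially. L n z = Lim z"
        using ev
      proof eventually_elim
        case (elim n)
        then show ?case using L[OF z, of n] fin True unfolding zz Lim_def fst_conv snd_conv a_def[symmetric] by simp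
      qed
      have "stopped_low_mean \<tau> f z = low_mean f (peak X a t \<omega>)"
        using True by (simp add: zz stopped_low_mean_def a_def)
      ultimately have "(\<lambda>n. R n z) \<longlonglongrightarrow> stopped_low_mean \<tau> f z"
        using tendsto_cong[OF evR] by simp
      moreover note evL
      ultimately show ?thesis by (simp add: tendsto_eventually)
    qed
  qed
  show meas: "stopped_low_mean \<tau> f \<in> borel_measurable MT"
    by (rule borel_measurable_LIMSEQ_order[where u = R]) (use lims in auto)
  have meas': "Lim \<in> borel_measurable MT"
    by (rule borel_measurable_LIMSEQ_order[where u = L]) (use lims in auto)
  have LB: "L n z \<le> B" "R n z \<le> B" if "z \<in> space MT" for n z
    using B low_mean_le[of f B] by (auto simp: L[OF that] R[OF that])
  have fin: "(\<integral>\<^sup>+z. B \<partial>MT) < \<infinity>" using B by (simp add: MT.emeasure_space_1)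
  have "(\<lambda>n. \<integral>\<^sup>+z. L n z \<partial>MT) \<longlonglongrightarrow> (\<integral>\<^sup>+z. Lim z \<partial>MT)"
    by (rule nn_integral_dominated_convergence[where w = "\<lambda>_. B"]) (use lims LB fin meas' in auto)
  moreover have "(\<lambda>n. \<integral>\<^sup>+z. R n z \<partial>MT) \<longlonglongrightarrow> (\<integral>\<^sup>+z. stopped_low_mean \<tau> f z \<partial>MT)"
    by (rule nn_integral_dominated_convergence[where w = "\<lambda>_. B"]) (use lims LB fin meas in auto)
  ultimately show "(\<integral>\<^sup>+z. (if \<tau> (fst z) < ennreal (snd z) then f (X (max 0 (snd z)) (fst z)) else 0) \<partial>MT) =
      (\<integral>\<^sup>+z. stopped_low_mean \<tau> f z \<partial>MT)"
    unfolding Lim_def[symmetric] eq by (rule LIMSEQ_unique)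
qed

lemma low_mean_mono: "(\<And>y. f y \<le> f' y) \<Longrightarrow> low_mean f y \<le> low_mean f' y"
  unfolding low_mean_def by (intro nn_integral_mono)

lemma low_mean_SUP:
  assumes f: "\<And>i :: nat. f i \<in> borel_measurable borel" and inc: "incseq f"
  shows "low_mean (\<lambda>y. SUP i. f i y) y = (SUP i. low_mean (f i) y)"
proof -
  note [measurable] = f
  have "low_mean (\<lambda>y. SUP i. f i y) y = (\<integral>\<^sup>+t. (SUP i. \<integral>\<^sup>+\<omega>. f i (y + low X' t \<omega>) \<partial>M') \<partial>exp_law r)"
    unfolding low_mean_def using inc
    by (intro nn_integral_cong nn_integral_monotone_convergence_SUP) (auto simp: incseq_def le_fun_def)
  also have "\<dots> = (SUP i. low_mean (f i) y)"
    unfolding low_mean_def using inc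
    by (intro nn_integral_monotone_convergence_SUP)
       (auto simp: incseq_def le_fun_def intro!: nn_integral_mono)
  finally show ?thesis .
qed

text \<open>Truncation \<open>min f i\<close> and monotone convergence remove the bound on \<open>f\<close>.\<close>

theorem wiener_hopf_stopped:
  assumes \<tau>: "stopping_time (nat_filtration M X) \<tau>" and f: "continuous_on UNIV f"
  shows "stopped_low_mean \<tau> f \<in> borel_measurable MT"
    and "(\<integral>\<^sup>+z. (if \<tau> (fst z) < ennreal (snd z) then f (X (max 0 (snd z)) (fst z)) else 0) \<partial>MT) =
      (\<integral>\<^sup>+z. stopped_low_mean \<tau> f z \<partial>MT)"
proof -
  note [measurable] = X.stopping_time_measurable[OF \<tau>]
  define g where "g i y = min (f y) (of_nat i)" for i :: nat and y
  have g: "continuous_on UNIV (g i)" for i unfolding g_def by (intro continuous_on_min f continuous_on_const)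
  have gB: "g i y \<le> of_nat i" "(of_nat i :: ennreal) < \<infinity>" for i y
    by (auto simp: g_def of_nat_less_top)
  have [measurable]: "g i \<in> borel_measurable borel" for i by (rule borel_measurable_continuous_onI[OF g])
  have inc: "incseq g" by (auto simp: incseq_def le_fun_def g_def min.coboundedI2)
  have f_SUP: "f = (\<lambda>y. SUP i. g i y)"
  proof
    fix y
    have "(SUP i. g i y) = inf (f y) (SUP i. of_nat i)"
      unfolding g_def inf_min[symmetric] by (rule inf_SUP[symmetric])
    then show "f y = (SUP i. g i y)" by (simp add: ennreal_SUP_of_nat_eq_top)
  qed
  have sk: "stopped_low_mean \<tau> f z = (SUP i. stopped_low_mean \<tau> (g i) z)" for z
    unfolding stopped_low_mean_def by (subst f_SUP, subst low_mean_SUP) (auto intro: inc)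
  note [measurable] = wiener_hopf_stopped_bounded(1)[OF \<tau> g gB]
  show "stopped_low_mean \<tau> f \<in> borel_measurable MT"
    unfolding sk[abs_def] by measurable
  have "(\<integral>\<^sup>+z. (if \<tau> (fst z) < ennreal (snd z) then f (X (max 0 (snd z)) (fst z)) else 0) \<partial>MT)
     = (\<integral>\<^sup>+z. (SUP i. (if \<tau> (fst z) < ennreal (snd z) then g i (X (max 0 (snd z)) (fst z)) else 0)) \<partial>MT)"
    by (intro nn_integral_cong) (subst f_SUP, simp)
  also have "\<dots> = (SUP i. \<integral>\<^sup>+z. (if \<tau> (fst z) < ennreal (snd z) then g i (X (max 0 (snd z)) (fst z)) else 0) \<partial>MT)"
    using inc by (intro nn_integral_monotone_convergence_SUP) (auto simp: incseq_def le_fun_def)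
  also have "\<dots> = (SUP i. \<integral>\<^sup>+z. stopped_low_mean \<tau> (g i) z \<partial>MT)"
    by (simp only: wiener_hopf_stopped_bounded(2)[OF \<tau> g gB])
  also have "\<dots> = (\<integral>\<^sup>+z. (SUP i. stopped_low_mean \<tau> (g i) z) \<partial>MT)"
  proof (rule nn_integral_monotone_convergence_SUP[symmetric])
    show "incseq (\<lambda>i. stopped_low_mean \<tau> (g i))"
      using inc by (auto simp: incseq_def le_fun_def stopped_low_mean_def intro!: low_mean_mono)
  qed measurable
  finally show "(\<integral>\<^sup>+z. (if \<tau> (fst z) < ennreal (snd z) then f (X (max 0 (snd z)) (fst z)) else 0) \<partial>MT) =
      (\<integral>\<^sup>+z. stopped_low_mean \<tau> f z \<partial>MT)"
    by (simp only: sk)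
qed

end

section \<open>The entrance time into a closed half-line\<close>

lemma emeasure_liminf_le:
  assumes B [measurable]: "\<And>n :: nat. B n \<in> sets M" and p: "\<And>n. emeasure M (B n) \<le> p"
  shows "emeasure M (\<Union>k. \<Inter>n\<in>{k..}. B n) \<le> p"
proof -
  have inc: "incseq (\<lambda>k. \<Inter>n\<in>{k..}. B n)" by (auto simp: incseq_def)
  have "emeasure M (\<Union>k. \<Inter>n\<in>{k..}. B n) = (SUP k. emeasure M (\<Inter>n\<in>{k..}. B n))"
    by (rule SUP_emeasure_incseq[symmetric, OF _ inc]) auto
  also have "\<dots> \<le> p"
  proof (rule SUP_least)
    fix k
    have "emeasure M (\<Inter>n\<in>{k..}. B n) \<le> emeasure M (B k)" by (rule emeasure_mono) auto
    then show "emeasure M (\<Inter>n\<in>{k..}. B n) \<le> p" using p by (rule order_trans)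
  qed
  finally show ?thesis .
qed

context levy_from begin

text \<open>The process falls by more than \<open>\<delta>\<close> below its start within time \<open>\<epsilon>\<close>, as seen on some grid.\<close>

definition early_drop :: "real \<Rightarrow> real \<Rightarrow> 'a set" where
  "early_drop \<delta> \<epsilon> = {\<omega>\<in>space M. \<exists>m i. real i * mesh m \<le> \<epsilon> \<and> X (real i * mesh m) \<omega> - X 0 \<omega> < - \<delta>}"

text \<open>The process falls by more than \<open>\<delta>\<close> within time \<open>\<epsilon>\<close> after the first grid time above level \<open>a\<close>.\<close>

definition drop_after_passage :: "real \<Rightarrow> real \<Rightarrow> real \<Rightarrow> nat \<Rightarrow> 'a set" where
  "drop_after_passage a \<delta> \<epsilon> n = {\<omega>\<in>space M. \<exists>k. a < X (real k * mesh n) \<omega> \<and> (\<forall>i<k. X (real i * mesh n) \<omega> \<le> a) \<and>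
     (\<exists>i. real i * mesh n \<le> \<epsilon> \<and> X (real (k + i) * mesh n) \<omega> - X (real k * mesh n) \<omega> < - \<delta>)}"

lemma early_drop_sets [measurable]: "early_drop \<delta> \<epsilon> \<in> sets M"
  unfolding early_drop_def by measurable

lemma drop_after_passage_sets [measurable]: "drop_after_passage a \<delta> \<epsilon> n \<in> sets M"
  unfolding drop_after_passage_def not_less[symmetric] by measurable

text \<open>The strong Markov property at the first passage on the grid: the events of first passage at the
  \<open>k\<close>-th grid point are disjoint and independent of the drop that follows.\<close>

lemma drop_after_passage_le:
  "emeasure M (drop_after_passage a \<delta> \<epsilon> n) \<le> emeasure M (early_drop \<delta> \<epsilon>)"
proof -
  define D where "D = {d \<in> space (PiM UNIV (\<lambda>_::nat. borel :: real measure)). \<exists>i. real i * mesh n \<le> \<epsilon> \<and> wsum d i < - \<delta>}"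
  have D: "D \<in> sets (PiM UNIV (\<lambda>_. borel))" unfolding D_def by measurable
  define F where "F k = {\<omega>\<in>space M. a < X (real k * mesh n) \<omega> \<and> (\<forall>i<k. X (real i * mesh n) \<omega> \<le> a)}" for k
  have F_raw: "F k \<in> sets (raw_filtration M X (real k * mesh n))" for k
  proof -
    let ?R = "raw_filtration M X (real k * mesh n)"
    have meas: "X (real i * mesh n) \<in> borel_measurable ?R" if "i \<le> k" for i
      using that by (intro measurable_X_raw) (auto intro: mult_right_mono)
    have "{\<omega>\<in>space ?R. a < X (real k * mesh n) \<omega> \<and> (\<forall>i\<in>{..<k}. X (real i * mesh n) \<omega> \<le> a)} \<in> sets ?R"
    proof (intro sets.sets_Collect_conj sets.sets_Collect_finite_All)
      show "{\<omega>\<in>space ?R. a < X (real k * mesh n) \<omega>} \<in> sets ?R"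
        by (intro borel_measurable_less borel_measurable_const meas) simp
      fix i assume "i \<in> {..<k}"
      then show "{\<omega>\<in>space ?R. X (real i * mesh n) \<omega> \<le> a} \<in> sets ?R"
        by (intro borel_measurable_le borel_measurable_const meas) simp
    qed simp
    then show ?thesis by (simp add: F_def lessThan_def)
  qed
  have F [measurable]: "F k \<in> sets M" for k by (rule subsetD[OF sets_raw_filtration_subset F_raw])
  have disj: "disjoint_family F"
  proof (unfold disjoint_family_on_def, intro ballI impI)
    fix i j :: nat assume "i \<noteq> j"
    then consider "i < j" | "j < i" by linarith
    then show "F i \<inter> F j = {}" by cases (auto simp: F_def dest: leD)
  qed
  define E where "E k = grid_incr X (real k * mesh n) n -` D \<inter> space M" for k
  have E [measurable]: "E k \<in> sets M" for k
    unfolding E_def by (rule measurable_sets[OF measurable_grid_incr_PiM D]) simp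
  have E_eq: "E k = {\<omega>\<in>space M. \<exists>i. real i * mesh n \<le> \<epsilon> \<and> X (real (k + i) * mesh n) \<omega> - X (real k * mesh n) \<omega> < - \<delta>}" for k
    by (auto simp: E_def D_def space_PiM wsum_grid_incr algebra_simps)
  have law: "prob (E k) = prob (E 0)" for k
  proof -
    have "measure (distr M (PiM UNIV (\<lambda>_. borel)) (grid_incr X (real k * mesh n) n)) D =
        measure (distr M (PiM UNIV (\<lambda>_. borel)) (grid_incr X (real 0 * mesh n) n)) D"
      by (subst (1 2) distr_grid_incr) auto
    then show ?thesis
      unfolding E_def by (subst (asm) (1 2) measure_distr) (auto intro: D measurable_grid_incr_PiM)
  qed
  have "E 0 \<subseteq> early_drop \<delta> \<epsilon>" by (auto simp: E_eq early_drop_def)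
  then have E0: "emeasure M (E 0) \<le> emeasure M (early_drop \<delta> \<epsilon>)" by (rule emeasure_mono) auto
  have "drop_after_passage a \<delta> \<epsilon> n = (\<Union>k. F k \<inter> E k)"
    by (auto simp: drop_after_passage_def F_def E_eq)
  then have "emeasure M (drop_after_passage a \<delta> \<epsilon> n) \<le> (\<Sum>k. emeasure M (F k \<inter> E k))"
    using emeasure_subadditive_countably[of "\<lambda>k. F k \<inter> E k" M] F E by (simp add: image_subset_iff)
  also have "\<dots> = (\<Sum>k. emeasure M (F k) * emeasure M (E 0))"
  proof (rule suminf_cong)
    fix k
    have "prob (F k \<inter> E k) = prob (F k) * prob (E k)"
      unfolding E_def by (rule past_indep_future[OF _ F_raw D]) simp
    then show "emeasure M (F k \<inter> E k) = emeasure M (F k) * emeasure M (E 0)"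
      by (simp add: emeasure_eq_measure ennreal_mult law[of k])
  qed
  also have "\<dots> = emeasure M (\<Union>k. F k) * emeasure M (E 0)"
    using suminf_emeasure[OF _ disj, of M] F by (simp add: ennreal_suminf_multc image_subset_iff)
  also have "\<dots> \<le> 1 * emeasure M (E 0)"
    by (intro mult_right_mono) (auto intro: emeasure_le_1)
  finally show ?thesis using E0 by simp
qed

lemma early_drop_vanishes:
  assumes "0 < \<delta>"
  shows "(\<lambda>j. emeasure M (early_drop \<delta> (mesh j))) \<longlonglongrightarrow> 0"
proof -
  have mesh_dec: "mesh j \<le> mesh i" if "i \<le> j" for i j
    using that by (auto simp: mesh_def intro!: divide_left_mono power_increasing)
  have dec: "decseq (\<lambda>j. early_drop \<delta> (mesh j))"
    unfolding decseq_def early_drop_def using order_trans[OF _ mesh_dec] by blast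
  have empty: "(\<Inter>j. early_drop \<delta> (mesh j)) = {}"
  proof (rule ccontr)
    assume "(\<Inter>j. early_drop \<delta> (mesh j)) \<noteq> {}"
    then obtain \<omega> where w: "\<And>j. \<omega> \<in> early_drop \<delta> (mesh j)" by auto
    then have "\<omega> \<in> space M" by (auto simp: early_drop_def)
    then have "((\<lambda>t. X t \<omega>) \<longlongrightarrow> X 0 \<omega>) (at_right 0)" by (intro cadlag_right cadlag_path) auto
    then have "\<forall>\<^sub>F t in at_right 0. dist (X t \<omega>) (X 0 \<omega>) < \<delta>" using assms by (rule tendstoD)
    then obtain e where e: "0 < e" "\<And>t. 0 < t \<Longrightarrow> t < e \<Longrightarrow> dist (X t \<omega>) (X 0 \<omega>) < \<delta>"
      using eventually_at_right[of "0::real" 1] by auto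
    obtain j where j: "mesh j < e"
      using order_tendstoD(2)[OF mesh_tendsto e(1)] eventually_happens'[OF sequentially_bot] by blast
    obtain m i where mi: "real i * mesh m \<le> mesh j" "X (real i * mesh m) \<omega> - X 0 \<omega> < - \<delta>"
      using w[of j] by (auto simp: early_drop_def)
    have "0 < real i * mesh m" using mi(2) assms by (cases "i = 0") auto
    then have "dist (X (real i * mesh m) \<omega>) (X 0 \<omega>) < \<delta>" using e(2)[of "real i * mesh m"] mi(1) j by linarith
    then show False using mi(2) by (simp add: dist_real_def abs_if split: if_splits)
  qed
  have "(\<lambda>j. emeasure M (early_drop \<delta> (mesh j))) \<longlonglongrightarrow> emeasure M (\<Inter>j. early_drop \<delta> (mesh j))"
    by (rule Lim_emeasure_decseq[OF _ dec]) auto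
  then show ?thesis by (simp only: empty emeasure_empty)
qed

text \<open>The path approaches level \<open>b\<close> from below for the first time at \<open>\<sigma>\<close> and is thrown back by more
  than \<open>2 * \<delta>\<close> at that moment.\<close>

definition jump_off :: "real \<Rightarrow> real \<Rightarrow> 'a set" where
  "jump_off b \<delta> = {\<omega>\<in>space M. \<exists>\<sigma>>0. (\<forall>s. 0 \<le> s \<longrightarrow> s < \<sigma> \<longrightarrow> peak X 0 s \<omega> < b) \<and>
     ((\<lambda>s. X s \<omega>) \<longlongrightarrow> b) (at_left \<sigma>) \<and> X \<sigma> \<omega> < b - 2 * \<delta>}"

lemma peak_upper:
  assumes "\<omega> \<in> space M" "0 \<le> u" "u \<le> s" "s \<le> t"
  shows "X s \<omega> \<le> peak X u t \<omega>"
  unfolding peak_def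
  by (rule cSUP_upper) (use assms in \<open>auto intro!: cadlag_bdd cadlag_path\<close>)

text \<open>Since \<open>\<sigma>\<close> is the first approach, passage over a level slightly below \<open>b\<close> happens only shortly
  before \<open>\<sigma>\<close>, on all fine grids; the jump at \<open>\<sigma>\<close> is then a drop within time \<open>\<epsilon>\<close> of this passage. One half
  of \<open>2 * \<delta>\<close> absorbs the gap between the level and \<open>b\<close>.\<close>

lemma jump_off_drop:
  assumes \<omega>: "\<omega> \<in> jump_off b \<delta>" and pos: "0 < \<delta>" "0 < \<epsilon>"
  shows "\<omega> \<in> (\<Union>k. \<Inter>m\<in>{k..}. \<Union>l. \<Inter>n\<in>{l..}. drop_after_passage (b - mesh m) \<delta> \<epsilon> n)"
proof -
  obtain \<sigma> where \<sigma>: "0 < \<sigma>" "\<And>s. 0 \<le> s \<Longrightarrow> s < \<sigma> \<Longrightarrow> peak X 0 s \<omega> < b"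
    "((\<lambda>s. X s \<omega>) \<longlongrightarrow> b) (at_left \<sigma>)" "X \<sigma> \<omega> < b - 2 * \<delta>" and sp: "\<omega> \<in> space M"
    using \<omega> by (auto simp: jump_off_def)
  define v where "v = max 0 (\<sigma> - \<epsilon> / 2)"
  have v: "0 \<le> v" "v < \<sigma>" "\<sigma> - \<epsilon> / 2 \<le> v" using \<sigma>(1) pos by (auto simp: v_def)
  define \<eta> where "\<eta> = min \<delta> (b - peak X 0 v \<omega>)"
  have "0 < \<eta>" using pos \<sigma>(2)[OF v(1,2)] by (simp add: \<eta>_def)
  then obtain k where k: "\<And>m. k \<le> m \<Longrightarrow> mesh m < \<eta>"
    using order_tendstoD(2)[OF mesh_tendsto] by (auto simp: eventually_sequentially)
  have "\<exists>l. \<forall>n\<ge>l. \<omega> \<in> drop_after_passage (b - mesh m) \<delta> \<epsilon> n" if m: "k \<le> m" for m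
  proof -
    have \<eta>: "mesh m < \<delta>" "mesh m < b - peak X 0 v \<omega>" using k[OF m] by (auto simp: \<eta>_def)
    have "\<forall>\<^sub>F s in at_left \<sigma>. b - mesh m < X s \<omega>"
      by (rule order_tendstoD(1)[OF \<sigma>(3)]) simp
    moreover have "\<forall>\<^sub>F s in at_left \<sigma>. v < s \<and> s < \<sigma>"
      using v(2) by (auto simp: eventually_at_left[OF v(2)])
    ultimately have "\<forall>\<^sub>F s in at_left \<sigma>. b - mesh m < X s \<omega> \<and> v < s \<and> s < \<sigma>"
      by eventually_elim simp
    then obtain s where s: "b - mesh m < X s \<omega>" "v < s" "s < \<sigma>"
      using eventually_happens'[OF trivial_limit_at_left_real] by blast
    have "\<forall>\<^sub>F n in sequentially. b - mesh m < X (real (next_idx n s) * mesh n) \<omega>"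
      by (rule order_tendstoD(1)[OF cadlag_next_time[OF cadlag_path[OF sp]] s(1)]) (use v s in simp)
    moreover have "\<forall>\<^sub>F n in sequentially. X (real (next_idx n \<sigma>) * mesh n) \<omega> < b - 2 * \<delta>"
      by (rule order_tendstoD(2)[OF cadlag_next_time[OF cadlag_path[OF sp]] \<sigma>(4)]) (use \<sigma> in simp)
    moreover have "\<forall>\<^sub>F n in sequentially. mesh n < \<epsilon> / 2"
      by (rule order_tendstoD(2)[OF mesh_tendsto]) (use pos in simp)
    ultimately have "\<forall>\<^sub>F n in sequentially. \<omega> \<in> drop_after_passage (b - mesh m) \<delta> \<epsilon> n"
    proof eventually_elim
      case (elim n)
      (* The first passage index; it is at most the index of the grid point following s. *)
      define q where "q = (LEAST i. b - mesh m < X (real i * mesh n) \<omega>)"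
      have q: "b - mesh m < X (real q * mesh n) \<omega>" "q \<le> next_idx n s"
        "\<And>i. i < q \<Longrightarrow> X (real i * mesh n) \<omega> \<le> b - mesh m"
        unfolding q_def using elim(1) by (auto intro: LeastI Least_le dest: not_less_Least)
      have "v < real q * mesh n"
      proof (rule ccontr)
        assume "\<not> v < real q * mesh n"
        then have "X (real q * mesh n) \<omega> \<le> peak X 0 v \<omega>" by (intro peak_upper sp) auto
        then show False using q(1) \<eta>(2) by simp
      qed
      define i where "i = next_idx n \<sigma> - q"
      have qi: "q + i = next_idx n \<sigma>"
        using q(2) next_idx_mono[of s \<sigma> n] s by (simp add: i_def)
      have "real i * mesh n = real (next_idx n \<sigma>) * mesh n - real q * mesh n"
        unfolding qi[symmetric] by (simp add: algebra_simps)
      also have "\<dots> \<le> \<epsilon>"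
        using next_idx_bounds(2)[of \<sigma> n] \<sigma>(1) v(3) \<open>v < real q * mesh n\<close> elim(3) by linarith
      finally have "real i * mesh n \<le> \<epsilon>" .
      moreover have "X (real (q + i) * mesh n) \<omega> - X (real q * mesh n) \<omega> < - \<delta>"
        unfolding qi using elim(2) q(1) \<eta>(1) by linarith
      ultimately show ?case
        unfolding drop_after_passage_def using sp q by blast
    qed
    then show ?thesis by (auto simp: eventually_sequentially)
  qed
  then have "\<forall>m\<in>{k..}. \<exists>l. \<forall>n\<in>{l..}. \<omega> \<in> drop_after_passage (b - mesh m) \<delta> \<epsilon> n"
    unfolding Ball_def atLeast_iff by blast
  then show ?thesis
    unfolding UN_iff INT_iff bex_UNIV by (rule exI)
qed

text \<open>The event lies in a double limes inferior of events whose probability is at most that of an early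
  drop, for every time horizon; and early drops become impossible as the horizon shrinks.\<close>

lemma jump_off_null:
  assumes "0 < \<delta>"
  shows "jump_off b \<delta> \<in> null_sets (completion M)"
proof -
  define E where "E j = (\<Union>k. \<Inter>m\<in>{k..}. \<Union>l. \<Inter>n\<in>{l..}. drop_after_passage (b - mesh m) \<delta> (mesh j) n)" for j
  have E [measurable]: "E j \<in> sets M" for j unfolding E_def by measurable
  have le: "emeasure M (\<Inter>j. E j) \<le> emeasure M (early_drop \<delta> (mesh j))" for j
  proof -
    have "emeasure M (\<Inter>j. E j) \<le> emeasure M (E j)" by (rule emeasure_mono) auto
    also have "\<dots> \<le> emeasure M (early_drop \<delta> (mesh j))"
      unfolding E_def by (intro emeasure_liminf_le drop_after_passage_le) measurable
    finally show ?thesis .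
  qed
  have "emeasure M (\<Inter>j. E j) \<le> 0"
    by (rule LIMSEQ_le_const[OF early_drop_vanishes[OF assms]]) (use le in auto)
  then have "(\<Inter>j. E j) \<in> null_sets M" by (intro null_setsI) auto
  moreover have "jump_off b \<delta> \<subseteq> (\<Inter>j. E j)"
    unfolding E_def using jump_off_drop[OF _ assms mesh_pos(1)] by blast
  ultimately show ?thesis
    by (intro null_sets_completion_subset[OF _ null_sets_completionI])
qed

text \<open>If the supremum up to \<open>t\<close> reaches \<open>b\<close> but no value does, then at the first time at which the running
  supremum equals \<open>b\<close> the left limit must be \<open>b\<close>.\<close>

lemma first_approach:
  assumes \<omega>: "\<omega> \<in> space M" and t: "0 \<le> t" and below: "\<And>s. 0 \<le> s \<Longrightarrow> s \<le> t \<Longrightarrow> X s \<omega> < b"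
    and sup: "b \<le> peak X 0 t \<omega>"
  shows "\<exists>j. \<omega> \<in> jump_off b (mesh j)"
proof -
  note c = cadlag_path[OF \<omega>]
  have peak_less: "peak X 0 s \<omega> < b" if "b' < b" "0 \<le> s" "\<And>s'. 0 \<le> s' \<Longrightarrow> s' \<le> s \<Longrightarrow> X s' \<omega> \<le> b'" for s b'
  proof -
    have "peak X 0 s \<omega> \<le> b'" unfolding peak_def using that by (intro cSUP_least) auto
    then show ?thesis using that(1) by simp
  qed
  define S where "S = {s\<in>{0..t}. peak X 0 s \<omega> < b}"
  have S0: "0 \<in> S" using below[of 0] t by (simp add: S_def peak_def)
  have Sb: "bdd_above S" by (auto simp: S_def intro!: bdd_aboveI[of _ t])
  define \<sigma> where "\<sigma> = Sup S"
  have "s \<le> t" if "s \<in> S" for s using that by (simp add: S_def)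
  then have \<sigma>t: "0 \<le> \<sigma>" "\<sigma> \<le> t"
    unfolding \<sigma>_def using cSup_upper[OF S0 Sb] cSup_least[of S t] S0 by blast+
  have before: "peak X 0 s \<omega> < b" if "0 \<le> s" "s < \<sigma>" for s
  proof -
    have "S \<noteq> {}" using S0 by blast
    then obtain s' where s': "s' \<in> S" "s < s'"
      using \<open>s < \<sigma>\<close> unfolding \<sigma>_def by (auto simp: less_cSup_iff[OF _ Sb])
    have "peak X 0 s \<omega> \<le> peak X 0 s' \<omega>"
      unfolding peak_def using that s' by (intro cSUP_subset_mono cadlag_bdd c) auto
    then show ?thesis using s' by (simp add: S_def)
  qed
  have \<sigma>S: "b \<le> peak X 0 \<sigma> \<omega>"
  proof (rule ccontr)
    assume n: "\<not> b \<le> peak X 0 \<sigma> \<omega>"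
    then have "\<sigma> \<noteq> t" using sup by auto
    then have lt: "\<sigma> < t" using \<sigma>t by simp
    define b' where "b' = (peak X 0 \<sigma> \<omega> + b) / 2"
    have b': "peak X 0 \<sigma> \<omega> < b'" "b' < b" using n by (auto simp: b'_def)
    have "X \<sigma> \<omega> < b'" using peak_upper[OF \<omega> order_refl \<sigma>t(1) order_refl] b' by simp
    then have "\<forall>\<^sub>F s in at_right \<sigma>. X s \<omega> < b'" by (rule order_tendstoD(2)[OF cadlag_right[OF c \<sigma>t(1)]])
    then obtain e where e: "\<sigma> < e" "\<And>s. \<sigma> < s \<Longrightarrow> s < e \<Longrightarrow> X s \<omega> < b'"
      using eventually_at_right[OF lt] by auto
    define w where "w = min t ((\<sigma> + e) / 2)"
    have w: "\<sigma> < w" "w \<le> t" "w < e" using lt e(1) by (auto simp: w_def min_less_iff_disj)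
    have "X s \<omega> \<le> b'" if "0 \<le> s" "s \<le> w" for s
      using peak_upper[OF \<omega> order_refl that(1), of \<sigma>] b' e(2)[of s] that w by (cases "s \<le> \<sigma>") auto
    then have "peak X 0 w \<omega> < b" using \<sigma>t w by (intro peak_less[OF b'(2)]) auto
    then have "w \<in> S" using w \<sigma>t by (simp add: S_def)
    then show False using cSup_upper[OF _ Sb, of w] w by (simp add: \<sigma>_def)
  qed
  have \<sigma>0: "0 < \<sigma>"
  proof (rule ccontr)
    assume "\<not> 0 < \<sigma>" then have "\<sigma> = 0" using \<sigma>t by simp
    then show False using \<sigma>S S0 by (simp add: S_def)
  qed
  obtain l where l: "((\<lambda>s. X s \<omega>) \<longlongrightarrow> l) (at_left \<sigma>)" using c \<sigma>0 by (auto simp: cadlag_def)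
  have ev_lt: "\<forall>\<^sub>F s in at_left \<sigma>. 0 < s \<and> s < \<sigma>" by (auto simp: eventually_at_left[OF \<sigma>0] intro!: exI[of _ 0] \<sigma>0)
  have "l = b"
  proof (rule antisym)
    have "\<forall>\<^sub>F s in at_left \<sigma>. X s \<omega> \<le> b"
      using ev_lt by eventually_elim (use below \<sigma>t in \<open>force intro: less_imp_le\<close>)
    then show "l \<le> b" by (intro tendsto_upperbound[OF l]) auto
    show "b \<le> l"
    proof (rule ccontr)
      assume "\<not> b \<le> l"
      then have lb: "l < (l + b) / 2" "(l + b) / 2 < b" by auto
      have "\<forall>\<^sub>F s in at_left \<sigma>. X s \<omega> < (l + b) / 2" by (rule order_tendstoD(2)[OF l lb(1)])
      then obtain e where e: "e < \<sigma>" "\<And>s. e < s \<Longrightarrow> s < \<sigma> \<Longrightarrow> X s \<omega> < (l + b) / 2"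
        using eventually_at_left[OF \<sigma>0] by auto
      define v where "v = max 0 e"
      have v: "0 \<le> v" "v < \<sigma>" "e \<le> v" using e \<sigma>0 by (auto simp: v_def)
      define b' where "b' = max (peak X 0 v \<omega>) (max ((l + b) / 2) (X \<sigma> \<omega>))"
      have "b' < b" using before[OF v(1,2)] lb below[OF \<sigma>t] by (simp add: b'_def)
      moreover have "X s \<omega> \<le> b'" if s: "0 \<le> s" "s \<le> \<sigma>" for s
      proof -
        consider "s \<le> v" | "v < s" "s < \<sigma>" | "s = \<sigma>" using s by linarith
        then show ?thesis
        proof cases
          case 1 then show ?thesis using peak_upper[OF \<omega> order_refl s(1) 1] by (simp add: b'_def)
        next
          case 2
          then have "X s \<omega> < (l + b) / 2" using e(2)[of s] v by simp
          then show ?thesis by (simp add: b'_def le_max_iff_disj)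
        qed (simp add: b'_def)
      qed
      ultimately have "peak X 0 \<sigma> \<omega> < b" using \<sigma>t by (intro peak_less) auto
      then show False using \<sigma>S by simp
    qed
  qed
  moreover obtain j where "X \<sigma> \<omega> < b - 2 * mesh j"
  proof -
    have "\<forall>\<^sub>F j in sequentially. mesh j < (b - X \<sigma> \<omega>) / 2"
      by (rule order_tendstoD(2)[OF mesh_tendsto]) (use below[OF \<sigma>t] in simp)
    then obtain j where "mesh j < (b - X \<sigma> \<omega>) / 2"
      using eventually_happens'[OF sequentially_bot] by blast
    then show ?thesis using that[of j] by (simp add: field_simps)
  qed
  ultimately show ?thesis using \<omega> \<sigma>0 before l unfolding jump_off_def by blast
qed

lemma peak_measurable_nat_filtration:
  assumes t: "0 \<le> t"
  shows "{\<omega>\<in>space M. b \<le> peak X 0 t \<omega>} \<in> sets (nat_filtration M X (ennreal t))"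
proof -
  let ?F = "nat_filtration M X (ennreal t)"
  let ?Q = "insert t (\<rat> \<inter> {0..t})"
  have X: "X s \<in> borel_measurable ?F" if "s \<in> ?Q" for s
  proof (rule measurableI)
    fix A :: "real set" assume "A \<in> sets borel"
    then show "X s -` A \<inter> space ?F \<in> sets ?F"
      unfolding sets_nat_filtration space_nat_filtration using that t by (intro sigma_sets.Basic) auto
  qed auto
  have "countable ?Q" by (auto intro!: countable_subset[OF _ countable_rat])
  have eq: "b \<le> peak X 0 t \<omega> \<longleftrightarrow> (\<forall>j. \<exists>s\<in>?Q. b - mesh j < X s \<omega>)" if \<omega>: "\<omega> \<in> space M" for \<omega>
  proof
    assume b: "b \<le> peak X 0 t \<omega>"
    show "\<forall>j. \<exists>s\<in>?Q. b - mesh j < X s \<omega>"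
    proof
      fix j
      have "b - mesh j < peak X 0 t \<omega>" using b mesh_pos(1)[of j] by linarith
      then have "\<exists>s\<in>{0..t}. b - mesh j < X s \<omega>"
        using t unfolding peak_def
        by (subst (asm) less_cSUP_iff) (auto intro!: cadlag_bdd cadlag_path \<omega>)
      then obtain s where s: "s \<in> {0..t}" "b - mesh j < X s \<omega>" by blast
      show "\<exists>s\<in>?Q. b - mesh j < X s \<omega>"
      proof (cases "s = t")
        case False
        then have st: "s < t" using s by simp
        have "\<forall>\<^sub>F s' in at_right s. b - mesh j < X s' \<omega>"
          using order_tendstoD(1)[OF cadlag_right[OF cadlag_path[OF \<omega>]] s(2)] s by auto
        then obtain e where e: "s < e" "\<And>s'. s < s' \<Longrightarrow> s' < e \<Longrightarrow> b - mesh j < X s' \<omega>"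
          using eventually_at_right[OF st] by auto
        obtain q where "q \<in> \<rat>" "s < q" "q < min e t" using Rats_dense_in_real[of s "min e t"] st e by auto
        then show ?thesis using e(2)[of q] s by (intro bexI[of _ q]) auto
      qed (use s in auto)
    qed
  next
    assume a: "\<forall>j. \<exists>s\<in>?Q. b - mesh j < X s \<omega>"
    have "b - mesh j \<le> peak X 0 t \<omega>" for j
    proof -
      obtain s where "s \<in> ?Q" "b - mesh j < X s \<omega>" using a by blast
      then show ?thesis using peak_upper[OF \<omega> order_refl, of s t] t by auto
    qed
    moreover have "(\<lambda>j. b - mesh j) \<longlonglongrightarrow> b - 0" by (intro tendsto_intros mesh_tendsto)
    ultimately show "b \<le> peak X 0 t \<omega>" using LIMSEQ_le_const2[of "\<lambda>j. b - mesh j" b] by auto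
  qed
  have "{\<omega>\<in>space ?F. \<forall>j. \<exists>s\<in>?Q. b - mesh j < X s \<omega>} \<in> sets ?F"
  proof (intro sets.sets_Collect_countable_All sets.sets_Collect_countable_Ex')
    fix j s assume "s \<in> ?Q"
    then show "{\<omega>\<in>space ?F. b - mesh j < X s \<omega>} \<in> sets ?F"
      by (intro borel_measurable_less borel_measurable_const X)
  qed fact
  moreover have "{\<omega>\<in>space ?F. \<forall>j. \<exists>s\<in>?Q. b - mesh j < X s \<omega>} = {\<omega>\<in>space M. b \<le> peak X 0 t \<omega>}"
    using eq by auto
  ultimately show ?thesis by simp
qed

text \<open>Up to the null event of \<open>first_approach\<close>, hitting the half-line means that the running supremum
  reaches its end point, which is observable on countably many times.\<close>

lemma hits_closed_half_line:
  assumes t: "0 \<le> t"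
  shows "{\<omega>\<in>space M. \<exists>s\<in>{0..t}. b \<le> X s \<omega>} \<in> sets (nat_filtration M X (ennreal t))"
    (is "?H \<in> sets ?F")
proof -
  let ?G = "{\<omega>\<in>space M. b \<le> peak X 0 t \<omega>}"
  have "?G - ?H \<subseteq> (\<Union>j. jump_off b (mesh j))"
    using first_approach[OF _ t, of _ b] by (fastforce simp: not_le)
  moreover have "(\<Union>j. jump_off b (mesh j)) \<in> null_sets (completion M)"
    by (intro null_sets_UN jump_off_null) simp
  ultimately have "?G - ?H \<in> null_sets (completion M)"
    by (rule null_sets_completion_subset)
  then have "?G - ?H \<in> sets ?F" unfolding sets_nat_filtration by (intro sigma_sets.Basic) auto
  moreover have "?G \<in> sets ?F" by (rule peak_measurable_nat_filtration[OF t])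
  ultimately have "?G - (?G - ?H) \<in> sets ?F" by (rule sets.Diff[rotated])
  moreover have "?H \<subseteq> ?G"
    using peak_upper[of _ 0 _ t] by (auto intro: order_trans)
  then have "?G - (?G - ?H) = ?H" by blast
  ultimately show ?thesis by simp
qed

text \<open>By right-continuity the infimum is attained.\<close>

lemma entrance_time_le_iff:
  assumes \<omega>: "\<omega> \<in> space M" and K: "continuous_on UNIV K" and t: "0 \<le> t"
  shows "entrance_time X K c \<omega> \<le> ennreal t \<longleftrightarrow> (\<exists>s\<in>{0..t}. c \<le> K (X s \<omega>))"
proof
  assume "\<exists>s\<in>{0..t}. c \<le> K (X s \<omega>)"
  then obtain s where s: "0 \<le> s" "s \<le> t" "c \<le> K (X s \<omega>)" by auto
  then have "entrance_time X K c \<omega> \<le> ennreal s" unfolding entrance_time_def by (intro Inf_lower) auto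
  then show "entrance_time X K c \<omega> \<le> ennreal t" using s by (meson ennreal_leI order_trans)
next
  assume le: "entrance_time X K c \<omega> \<le> ennreal t"
  show "\<exists>s\<in>{0..t}. c \<le> K (X s \<omega>)"
  proof (rule ccontr)
    assume n: "\<not> ?thesis"
    have "((\<lambda>s. K (X s \<omega>)) \<longlongrightarrow> K (X t \<omega>)) (at_right t)"
      using continuous_on_tendsto_compose[OF K cadlag_right[OF cadlag_path[OF \<omega>] t]] by simp
    then have "\<forall>\<^sub>F s in at_right t. K (X s \<omega>) < c" by (rule order_tendstoD(2)) (use n t in \<open>auto simp: not_le\<close>)
    then obtain e where e: "t < e" "\<And>s. t < s \<Longrightarrow> s < e \<Longrightarrow> K (X s \<omega>) < c"
      using eventually_at_right[of t "t+1"] by auto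
    have "ennreal e \<le> entrance_time X K c \<omega>"
      unfolding entrance_time_def
    proof (rule Inf_greatest, safe)
      fix s assume s: "0 \<le> s" "c \<le> K (X s \<omega>)"
      then have "t < s" using n by force
      then have "e \<le> s" using e(2)[of s] s by force
      then show "ennreal e \<le> ennreal s" by (rule ennreal_leI)
    qed
    then have "ennreal e \<le> ennreal t" using le by (rule order_trans)
    then show False using e(1) t by (simp add: ennreal_le_iff)
  qed
qed

theorem stopping_time_entrance_time:
  assumes K: "continuous_on UNIV K" "mono K"
  shows "stopping_time (nat_filtration M X) (entrance_time X K c)"
proof
  fix t :: ennreal
  show "Measurable.pred (nat_filtration M X t) (\<lambda>\<omega>. entrance_time X K c \<omega> \<le> t)"
  proof (cases t)
    case (real a)
    define S where "S = {y. c \<le> K y}"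
    have S_up: "y' \<in> S" if "y \<in> S" "y \<le> y'" for y y'
      using that monoD[OF K(2) that(2)] by (auto simp: S_def)
    have S_closed: "closed S" unfolding S_def by (intro closed_Collect_le K continuous_on_const)
    have eq: "{\<omega>\<in>space M. entrance_time X K c \<omega> \<le> t} = {\<omega>\<in>space M. \<exists>s\<in>{0..a}. X s \<omega> \<in> S}"
      unfolding real S_def using entrance_time_le_iff[OF _ K(1) real(1)] by auto
    have "{\<omega>\<in>space M. \<exists>s\<in>{0..a}. X s \<omega> \<in> S} \<in> sets (nat_filtration M X t)"
    proof (cases "S \<noteq> {} \<and> bdd_below S")
      case True
      then have "Inf S \<in> S" using closed_contains_Inf S_closed by blast
      then have "y \<in> S \<longleftrightarrow> Inf S \<le> y" for y using True S_up by (auto intro: cInf_lower)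
      then show ?thesis using hits_closed_half_line[OF real(1), of "Inf S"] real by simp
    next
      case False
      have "S = {} \<or> S = UNIV"
      proof (rule disjCI)
        assume "S \<noteq> UNIV"
        then obtain y where "y \<notin> S" by blast
        then have "\<forall>x\<in>S. y \<le> x" using S_up by (meson linear)
        then have "bdd_below S" by (auto simp: bdd_below_def)
        with False show "S = {}" by blast
      qed
      then show ?thesis
        using real(1) sets.top[of "nat_filtration M X t"] by auto
    qed
    then show ?thesis by (simp add: pred_def eq)
  qed (use sets.top[of "nat_filtration M X t"] in \<open>simp add: pred_def\<close>)
qed

end

section \<open>Optimality of the entrance time\<close>

context levy_pair begin

lemma AE_start: "AE \<omega> in Mc. \<omega> \<in> space M \<and> X 0 \<omega> = x"
  using AE_completion[OF X.start] by (auto intro: AE_I2 elim!: eventually_elim2 simp: eventually_conj_iff)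

lemma peak_near_start:
  assumes "0 < d"
  shows "AE \<omega> in Mc. \<exists>e>0. \<forall>t. 0 < t \<longrightarrow> t < e \<longrightarrow> peak X 0 t \<omega> \<le> x + d"
  using AE_start
proof eventually_elim
  case (elim \<omega>)
  have "((\<lambda>t. X t \<omega>) \<longlongrightarrow> x) (at_right 0)"
    using cadlag_right[OF X.cadlag_path, of \<omega> 0] elim by simp
  then have "\<forall>\<^sub>F t in at_right 0. X t \<omega> < x + d" by (rule order_tendstoD(2)) (use assms in simp)
  then obtain e where e: "0 < e" "\<And>t. 0 < t \<Longrightarrow> t < e \<Longrightarrow> X t \<omega> < x + d"
    using eventually_at_right[of "0::real" 1] by auto
  have "peak X 0 t \<omega> \<le> x + d" if "0 < t" "t < e" for t
    unfolding peak_def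
  proof (rule cSUP_least)
    fix s assume "s \<in> {0..max 0 t}"
    then show "X s \<omega> \<le> x + d" using e(2)[of s] elim assms that by (cases "s = 0") auto
  qed simp
  then show ?case using e(1) by blast
qed

text \<open>The exponential clock rings before any given time with positive probability; so what happens for all
  small \<open>t\<close> cannot be negligible.\<close>

lemma not_AE_near_start:
  assumes Q: "AE \<omega> in Mc. \<exists>e>0. \<forall>t. 0 < t \<longrightarrow> t < e \<longrightarrow> Q (\<omega>, t)"
  shows "\<not> (AE z in MT. \<not> Q z)"
proof
  assume "AE z in MT. \<not> Q z"
  from MT.AE_pair[OF this] Q have "AE \<omega> in Mc. False"
  proof eventually_elim
    case (elim \<omega>)
    then obtain e where e: "0 < e" "\<And>t. 0 < t \<Longrightarrow> t < e \<Longrightarrow> Q (\<omega>, t)" by blast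
    from elim(1) AE_clock_pos have "AE t in exp_law r. e / 2 < t"
    proof eventually_elim
      case (elim t)
      then show ?case using e(2)[of t] e(1) by (cases "t < e") auto
    qed
    then have "clock.prob {t \<in> space (exp_law r). e / 2 < t} = 1"
      by (subst clock.prob_Collect_eq_1) auto
    then show ?case using clock_exceeds[of "e / 2"] e(1) r_pos by simp
  qed
  then show False by simp
qed

text \<open>For decreasing \<open>f\<close>, an infinite value at \<open>x + d\<close> would propagate to all lower points. These carry
  the running supremum for a short while after the start in \<open>x\<close>, so the right-hand side of the
  factorization would be infinite.\<close>

lemma low_mean_finite_above_start:
  assumes f: "continuous_on UNIV f" and anti: "\<And>y y'. y \<le> y' \<Longrightarrow> f y' \<le> f y"
    and fin: "(\<integral>\<^sup>+z. f (X (max 0 (snd z)) (fst z)) \<partial>MT) < \<infinity>" and d: "0 < d"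
  shows "low_mean f (x + d) < \<infinity>"
proof (rule ccontr)
  assume "\<not> low_mean f (x + d) < \<infinity>"
  then have inf: "low_mean f (x + d) = \<infinity>" by (simp add: less_top[symmetric])
  have kinf: "low_mean f y = \<infinity>" if "y \<le> x + d" for y
  proof -
    have "low_mean f (x + d) \<le> low_mean f y"
      unfolding low_mean_def by (intro nn_integral_mono anti) (use that in simp)
    then show ?thesis using inf by (simp add: top_unique)
  qed
  have st: "stopping_time (nat_filtration M X) (\<lambda>_. 0)" by (rule stopping_time_const)
  have "(\<integral>\<^sup>+z. stopped_low_mean (\<lambda>_. 0) f z \<partial>MT) \<le> (\<integral>\<^sup>+z. f (X (max 0 (snd z)) (fst z)) \<partial>MT)"
    unfolding wiener_hopf_stopped(2)[OF st f, symmetric] by (intro nn_integral_mono) auto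
  then have "(\<integral>\<^sup>+z. stopped_low_mean (\<lambda>_. 0) f z \<partial>MT) \<noteq> \<infinity>" using fin by auto
  then have "AE z in MT. \<not> stopped_low_mean (\<lambda>_. 0) f z = \<infinity>"
    using nn_integral_PInf_AE[OF wiener_hopf_stopped(1)[OF st f]] by simp
  moreover have "AE \<omega> in Mc. \<exists>e>0. \<forall>t. 0 < t \<longrightarrow> t < e \<longrightarrow> stopped_low_mean (\<lambda>_. 0) f (\<omega>, t) = \<infinity>"
    using peak_near_start[OF d]
  proof eventually_elim
    case (elim \<omega>)
    then obtain e where e: "0 < e" "\<And>t. 0 < t \<Longrightarrow> t < e \<Longrightarrow> peak X 0 t \<omega> \<le> x + d" by blast
    show ?case
      by (rule exI[of _ e]) (use e in \<open>auto simp: stopped_low_mean_def kinf simp del: infinity_ennreal_def\<close>)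
  qed
  ultimately show False using not_AE_near_start[of "\<lambda>z. stopped_low_mean (\<lambda>_. 0) f z = \<infinity>"] by blast
qed

end

text \<open>Here \<open>K\<close> is the function \<open>\<kappa>\<close>, expressed by the positive and negative parts of \<open>g\<close>.\<close>

locale levy_stopping = levy_pair +
  fixes g K :: "real \<Rightarrow> real" and c :: real
  assumes g_cont: "continuous_on UNIV g"
    and g_integrable: "integrable MT (\<lambda>z. g (X (max 0 (snd z)) (fst z)))"
    and low_mean_finite: "\<And>y. low_mean (\<lambda>y. ennreal (g y)) y < \<infinity>" "\<And>y. low_mean (\<lambda>y. ennreal (- g y)) y < \<infinity>"
    and K_low_mean: "\<And>y. K y = (enn2real (low_mean (\<lambda>y. ennreal (g y)) y) - enn2real (low_mean (\<lambda>y. ennreal (- g y)) y)) / r"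
    and K_cont: "continuous_on UNIV K" and K_mono: "mono K"
begin

abbreviation "flow z \<equiv> g (X (max 0 (snd z)) (fst z))"

text \<open>The mean of this function is what stopping at \<open>\<tau>\<close> saves compared with never stopping; \<open>fst z\<close> is
  the path and \<open>snd z\<close> the value of the exponential clock.\<close>

definition gain :: "('a \<Rightarrow> ennreal) \<Rightarrow> 'a \<times> real \<Rightarrow> real" where
  "gain \<tau> z = (if \<tau> (fst z) < ennreal (snd z) then K (peak X (enn2real (\<tau> (fst z))) (snd z) (fst z)) - c else 0)"

lemma measurable_g [measurable]: "g \<in> borel_measurable borel"
  by (rule borel_measurable_continuous_onI[OF g_cont])

lemma measurable_K [measurable]: "K \<in> borel_measurable borel"
  by (rule borel_measurable_continuous_onI[OF K_cont])

lemma integrable_if: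
  assumes [measurable]: "Measurable.pred MT Q" and h: "integrable MT h"
  shows "integrable MT (\<lambda>z. if Q z then h z else 0 :: real)"
proof -
  have [measurable]: "h \<in> borel_measurable MT" using h by simp
  show ?thesis by (rule Bochner_Integration.integrable_bound[OF h]) auto
qed

lemma gain_integral:
  assumes \<tau>: "stopping_time (nat_filtration M X) \<tau>"
  shows "integrable MT (gain \<tau>)"
    and "(\<integral>z. gain \<tau> z \<partial>MT) = (\<integral>z. (if \<tau> (fst z) < ennreal (snd z) then flow z / r - c else 0) \<partial>MT)"
proof -
  note [measurable] = X.stopping_time_measurable[OF \<tau>]
  let ?gp = "\<lambda>y. ennreal (g y)" and ?gn = "\<lambda>y. ennreal (- g y)"
  let ?A = "\<lambda>z. \<tau> (fst z) < ennreal (snd z)"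
  define h where "h z = (if ?A z then flow z else 0)" for z
  have h: "integrable MT h" unfolding h_def by (rule integrable_if[OF _ g_integrable]) measurable
  have cont: "continuous_on UNIV ?gp" "continuous_on UNIV ?gn"
    by (intro continuous_on_ennreal g_cont continuous_on_minus)+
  note meas = wiener_hopf_stopped(1)[OF \<tau> cont(1)] wiener_hopf_stopped(1)[OF \<tau> cont(2)]
  note [measurable] = meas
  have hp: "(\<integral>\<^sup>+z. ennreal (h z) \<partial>MT) = (\<integral>\<^sup>+z. stopped_low_mean \<tau> ?gp z \<partial>MT)"
    unfolding wiener_hopf_stopped(2)[OF \<tau> cont(1), symmetric] by (intro nn_integral_cong) (simp add: h_def)
  have hn: "(\<integral>\<^sup>+z. ennreal (- h z) \<partial>MT) = (\<integral>\<^sup>+z. stopped_low_mean \<tau> ?gn z \<partial>MT)"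
    unfolding wiener_hopf_stopped(2)[OF \<tau> cont(2), symmetric] by (intro nn_integral_cong) (simp add: h_def)
  have fin: "stopped_low_mean \<tau> ?gp z < \<infinity>" "stopped_low_mean \<tau> ?gn z < \<infinity>" for z
    using low_mean_finite by (auto simp: stopped_low_mean_def)
  have parts: "integrable MT (\<lambda>z. enn2real (u z))" "(\<integral>z. enn2real (u z) \<partial>MT) = enn2real (\<integral>\<^sup>+z. u z \<partial>MT)"
    if u: "u \<in> borel_measurable MT" "\<And>z. u z < \<infinity>" "(\<integral>\<^sup>+z. u z \<partial>MT) < \<infinity>" for u
  proof -
    note [measurable] = u(1)
    have u': "ennreal (enn2real (u z)) = u z" for z using u(2)[of z] by simp
    show "integrable MT (\<lambda>z. enn2real (u z))" by (rule integrableI_nonneg) (use u(3) u' in auto)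
    show "(\<integral>z. enn2real (u z) \<partial>MT) = enn2real (\<integral>\<^sup>+z. u z \<partial>MT)"
      by (subst integral_eq_nn_integral) (use u' in auto)
  qed
  have "(\<integral>\<^sup>+z. ennreal (h z) \<partial>MT) < \<infinity>" "(\<integral>\<^sup>+z. ennreal (- h z) \<partial>MT) < \<infinity>"
    using h by (auto simp: real_integrable_def less_top[symmetric])
  note pint = parts[OF meas(1) fin(1) this(1)[unfolded hp]] and nint = parts[OF meas(2) fin(2) this(2)[unfolded hn]]
  let ?c = "\<lambda>z. if ?A z then c else 0"
  have cint: "integrable MT ?c" by (rule integrable_if) measurable
  have eq: "gain \<tau> = (\<lambda>z. (enn2real (stopped_low_mean \<tau> ?gp z) - enn2real (stopped_low_mean \<tau> ?gn z)) / r - ?c z)"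
    by (auto simp: fun_eq_iff gain_def stopped_low_mean_def K_low_mean)
  show "integrable MT (gain \<tau>)"
    unfolding eq using pint(1) nint(1) cint by auto
  have "(\<integral>z. gain \<tau> z \<partial>MT) = ((\<integral>z. enn2real (stopped_low_mean \<tau> ?gp z) \<partial>MT) - (\<integral>z. enn2real (stopped_low_mean \<tau> ?gn z) \<partial>MT)) / r
      - (\<integral>z. ?c z \<partial>MT)"
    unfolding eq using pint(1) nint(1) cint by simp
  also have "\<dots> = (\<integral>z. h z \<partial>MT) / r - (\<integral>z. ?c z \<partial>MT)"
    by (simp only: pint(2) nint(2) hp hn real_lebesgue_integral_def[OF h])
  also have "\<dots> = (\<integral>z. h z / r - ?c z \<partial>MT)"
    using h cint by simp
  also have "\<dots> = (\<integral>z. (if ?A z then flow z / r - c else 0) \<partial>MT)"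
    by (intro Bochner_Integration.integral_cong) (auto simp: h_def)
  finally show "(\<integral>z. gain \<tau> z \<partial>MT) = (\<integral>z. (if ?A z then flow z / r - c else 0) \<partial>MT)" .
qed

text \<open>The density \<open>r * exp (- r * t)\<close> of the clock absorbs the discounting.\<close>

lemma running_cost_clock:
  assumes \<omega>: "\<omega> \<in> space M"
  shows "(LBINT t:{t. 0 \<le> t \<and> ennreal t \<le> s}. g (X t \<omega>) * exp (- r * t)) =
    (\<integral>t. (if s < ennreal t then 0 else g (X (max 0 t) \<omega>) / r) \<partial>exp_law r)"
proof -
  have "(\<lambda>t. (t, \<omega>)) \<in> borel \<rightarrow>\<^sub>M borel \<Otimes>\<^sub>M M" using \<omega> by measurable
  then have [measurable]: "(\<lambda>t. X (max 0 t) \<omega>) \<in> borel_measurable borel"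
    by (intro X.measurable_path_pair) (use \<omega> in auto)
  have "(\<integral>t. (if s < ennreal t then 0 else g (X (max 0 t) \<omega>) / r) \<partial>exp_law r) =
      (\<integral>t. exponential_density r t *\<^sub>R (if s < ennreal t then 0 else g (X (max 0 t) \<omega>) / r) \<partial>lborel)"
    using exponential_density_nonneg[OF r_pos] by (intro integral_density) auto
  also have "\<dots> = (\<integral>t. indicator {t. 0 \<le> t \<and> ennreal t \<le> s} t *\<^sub>R (g (X t \<omega>) * exp (- r * t)) \<partial>lborel)"
    using r_pos by (intro Bochner_Integration.integral_cong)
      (auto simp: exponential_density_def indicator_def not_less mult.commute)
  finally show ?thesis by (simp add: set_lebesgue_integral_def)
qed

lemma discount_clock: "discount r s = (\<integral>t. (if s < ennreal t then 1 else 0) \<partial>exp_law r)"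
proof -
  have "(\<integral>t. (if s < ennreal t then 1 else 0) \<partial>exp_law r) = (\<integral>t. indicator {t. s < ennreal t} t \<partial>exp_law r)"
    by (intro Bochner_Integration.integral_cong) (auto simp: indicator_def)
  also have "\<dots> = clock.prob {t. s < ennreal t}" by simp
  also have "\<dots> = discount r s"
  proof (cases s)
    case (real a)
    then have "{t. s < ennreal t} = {t. a < t}" by (auto simp: ennreal_less_iff)
    then show ?thesis using real clock_exceeds[of a] by (simp add: discount_def)
  next
    case top
    then show ?thesis by (simp add: discount_def)
  qed
  finally show ?thesis ..
qed

text \<open>The first term is the cost of never stopping. For the second, \<open>gain_integral\<close> exchanges
  \<open>g (X t) / r\<close> for \<open>K\<close> at the running supremum since \<open>\<tau>\<close>.\<close>

theorem cost_eq:
  assumes \<tau>: "stopping_time (nat_filtration M X) \<tau>"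
  shows "cost M X r g c \<tau> = (\<integral>z. flow z / r \<partial>MT) - (\<integral>z. gain \<tau> z \<partial>MT)"
proof -
  note [measurable] = X.stopping_time_measurable[OF \<tau>]
  let ?A = "\<lambda>z. \<tau> (fst z) < ennreal (snd z)"
  define a where "a z = (if ?A z then 0 else flow z / r)" for z
  define b where "b z = (if ?A z then 1 else 0 :: real)" for z
  have fr: "integrable MT (\<lambda>z. flow z / r)" using g_integrable by simp
  have a: "integrable MT a"
  proof -
    have "a = (\<lambda>z. if \<not> ?A z then flow z / r else 0)" by (auto simp: a_def fun_eq_iff)
    then show ?thesis using integrable_if[OF _ fr, of "\<lambda>z. \<not> ?A z"] by simp
  qed
  have b: "integrable MT b" unfolding b_def by (rule integrable_if) measurable
  have "cost M X r g c \<tau> = (\<integral>\<omega>. (\<integral>t. a (\<omega>, t) \<partial>exp_law r) + c * (\<integral>t. b (\<omega>, t) \<partial>exp_law r) \<partial>Mc)"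
    unfolding cost_def
  proof (rule Bochner_Integration.integral_cong[OF refl])
    fix \<omega> assume "\<omega> \<in> space Mc"
    then have \<omega>: "\<omega> \<in> space M" by simp
    show "(LBINT t:{t. 0 \<le> t \<and> ennreal t \<le> \<tau> \<omega>}. g (X t \<omega>) * exp (- r * t)) + c * discount r (\<tau> \<omega>) =
        (\<integral>t. a (\<omega>, t) \<partial>exp_law r) + c * (\<integral>t. b (\<omega>, t) \<partial>exp_law r)"
      unfolding running_cost_clock[OF \<omega>] discount_clock a_def b_def fst_conv snd_conv by (rule refl)
  qed
  also have "\<dots> = (\<integral>\<omega>. (\<integral>t. a (\<omega>, t) \<partial>exp_law r) \<partial>Mc) + c * (\<integral>\<omega>. (\<integral>t. b (\<omega>, t) \<partial>exp_law r) \<partial>Mc)"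
    using MT.integrable_fst'[OF a] MT.integrable_fst'[OF b] by simp
  also have "\<dots> = (\<integral>z. a z \<partial>MT) + c * (\<integral>z. b z \<partial>MT)"
    by (simp only: MT.integral_fst'[OF a] MT.integral_fst'[OF b])
  also have "\<dots> = (\<integral>z. a z + c * b z \<partial>MT)" using a b by simp
  also have "\<dots> = (\<integral>z. flow z / r - (if ?A z then flow z / r - c else 0) \<partial>MT)"
    by (intro Bochner_Integration.integral_cong) (auto simp: a_def b_def)
  also have "\<dots> = (\<integral>z. flow z / r \<partial>MT) - (\<integral>z. (if ?A z then flow z / r - c else 0) \<partial>MT)"
    by (intro Bochner_Integration.integral_diff fr integrable_if) (use fr in \<open>measurable, auto\<close>)
  finally show ?thesis by (simp only: gain_integral(2)[OF \<tau>])
qed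

lemma K_peak_le:
  assumes \<omega>: "\<omega> \<in> space M" and t: "0 \<le> t" and le: "\<And>s. 0 \<le> s \<Longrightarrow> s \<le> t \<Longrightarrow> K (X s \<omega>) \<le> d"
  shows "K (peak X 0 t \<omega>) \<le> d"
proof -
  have "closed {y. K y \<le> d}" by (intro closed_Collect_le K_cont continuous_on_const)
  moreover have "(\<lambda>s. X s \<omega>) ` {0..max 0 t} \<subseteq> {y. K y \<le> d}" using le t by auto
  ultimately have "Sup ((\<lambda>s. X s \<omega>) ` {0..max 0 t}) \<in> {y. K y \<le> d}"
    by (intro closed_subset_contains_Sup cadlag_bdd X.cadlag_path \<omega>) auto
  then show ?thesis by (simp add: peak_def)
qed

abbreviation "gain0 \<equiv> gain (\<lambda>_. 0)"

lemma gain_le: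
  assumes "z \<in> space MT"
  shows "gain \<tau> z \<le> max 0 (gain0 z)"
proof (cases "\<tau> (fst z) < ennreal (snd z)")
  case True
  have \<omega>: "fst z \<in> space M" using assms by (auto simp: space_pair_measure)
  have t: "0 < snd z" using True by (metis ennreal_0 ennreal_neg linorder_not_le not_less_zero)
  have fin: "\<tau> (fst z) < \<infinity>" using True by (metis ennreal_less_top order.strict_trans infinity_ennreal_def)
  define a where "a = enn2real (\<tau> (fst z))"
  have "ennreal a = \<tau> (fst z)" using fin by (simp add: a_def)
  then have a: "0 \<le> a" "a < snd z" using True by (auto simp: a_def ennreal_less_iff[symmetric])
  have "peak X a (snd z) (fst z) \<le> peak X 0 (snd z) (fst z)"
    unfolding peak_def using a t by (intro cSUP_subset_mono cadlag_bdd X.cadlag_path \<omega>) auto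
  then have "K (peak X a (snd z) (fst z)) \<le> K (peak X 0 (snd z) (fst z))" by (rule monoD[OF K_mono])
  then show ?thesis using True t by (auto simp: gain_def a_def[symmetric])
qed (simp add: gain_def)

text \<open>Before the entrance time \<open>K\<close> of the path is below \<open>c\<close>, at the entrance time it is at least \<open>c\<close>.
  Hence \<open>K\<close> at the overall supremum is at most \<open>c\<close> if the clock rings before, and is
  determined by the path after the entrance if it rings later. The clock ringing at the entrance time
  itself is excluded.\<close>

lemma gain_entrance_time:
  assumes z: "z \<in> space MT" and ne: "entrance_time X K c (fst z) \<noteq> ennreal (snd z)"
  shows "gain (entrance_time X K c) z = max 0 (gain0 z)"
proof -
  let ?\<tau> = "entrance_time X K c"
  obtain \<omega> t where zz: "z = (\<omega>, t)" and \<omega>: "\<omega> \<in> space M" using z by (auto simp: space_pair_measure)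
  show ?thesis
  proof (cases "0 < t")
    case False
    then have "ennreal t = 0" by (simp add: ennreal_neg)
    then show ?thesis by (simp add: gain_def zz)
  next
    case t: True
    show ?thesis
    proof (cases "?\<tau> \<omega> < ennreal t")
      case False
      then have "\<not> ?\<tau> \<omega> \<le> ennreal t" using ne by (simp add: zz)
      then have "K (X s \<omega>) \<le> c" if "0 \<le> s" "s \<le> t" for s
        using X.entrance_time_le_iff[OF \<omega> K_cont, of t c] t that by (meson atLeastAtMost_iff less_imp_le linear)
      then have "K (peak X 0 t \<omega>) \<le> c" using t by (intro K_peak_le \<omega>) auto
      then show ?thesis using False t by (simp add: gain_def zz)
    next
      case True
      then have fin: "?\<tau> \<omega> < \<infinity>" by (metis ennreal_less_top order.strict_trans infinity_ennreal_def)
      define a where "a = enn2real (?\<tau> \<omega>)"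
      have ea: "ennreal a = ?\<tau> \<omega>" using fin by (simp add: a_def)
      then have a: "0 \<le> a" "a < t" using True by (auto simp: a_def ennreal_less_iff[symmetric])
      have before: "K (X s \<omega>) < c" if "0 \<le> s" "s < a" for s
      proof (rule ccontr)
        assume "\<not> K (X s \<omega>) < c"
        then have "?\<tau> \<omega> \<le> ennreal s" using X.entrance_time_le_iff[OF \<omega> K_cont that(1), of c] that by (auto simp: not_less)
        then show False using that by (simp add: ea[symmetric] ennreal_le_iff)
      qed
      obtain s where "0 \<le> s" "s \<le> a" "c \<le> K (X s \<omega>)"
        using X.entrance_time_le_iff[OF \<omega> K_cont a(1), of c] ea by auto
      with before[of s] have Ka: "c \<le> K (X a \<omega>)" by (cases "s = a") auto
      let ?p = "peak X a t \<omega>"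
      have "K (X a \<omega>) \<le> K ?p" by (intro monoD[OF K_mono] X.peak_upper \<omega>) (use a in auto)
      with Ka have Kp: "c \<le> K ?p" by simp
      have "K (peak X 0 t \<omega>) \<le> K ?p"
      proof (rule K_peak_le[OF \<omega>])
        fix s assume s: "0 \<le> s" "s \<le> t"
        show "K (X s \<omega>) \<le> K ?p"
        proof (cases "s < a")
          case True then show ?thesis using before[OF s(1) True] Kp by simp
        next
          case False then show ?thesis by (intro monoD[OF K_mono] X.peak_upper \<omega>) (use a s in auto)
        qed
      qed (use t in simp)
      moreover have "gain ?\<tau> z \<le> max 0 (gain0 z)" by (rule gain_le[OF z])
      ultimately show ?thesis using True t Kp by (auto simp: gain_def zz a_def[symmetric])
    qed
  qed
qed

lemma AE_gain_entrance_time: "AE z in MT. gain (entrance_time X K c) z = max 0 (gain0 z)"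
proof -
  let ?\<tau> = "entrance_time X K c"
  note [measurable] = X.stopping_time_measurable[OF X.stopping_time_entrance_time[OF K_cont K_mono]]
  have "AE z in MT. ?\<tau> (fst z) \<noteq> ennreal (snd z)"
  proof (rule MT.AE_pair_measure)
    show "{z \<in> space MT. ?\<tau> (fst z) \<noteq> ennreal (snd z)} \<in> sets MT" by measurable
    have ne: "AE t in exp_law r. t \<noteq> enn2real s" for s
      using AE_lborel_singleton[of "enn2real s"] by (auto simp: AE_density elim!: eventually_mono)
    show "AE \<omega> in Mc. AE t in exp_law r. ?\<tau> (fst (\<omega>, t)) \<noteq> ennreal (snd (\<omega>, t))"
    proof (rule AE_I2)
      fix \<omega>
      show "AE t in exp_law r. ?\<tau> (fst (\<omega>, t)) \<noteq> ennreal (snd (\<omega>, t))"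
        using ne[of "?\<tau> \<omega>"] AE_clock_pos by eventually_elim auto
    qed
  qed
  moreover have "AE z in MT. z \<in> space MT" by simp
  ultimately show ?thesis by eventually_elim (rule gain_entrance_time)
qed

lemma stopping_time_0: "stopping_time (nat_filtration M X) (\<lambda>_. 0)"
  by (rule stopping_time_const)

lemma integrable_gain0: "integrable MT gain0"
  by (rule gain_integral(1)[OF stopping_time_0])

lemma entrance_time_optimal:
  assumes \<tau>: "stopping_time (nat_filtration M X) \<tau>"
  shows "cost M X r g c (entrance_time X K c) \<le> cost M X r g c \<tau>"
    and "cost M X r g c (entrance_time X K c) = (\<integral>z. flow z / r \<partial>MT) - (\<integral>z. max 0 (gain0 z) \<partial>MT)"
proof -
  let ?\<tau> = "entrance_time X K c"
  have st: "stopping_time (nat_filtration M X) ?\<tau>" by (rule X.stopping_time_entrance_time[OF K_cont K_mono])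
  have m: "integrable MT (\<lambda>z. max 0 (gain0 z))" using integrable_gain0 by auto
  have "(\<integral>z. gain ?\<tau> z \<partial>MT) = (\<integral>z. max 0 (gain0 z) \<partial>MT)"
    using AE_gain_entrance_time gain_integral(1)[OF st] m by (intro integral_cong_AE) auto
  then show eq: "cost M X r g c ?\<tau> = (\<integral>z. flow z / r \<partial>MT) - (\<integral>z. max 0 (gain0 z) \<partial>MT)"
    by (simp add: cost_eq[OF st])
  have "(\<integral>z. gain \<tau> z \<partial>MT) \<le> (\<integral>z. max 0 (gain0 z) \<partial>MT)"
    by (rule integral_mono[OF gain_integral(1)[OF \<tau>] m gain_le])
  then show "cost M X r g c ?\<tau> \<le> cost M X r g c \<tau>"
    by (simp add: eq cost_eq[OF \<tau>])
qed

lemma cost_0: "cost M X r g c (\<lambda>_. 0) = c"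
proof -
  have "{t::real. 0 \<le> t \<and> ennreal t \<le> 0} = {0}" by (auto simp: ennreal_eq_0_iff)
  moreover have "(LBINT t:{0}. h t) = 0" for h :: "real \<Rightarrow> real"
    unfolding set_lebesgue_integral_def
    by (rule integral_eq_zero_AE) (use AE_lborel_singleton[of 0] in \<open>auto elim!: eventually_mono\<close>)
  ultimately have "cost M X r g c (\<lambda>_. 0) = (\<integral>\<omega>. c \<partial>Mc)"
    unfolding cost_def discount_def by simp
  then show ?thesis using Mc.prob_space by simp
qed

text \<open>The difference \<open>c - V\<close> is the cost of stopping at once minus the optimal cost, that is, the mean of
  the negative part of \<open>gain0\<close>.\<close>

theorem optimal_value:
  defines "V \<equiv> INF \<tau>\<in>{\<tau>. stopping_time (nat_filtration M X) \<tau>}. cost M X r g c \<tau>"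
  shows "cost M X r g c (entrance_time X K c) = V"
    and "V \<le> c" and "V = c \<longleftrightarrow> c \<le> K x"
proof -
  let ?\<tau> = "entrance_time X K c"
  have st: "stopping_time (nat_filtration M X) ?\<tau>" by (rule X.stopping_time_entrance_time[OF K_cont K_mono])
  show V: "cost M X r g c ?\<tau> = V"
    unfolding V_def by (rule cInf_eq_minimum[symmetric]) (use st entrance_time_optimal(1) in auto)
  show "V \<le> c"
    using entrance_time_optimal(1)[OF stopping_time_0] by (simp add: V cost_0)
  define loss where "loss z = max 0 (- gain0 z)" for z
  have li: "integrable MT loss" unfolding loss_def using integrable_gain0 by auto
  have "c - V = (\<integral>z. max 0 (gain0 z) \<partial>MT) - (\<integral>z. gain0 z \<partial>MT)"
    using cost_eq[OF stopping_time_0] entrance_time_optimal(2)[OF stopping_time_0] by (simp add: V cost_0)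
  also have "\<dots> = (\<integral>z. max 0 (gain0 z) - gain0 z \<partial>MT)"
    using integrable_gain0 by (intro Bochner_Integration.integral_diff[symmetric]) auto
  also have "\<dots> = (\<integral>z. loss z \<partial>MT)"
    by (intro Bochner_Integration.integral_cong) (auto simp: loss_def max_def)
  finally have cV: "c - V = (\<integral>z. loss z \<partial>MT)" .
  have zero_iff: "(\<integral>z. loss z \<partial>MT) = 0 \<longleftrightarrow> (AE z in MT. loss z = 0)"
    by (rule integral_nonneg_eq_0_iff_AE[OF li]) (simp add: loss_def)
  show "V = c \<longleftrightarrow> c \<le> K x"
  proof
    assume "c \<le> K x"
    have "AE z in MT. loss z = 0"
    proof (rule MT.AE_pair_measure)
      have [measurable]: "loss \<in> borel_measurable MT" using li by simp
      show "{z \<in> space MT. loss z = 0} \<in> sets MT" by measurable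
      show "AE \<omega> in Mc. AE t in exp_law r. loss (\<omega>, t) = 0"
        using AE_start
      proof eventually_elim
        case (elim \<omega>)
        show ?case
        proof (rule AE_I2)
          fix t
          show "loss (\<omega>, t) = 0"
          proof (cases "0 < t")
            case True
            have "x \<le> peak X 0 t \<omega>" using X.peak_upper[of \<omega> 0 0 t] elim True by simp
            then have "c \<le> K (peak X 0 t \<omega>)" using monoD[OF K_mono] \<open>c \<le> K x\<close> by (meson order_trans)
            then show ?thesis by (simp add: loss_def gain_def)
          next
            case False
            then have "ennreal t = 0" by (simp add: ennreal_neg)
            then show ?thesis by (simp add: loss_def gain_def)
          qed
        qed
      qed
    qed
    then show "V = c" using cV zero_iff by simp
  next
    assume "V = c"
    then have AE0: "AE z in MT. loss z = 0" using cV zero_iff by simp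
    show "c \<le> K x"
    proof (rule ccontr)
      assume "\<not> c \<le> K x"
      then have "K x < c" by simp
      have "((\<lambda>y. K y) \<longlongrightarrow> K x) (at_right x)"
        using K_cont by (auto simp: continuous_on_def intro: tendsto_within_subset)
      then have "\<forall>\<^sub>F y in at_right x. K y < c" using \<open>K x < c\<close> by (rule order_tendstoD(2))
      then obtain b where b: "x < b" "\<And>y. x < y \<Longrightarrow> y < b \<Longrightarrow> K y < c"
        using eventually_at_right[of x "x+1"] by auto
      define d where "d = (b - x) / 2"
      have d: "0 < d" "K (x + d) < c" using b(1) b(2)[of "x + d"] by (auto simp: d_def field_simps)
      have "AE \<omega> in Mc. \<exists>e>0. \<forall>t. 0 < t \<longrightarrow> t < e \<longrightarrow> loss (\<omega>, t) \<noteq> 0"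
        using peak_near_start[OF d(1)]
      proof eventually_elim
        case (elim \<omega>)
        then obtain e where e: "0 < e" "\<And>t. 0 < t \<Longrightarrow> t < e \<Longrightarrow> peak X 0 t \<omega> \<le> x + d" by blast
        have "loss (\<omega>, t) \<noteq> 0" if "0 < t" "t < e" for t
        proof -
          have "K (peak X 0 t \<omega>) < c" using monoD[OF K_mono e(2)[OF that]] d(2) by simp
          then show ?thesis using that by (simp add: loss_def gain_def max_def)
        qed
        then show ?case using e(1) by blast
      qed
      then show False using not_AE_near_start[of "\<lambda>z. loss z \<noteq> 0"] AE0 by simp
    qed
  qed
qed

end

section \<open>The running infimum at an exponential time\<close>

lemma measurable_sample_path:
  assumes "\<And>t. 0 \<le> t \<Longrightarrow> X t \<in> borel_measurable M"
  shows "sample_path X \<in> M \<rightarrow>\<^sub>M path_space"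
  unfolding sample_path_def[abs_def] path_space_def by (rule measurable_restrict) (use assms in auto)

lemma measurable_path_space_eval: "0 \<le> t \<Longrightarrow> (\<lambda>p. p t) \<in> borel_measurable path_space"
  unfolding path_space_def by (rule measurable_component_singleton) simp

lemma step_law_path:
  assumes "\<And>t. 0 \<le> t \<Longrightarrow> X t \<in> borel_measurable M"
  shows "step_law M X m = distr (distr M path_space (sample_path X)) borel (\<lambda>p. p (mesh m) - p 0)"
proof -
  have "(\<lambda>p. p (mesh m) - p 0) \<in> borel_measurable path_space"
    by (intro borel_measurable_diff measurable_path_space_eval) auto
  then show ?thesis
    unfolding step_law_def by (subst distr_distr[OF _ measurable_sample_path[OF assms]])
      (auto simp: comp_def sample_path_def)
qed

text \<open>The running infimum as a measurable function of the path and the time. Evaluation of a path at a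
  variable time is not measurable on the product space, so the infimum is built from fixed grid times;
  on cadlag paths the limit exists and is the infimum.\<close>

definition path_low :: "(real \<Rightarrow> real) \<Rightarrow> real \<Rightarrow> real" where
  "path_low p t = lim (\<lambda>m. Min ((\<lambda>i. p (real i * mesh m)) ` {..next_idx m t}))"

lemma measurable_path_low:
  "(\<lambda>z. path_low (snd z) (fst z)) \<in> borel_measurable (borel \<Otimes>\<^sub>M path_space)"
  unfolding path_low_def
proof (rule borel_measurable_lim_metric)
  fix m
  have [measurable]: "(\<lambda>z. snd z (real i * mesh m)) \<in> borel_measurable (borel \<Otimes>\<^sub>M path_space)" for i
    by (rule measurable_compose[OF measurable_snd measurable_path_space_eval]) simp
  show "(\<lambda>z. Min ((\<lambda>i. snd z (real i * mesh m)) ` {..next_idx m (fst z)})) \<in> borel_measurable (borel \<Otimes>\<^sub>M path_space)"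
    by (rule measurable_compose_countable[where f = "\<lambda>n z. Min ((\<lambda>i. snd z (real i * mesh m)) ` {..n})"
          and g = "\<lambda>z. next_idx m (fst z)"]) measurable
qed

lemma path_low_sample_path:
  assumes "cadlag (\<lambda>t. X t \<omega>)"
  shows "path_low (sample_path X \<omega>) t = low X t \<omega>"
  using limI[OF grid_low[where X = X and \<omega> = \<omega> and t = t, OF assms]] by (simp add: path_low_def sample_path_def)

lemma indep_rv_distr:
  assumes M: "prob_space M" and ind: "indep_rv M N Y L Z"
  shows "distr M N Y \<Otimes>\<^sub>M distr M L Z = distr M (N \<Otimes>\<^sub>M L) (\<lambda>\<omega>. (Y \<omega>, Z \<omega>))"
proof -
  interpret M: prob_space M by (rule M)
  have Y: "Y \<in> M \<rightarrow>\<^sub>M N" and Z: "Z \<in> M \<rightarrow>\<^sub>M L" using ind by (auto simp: indep_rv_def)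
  interpret Y: prob_space "distr M N Y" by (rule M.prob_space_distr[OF Y])
  interpret Z: prob_space "distr M L Z" by (rule M.prob_space_distr[OF Z])
  show ?thesis
  proof (rule pair_measure_eqI[OF Y.sigma_finite_measure_axioms Z.sigma_finite_measure_axioms])
    show "sets (distr M N Y \<Otimes>\<^sub>M distr M L Z) = sets (distr M (N \<Otimes>\<^sub>M L) (\<lambda>\<omega>. (Y \<omega>, Z \<omega>)))"
      by (simp cong: sets_pair_measure_cong)
    fix A B assume "A \<in> sets (distr M N Y)" "B \<in> sets (distr M L Z)"
    then have A: "A \<in> sets N" and B: "B \<in> sets L" by auto
    have "M.prob ((Y -` A \<inter> space M) \<inter> (Z -` B \<inter> space M)) = M.prob (Y -` A \<inter> space M) * M.prob (Z -` B \<inter> space M)"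
      by (rule M.indep_setD) (use ind A B in \<open>auto simp: indep_rv_def\<close>)
    moreover have "(\<lambda>\<omega>. (Y \<omega>, Z \<omega>)) -` (A \<times> B) \<inter> space M = (Y -` A \<inter> space M) \<inter> (Z -` B \<inter> space M)" by auto
    moreover have "(\<lambda>\<omega>. (Y \<omega>, Z \<omega>)) \<in> M \<rightarrow>\<^sub>M N \<Otimes>\<^sub>M L" by (rule measurable_Pair[OF Y Z])
    ultimately show "emeasure (distr M N Y) A * emeasure (distr M L Z) B = emeasure (distr M (N \<Otimes>\<^sub>M L) (\<lambda>\<omega>. (Y \<omega>, Z \<omega>))) (A \<times> B)"
      using A B Y Z by (simp add: emeasure_distr M.emeasure_eq_measure ennreal_mult)
  qed
qed

context levy_pair begin

text \<open>Independence of the clock and the path permits integrating out the path first.\<close>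

lemma low_mean_eq_random_time:
  assumes T: "distributed M' lborel T (exponential_density r)"
    and ind: "indep_rv M' borel T path_space (sample_path X')"
    and f [measurable]: "f \<in> borel_measurable borel"
  shows "(\<integral>\<^sup>+\<omega>. f (y + low X' (T \<omega>) \<omega>) \<partial>M') = low_mean f y"
proof -
  let ?p = "distr M' path_space (sample_path X')"
  have Tm: "T \<in> M' \<rightarrow>\<^sub>M borel" and pm: "sample_path X' \<in> M' \<rightarrow>\<^sub>M path_space"
    using ind by (auto simp: indep_rv_def)
  have TL: "distr M' borel T = exp_law r"
    using T unfolding distributed_def by (metis distr_cong sets_lborel)
  interpret p: prob_space ?p by (rule X'.prob_space_distr[OF pm])
  note [measurable] = measurable_path_low
  define F where "F z = f (y + path_low (snd z) (fst z))" for z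
  have F [measurable]: "F \<in> borel_measurable (borel \<Otimes>\<^sub>M path_space)" unfolding F_def by measurable
  have F': "F \<in> borel_measurable (exp_law r \<Otimes>\<^sub>M ?p)"
    using F by (simp cong: measurable_cong_sets sets_pair_measure_cong)
  have F_path: "F (t, sample_path X' \<omega>) = f (y + low X' t \<omega>)" if "\<omega> \<in> space M'" for t \<omega>
    by (simp add: F_def path_low_sample_path[where X = X' and \<omega> = \<omega>, OF X'.cadlag_path[OF that]])
  have "(\<integral>\<^sup>+\<omega>. f (y + low X' (T \<omega>) \<omega>) \<partial>M') = (\<integral>\<^sup>+\<omega>. F (T \<omega>, sample_path X' \<omega>) \<partial>M')"
    by (intro nn_integral_cong) (simp add: F_path)
  also have "\<dots> = (\<integral>\<^sup>+z. F z \<partial>distr M' (borel \<Otimes>\<^sub>M path_space) (\<lambda>\<omega>. (T \<omega>, sample_path X' \<omega>)))"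
    by (rule nn_integral_distr[symmetric]) (use Tm pm F in auto)
  also have "\<dots> = (\<integral>\<^sup>+z. F z \<partial>(exp_law r \<Otimes>\<^sub>M ?p))"
    unfolding indep_rv_distr[OF X'.prob_space_axioms ind, symmetric] TL ..
  also have "\<dots> = (\<integral>\<^sup>+t. \<integral>\<^sup>+p. F (t, p) \<partial>?p \<partial>exp_law r)"
    by (rule p.nn_integral_fst[OF F', symmetric])
  also have "\<dots> = (\<integral>\<^sup>+t. \<integral>\<^sup>+\<omega>. F (t, sample_path X' \<omega>) \<partial>M' \<partial>exp_law r)"
  proof (rule nn_integral_cong)
    fix t
    have "(\<lambda>p. F (t, p)) \<in> borel_measurable path_space"
      by (rule measurable_compose[OF _ F]) measurable
    then show "(\<integral>\<^sup>+p. F (t, p) \<partial>?p) = (\<integral>\<^sup>+\<omega>. F (t, sample_path X' \<omega>) \<partial>M')"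
      by (subst nn_integral_distr[OF pm]) auto
  qed
  also have "\<dots> = low_mean f y"
    unfolding low_mean_def by (intro nn_integral_cong) (simp add: F_path)
  finally show ?thesis .
qed

lemma low_le_start: "\<omega> \<in> space M' \<Longrightarrow> low X' t \<omega> \<le> X' 0 \<omega>"
  unfolding low_def by (rule cINF_lower) (auto intro!: cadlag_bdd X'.cadlag_path)

lemma low_mean_le_of_mono:
  assumes "\<And>y y'. y \<le> y' \<Longrightarrow> f y \<le> f y'"
  shows "low_mean f y \<le> f y"
proof -
  have "(\<integral>\<^sup>+\<omega>. f (y + low X' t \<omega>) \<partial>M') \<le> (\<integral>\<^sup>+\<omega>. f y \<partial>M')" for t
  proof (rule nn_integral_mono_AE)
    show "AE \<omega> in M'. f (y + low X' t \<omega>) \<le> f y"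
      using X'.start AE_space
    proof eventually_elim
      case (elim \<omega>)
      then show ?case using low_le_start[of \<omega> t] by (intro assms) simp
    qed
  qed
  then have "low_mean f y \<le> (\<integral>\<^sup>+t. f y \<partial>exp_law r)"
    unfolding low_mean_def by (intro nn_integral_mono) (simp add: X'.emeasure_space_1)
  then show ?thesis by (simp add: clock.emeasure_space_1[simplified])
qed

lemma resolvent_integrable:
  assumes g: "g \<in> borel_measurable borel" and fin: "resolvent_finite M X r g"
  shows "integrable MT (\<lambda>z. g (X (max 0 (snd z)) (fst z)))"
proof (rule integrableI_bounded)
  note [measurable] = g
  show m: "(\<lambda>z. g (X (max 0 (snd z)) (fst z))) \<in> borel_measurable MT" by measurable
  let ?h = "\<lambda>\<omega> t. ennreal (norm (indicator (space M \<times> {0..}) (\<omega>, t) *\<^sub>R (g (X t \<omega>) * exp (- r * t))))"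
  have "set_integrable (M \<Otimes>\<^sub>M lborel) (space M \<times> {0..}) (\<lambda>z. g (X (snd z) (fst z)) * exp (- r * snd z))"
    using fin by (simp add: resolvent_finite_def case_prod_beta')
  then have int: "integrable (M \<Otimes>\<^sub>M lborel) (\<lambda>z. indicator (space M \<times> {0..}) z *\<^sub>R (g (X (snd z) (fst z)) * exp (- r * snd z)))"
    by (simp add: set_integrable_def)
  have eq: "ennreal (exponential_density r t) * ennreal (norm (g (X (max 0 t) \<omega>))) = ennreal r * ?h \<omega> t"
    if "\<omega> \<in> space M" for \<omega> t
    using that r_pos by (auto simp: exponential_density_def indicator_def abs_mult ennreal_mult[symmetric] mult_ac)
  have "(\<integral>\<^sup>+z. ennreal (norm (g (X (max 0 (snd z)) (fst z)))) \<partial>MT) =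
      (\<integral>\<^sup>+\<omega>. \<integral>\<^sup>+t. ennreal (norm (g (X (max 0 t) \<omega>))) \<partial>exp_law r \<partial>Mc)"
    by (subst clock.nn_integral_fst[symmetric]) (use m in auto)
  also have "\<dots> = (\<integral>\<^sup>+\<omega>. \<integral>\<^sup>+t. ennreal (norm (g (X (max 0 t) \<omega>))) \<partial>exp_law r \<partial>M)"
    by (rule nn_integral_completion)
  also have "\<dots> = (\<integral>\<^sup>+\<omega>. \<integral>\<^sup>+t. ennreal r * ?h \<omega> t \<partial>lborel \<partial>M)"
  proof (rule nn_integral_cong)
    fix \<omega> assume \<omega>: "\<omega> \<in> space M"
    have [measurable]: "(\<lambda>t. X (max 0 t) \<omega>) \<in> borel_measurable borel"
      by (intro X.measurable_path_pair) (use \<omega> in auto)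
    have "(\<integral>\<^sup>+t. ennreal (norm (g (X (max 0 t) \<omega>))) \<partial>exp_law r) =
        (\<integral>\<^sup>+t. ennreal (exponential_density r t) * ennreal (norm (g (X (max 0 t) \<omega>))) \<partial>lborel)"
      by (rule nn_integral_density) auto
    then show "(\<integral>\<^sup>+t. ennreal (norm (g (X (max 0 t) \<omega>))) \<partial>exp_law r) = (\<integral>\<^sup>+t. ennreal r * ?h \<omega> t \<partial>lborel)"
      by (simp only: eq[OF \<omega>])
  qed
  also have "\<dots> = (\<integral>\<^sup>+z. ennreal r * ?h (fst z) (snd z) \<partial>(M \<Otimes>\<^sub>M lborel))"
    using int by (subst lborel.nn_integral_fst[symmetric]) (auto dest!: borel_measurable_integrable)
  also have "\<dots> = ennreal r * (\<integral>\<^sup>+z. ?h (fst z) (snd z) \<partial>(M \<Otimes>\<^sub>M lborel))"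
    using int by (intro nn_integral_cmult) (auto dest!: borel_measurable_integrable)
  also have "\<dots> < \<infinity>"
    using int by (simp add: integrable_iff_bounded ennreal_mult_less_top)
  finally show "(\<integral>\<^sup>+z. ennreal (norm (g (X (max 0 (snd z)) (fst z)))) \<partial>MT) < \<infinity>" .
qed

end

text \<open>By monotonicity, \<open>g (y + J)\<close> lies between \<open>g (l - 1 + J)\<close> and \<open>g (l + 1 + J)\<close> for \<open>y\<close> near \<open>l\<close>, which
  gives an integrable dominating function.\<close>

lemma integrable_translates:
  fixes g :: "real \<Rightarrow> real" and J :: "'a \<Rightarrow> real"
  assumes g: "continuous_on UNIV g" and mono: "mono g"
    and int: "\<And>y. integrable N (\<lambda>\<omega>. g (y + J \<omega>))"
  shows "continuous_on UNIV (\<lambda>y. \<integral>\<omega>. g (y + J \<omega>) \<partial>N)" and "mono (\<lambda>y. \<integral>\<omega>. g (y + J \<omega>) \<partial>N)"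
proof -
  show "mono (\<lambda>y. \<integral>\<omega>. g (y + J \<omega>) \<partial>N)"
    by (intro monoI integral_mono int monoD[OF mono]) simp
  show "continuous_on UNIV (\<lambda>y. \<integral>\<omega>. g (y + J \<omega>) \<partial>N)"
  proof (rule continuous_at_imp_continuous_on, rule ballI)
    fix l :: real
    show "isCont (\<lambda>y. \<integral>\<omega>. g (y + J \<omega>) \<partial>N) l"
    proof (rule continuous_at_sequentiallyI)
      fix y :: "nat \<Rightarrow> real" assume y: "y \<longlonglongrightarrow> l"
      obtain n0 where n0: "\<And>n. n0 \<le> n \<Longrightarrow> dist (y n) l < 1"
        using tendstoD[OF y, of 1] by (auto simp: eventually_sequentially)
      have "(\<lambda>n. \<integral>\<omega>. g (y (n + n0) + J \<omega>) \<partial>N) \<longlonglongrightarrow> (\<integral>\<omega>. g (l + J \<omega>) \<partial>N)"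
      proof (rule integral_dominated_convergence[where w = "\<lambda>\<omega>. \<bar>g (l - 1 + J \<omega>)\<bar> + \<bar>g (l + 1 + J \<omega>)\<bar>"])
        show "integrable N (\<lambda>\<omega>. \<bar>g (l - 1 + J \<omega>)\<bar> + \<bar>g (l + 1 + J \<omega>)\<bar>)"
          using int by auto
        have y': "(\<lambda>n. y (n + n0)) \<longlonglongrightarrow> l" using y by (rule LIMSEQ_ignore_initial_segment)
        show "AE \<omega> in N. (\<lambda>n. g (y (n + n0) + J \<omega>)) \<longlonglongrightarrow> g (l + J \<omega>)"
          by (intro AE_I2 continuous_on_tendsto_compose[OF g] tendsto_intros y') auto
        fix n
        have d: "l - 1 \<le> y (n + n0)" "y (n + n0) \<le> l + 1"
          using n0[of "n + n0"] by (auto simp: dist_real_def)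
        have "\<bar>g (y (n + n0) + J \<omega>)\<bar> \<le> \<bar>g (l - 1 + J \<omega>)\<bar> + \<bar>g (l + 1 + J \<omega>)\<bar>" for \<omega>
          using monoD[OF mono, of "l - 1 + J \<omega>" "y (n + n0) + J \<omega>"] monoD[OF mono, of "y (n + n0) + J \<omega>" "l + 1 + J \<omega>"] d
          by simp
        then show "AE \<omega> in N. norm (g (y (n + n0) + J \<omega>)) \<le> \<bar>g (l - 1 + J \<omega>)\<bar> + \<bar>g (l + 1 + J \<omega>)\<bar>"
          by simp
      qed (use int in auto)
      then show "(\<lambda>n. \<integral>\<omega>. g (y n + J \<omega>) \<partial>N) \<longlonglongrightarrow> (\<integral>\<omega>. g (l + J \<omega>) \<partial>N)"
        by (rule LIMSEQ_offset)
    qed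
  qed
qed

theorem corollary12:
  fixes P :: "real \<Rightarrow> 'a measure"
    and X X' :: "real \<Rightarrow> 'a \<Rightarrow> real"
    and T' :: "'a \<Rightarrow> real"
    and r c :: real
    and g \<kappa> :: "real \<Rightarrow> real"
  assumes "r > 0"
    and "levy_family P X"
    and "independent_copy (P 0) X X'"
    and "distributed (P 0) lborel T' (exponential_density r)"
    and "indep_rv (P 0) borel T'
           (path_space \<Otimes>\<^sub>M path_space) (\<lambda>\<omega>. (sample_path X \<omega>, sample_path X' \<omega>))"
    and "continuous_on UNIV g"
    and "mono g"
    and "\<And>x. resolvent_finite (P x) X r g"
  defines "\<kappa> \<equiv> kappa (P 0) X' T' r g"
  shows "stopping_region P X r g c = {x. \<kappa> x \<ge> c} \<and>
         continuation_region P X r g c = {x. \<kappa> x < c} \<and>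
         optimal_stopping_time P X r g c (entrance_time X \<kappa> c)"
proof -
  have fam: "levy_process (P x) X" "AE \<omega> in P x. X 0 \<omega> = x"
    "distr (P x) path_space (sample_path X) = distr (P 0) path_space (sample_path (\<lambda>t \<omega>. x + X t \<omega>))" for x
    using assms(2) by (auto simp: levy_family_def)
  have copy: "levy_process (P 0) X'"
    "distr (P 0) path_space (sample_path X') = distr (P 0) path_space (sample_path X)"
    using assms(3) by (auto simp: independent_copy_def)
  have pr: "prob_space (P x)" for x using fam(1) by (simp add: levy_process_def)
  have X: "levy_from (P x) X x" for x
    by (intro levy_from.intro levy_from_axioms.intro pr fam)
  have mX: "X t \<in> borel_measurable (P x)" if "0 \<le> t" for x t by (rule levy_from.measurable_X[OF X that])
  have mX': "X' t \<in> borel_measurable (P 0)" if "0 \<le> t" for t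
    using copy(1) that by (simp add: levy_process_def)
  have sX: "sample_path X \<in> P x \<rightarrow>\<^sub>M path_space" for x
    by (rule measurable_sample_path) (rule mX)
  have sX': "sample_path X' \<in> P 0 \<rightarrow>\<^sub>M path_space"
    by (rule measurable_sample_path) (rule mX')
  have X'0: "AE \<omega> in P 0. X' 0 \<omega> = 0"
  proof -
    have [measurable]: "(\<lambda>p. p 0) \<in> borel_measurable path_space" by (rule measurable_path_space_eval) simp
    have "AE p in distr (P 0) path_space (sample_path X). p 0 = 0"
      using fam(2)[of 0] by (subst AE_distr_iff[OF sX]) (auto simp: sample_path_def)
    then have "AE p in distr (P 0) path_space (sample_path X'). p 0 = 0" by (simp only: copy(2))
    then show ?thesis by (subst (asm) AE_distr_iff[OF sX']) (auto simp: sample_path_def)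
  qed
  have X': "levy_from (P 0) X' 0"
    by (intro levy_from.intro levy_from_axioms.intro pr copy X'0)
  (* Adding the constant x does not change the increments. *)
  have law: "step_law (P x) X m = step_law (P 0) X' m" for x m
  proof -
    have "step_law (P x) X m = step_law (P 0) (\<lambda>t \<omega>. x + X t \<omega>) m"
      using mX by (subst (1 2) step_law_path) (auto simp: fam(3)[of x])
    also have "\<dots> = step_law (P 0) X m" by (simp add: step_law_def)
    also have "\<dots> = step_law (P 0) X' m"
      using mX mX' by (subst (1 2) step_law_path) (auto simp: copy(2))
    finally show ?thesis .
  qed
  have clock: "exp_clock r" using assms(1) by unfold_locales
  have pair: "levy_pair (P x) X x (P 0) X' r" for x
    by (intro levy_pair.intro levy_pair_axioms.intro X X' clock law)
  interpret L0: levy_pair "P 0" X 0 "P 0" X' r by (rule pair)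

  have ind: "indep_rv (P 0) borel T' path_space (sample_path X')"
    unfolding indep_rv_def
  proof (intro conjI)
    show T'm: "T' \<in> borel_measurable (P 0)" using assms(5) by (simp add: indep_rv_def)
    have joint: "L0.X.indep_set {T' -` A \<inter> space (P 0) |A. A \<in> sets borel}
      {(\<lambda>\<omega>. (sample_path X \<omega>, sample_path X' \<omega>)) -` B \<inter> space (P 0) |B. B \<in> sets (path_space \<Otimes>\<^sub>M path_space)}"
      using assms(5) by (simp add: indep_rv_def)
    have sub: "{sample_path X' -` B \<inter> space (P 0) |B. B \<in> sets path_space} \<subseteq>
      {(\<lambda>\<omega>. (sample_path X \<omega>, sample_path X' \<omega>)) -` B \<inter> space (P 0) |B. B \<in> sets (path_space \<Otimes>\<^sub>M path_space)}"
    proof safe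
      fix B assume B: "B \<in> sets (path_space :: (real \<Rightarrow> real) measure)"
      have "sample_path X \<omega> \<in> space path_space" if "\<omega> \<in> space (P 0)" for \<omega>
        by (rule measurable_space[OF sX that])
      then have "sample_path X' -` B \<inter> space (P 0) =
        (\<lambda>\<omega>. (sample_path X \<omega>, sample_path X' \<omega>)) -` (space path_space \<times> B) \<inter> space (P 0)" by auto
      then show "\<exists>Ba. sample_path X' -` B \<inter> space (P 0) =
        (\<lambda>\<omega>. (sample_path X \<omega>, sample_path X' \<omega>)) -` Ba \<inter> space (P 0) \<and> Ba \<in> sets (path_space \<Otimes>\<^sub>M path_space)"
        using B by (intro exI[of _ "space path_space \<times> B"]) auto
    qed
    show "L0.X.indep_set {T' -` A \<inter> space (P 0) |A. A \<in> sets borel}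
      {sample_path X' -` B \<inter> space (P 0) |B. B \<in> sets path_space}"
    proof (rule L0.X.indep_setI)
      show "{T' -` A \<inter> space (P 0) |A. A \<in> sets borel} \<subseteq> L0.X.events"
        by (auto intro: measurable_sets[OF T'm])
      show "{sample_path X' -` B \<inter> space (P 0) |B. B \<in> sets path_space} \<subseteq> L0.X.events"
        by (auto intro: measurable_sets[OF sX'])
      fix a b
      assume a: "a \<in> {T' -` A \<inter> space (P 0) |A. A \<in> sets borel}"
        and b: "b \<in> {sample_path X' -` B \<inter> space (P 0) |B. B \<in> sets path_space}"
      show "L0.X.prob (a \<inter> b) = L0.X.prob a * L0.X.prob b"
        by (rule L0.X.indep_setD[OF joint a subsetD[OF sub b]])
    qed
  qed (rule sX')

  have gm [measurable]: "g \<in> borel_measurable borel" by (rule borel_measurable_continuous_onI[OF assms(6)])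
  have Tm [measurable]: "T' \<in> borel_measurable (P 0)" using ind by (simp add: indep_rv_def)
  define J where "J \<omega> = low X' (T' \<omega>) \<omega>" for \<omega>
  have Jm [measurable]: "J \<in> borel_measurable (P 0)" unfolding J_def by measurable
  note low_mean_J = L0.low_mean_eq_random_time[OF assms(4) ind, folded J_def]

  have flow: "integrable (completion (P x) \<Otimes>\<^sub>M exp_law r) (\<lambda>z. g (X (max 0 (snd z)) (fst z)))" for x
    by (rule levy_pair.resolvent_integrable[OF pair gm assms(8)])
  have low_mean_p: "L0.low_mean (\<lambda>y. ennreal (g y)) y < \<infinity>" for y
  proof -
    have "L0.low_mean (\<lambda>y. ennreal (g y)) y \<le> ennreal (g y)"
      by (intro L0.low_mean_le_of_mono ennreal_leI monoD[OF assms(7)])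
    then show ?thesis by (rule le_less_trans) simp
  qed
  (* The process started in y - 1 stays below y for a short while. *)
  have low_mean_n: "L0.low_mean (\<lambda>y. ennreal (- g y)) y < \<infinity>" for y
  proof -
    have "(\<integral>\<^sup>+z. ennreal (- g (X (max 0 (snd z)) (fst z))) \<partial>(completion (P (y - 1)) \<Otimes>\<^sub>M exp_law r)) < \<infinity>"
      using flow[of "y - 1"] by (simp add: real_integrable_def less_top[symmetric])
    then have "levy_pair.low_mean (P 0) X' r (\<lambda>y. ennreal (- g y)) (y - 1 + 1) < \<infinity>"
      by (intro levy_pair.low_mean_finite_above_start[OF pair] continuous_on_ennreal continuous_on_minus assms(6))
         (auto intro!: ennreal_leI monoD[OF assms(7)])
    then show ?thesis by simp
  qed
  have g_int: "integrable (P 0) (\<lambda>\<omega>. g (y + J \<omega>))" for y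
    using low_mean_J[of "\<lambda>y. ennreal (g y)" y] low_mean_J[of "\<lambda>y. ennreal (- g y)" y] low_mean_p[of y] low_mean_n[of y]
    by (simp add: real_integrable_def less_top[symmetric])
  (* For negative t the running infimum is Inf {}, where J differs from it. *)
  have kappa_J: "\<kappa> y = (\<integral>\<omega>. g (y + J \<omega>) \<partial>P 0) / r" for y
  proof -
    have T'_law: "distr (P 0) lborel T' = exp_law r" using assms(4) by (simp add: distributed_def)
    have "AE t in distr (P 0) lborel T'. 0 < t"
      unfolding T'_law by (rule L0.AE_clock_pos)
    then have pos: "AE \<omega> in P 0. 0 < T' \<omega>" by (subst (asm) AE_distr_iff) auto
    have "(\<lambda>\<omega>. running_inf X' (T' \<omega>) \<omega>) = (\<lambda>\<omega>. if 0 \<le> T' \<omega> then J \<omega> else Inf {})"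
      by (auto simp: fun_eq_iff running_inf_def J_def low_def)
    then have [measurable]: "(\<lambda>\<omega>. running_inf X' (T' \<omega>) \<omega>) \<in> borel_measurable (P 0)" by simp
    have "(\<integral>\<omega>. g (y + running_inf X' (T' \<omega>) \<omega>) \<partial>P 0) = (\<integral>\<omega>. g (y + J \<omega>) \<partial>P 0)"
    proof (rule integral_cong_AE)
      show "AE \<omega> in P 0. g (y + running_inf X' (T' \<omega>) \<omega>) = g (y + J \<omega>)"
        using pos by eventually_elim (simp add: running_inf_def J_def low_def)
    qed measurable
    then show ?thesis by (simp add: \<kappa>_def kappa_def)
  qed
  have K_low_mean: "\<kappa> y = (enn2real (L0.low_mean (\<lambda>y. ennreal (g y)) y) - enn2real (L0.low_mean (\<lambda>y. ennreal (- g y)) y)) / r" for y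
    unfolding kappa_J real_lebesgue_integral_def[OF g_int]
    using low_mean_J[of "\<lambda>y. ennreal (g y)" y] low_mean_J[of "\<lambda>y. ennreal (- g y)" y] by simp
  have K_cont: "continuous_on UNIV \<kappa>"
    unfolding kappa_J[abs_def]
    by (intro continuous_on_divide continuous_on_const integrable_translates assms(6,7) g_int) (use assms(1) in auto)
  have K_mono: "mono \<kappa>"
  proof (rule monoI)
    fix y y' :: real assume "y \<le> y'"
    then have "(\<integral>\<omega>. g (y + J \<omega>) \<partial>P 0) \<le> (\<integral>\<omega>. g (y' + J \<omega>) \<partial>P 0)"
      by (rule monoD[OF integrable_translates(2)[OF assms(6,7) g_int]])
    then show "\<kappa> y \<le> \<kappa> y'" using assms(1) by (simp add: kappa_J divide_right_mono)
  qed
  have stop: "levy_stopping (P x) X x (P 0) X' r g \<kappa>" for x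
    by (intro levy_stopping.intro levy_stopping_axioms.intro pair assms(6) flow low_mean_p low_mean_n K_low_mean K_cont K_mono)
  have opt: "cost (P x) X r g c (entrance_time X \<kappa> c) = value_fun P X r g x c"
    "value_fun P X r g x c \<le> c" "value_fun P X r g x c = c \<longleftrightarrow> c \<le> \<kappa> x" for x
    unfolding value_fun_def using levy_stopping.optimal_value[OF stop, of x c] by blast+
  have "value_fun P X r g x c < c \<longleftrightarrow> \<kappa> x < c" for x
    using opt(2,3)[of x] by auto
  moreover have "stopping_time (nat_filtration (P x) X) (entrance_time X \<kappa> c)" for x
    by (rule levy_from.stopping_time_entrance_time[OF X K_cont K_mono])
  ultimately show ?thesis
    using opt(1,3) by (simp add: stopping_region_def continuation_region_def optimal_stopping_time_def)
qed

end
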